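(* For every $\epsilon\in(0,1)$, $$\log M^*_{\mathrm{vf}}(\bar n,\epsilon)\ \ge\ \frac{\bar nC}{1-\epsilon}+\mathcal O(\bar n^{1/3}\log\bar n)\qquad(\bar n\to\infty),$$ i.e., there exist constants $K,\bar n_0$ such that $\log M^*_{\mathrm{vf}}(\bar n,\epsilon)\ge\frac{\bar nC}{1-\epsilon}-K\bar n^{1/3}\log\bar n$ for all $\bar n\ge\bar n_0$.
   Context: Setting (CM-DMBC): finite alphabets $\mathcal X=\{1,\dots,N\}$, $\mathcal Y$; transition matrices $W_1,W_2$; given input $x$ the outputs are $(y_1,y_2)$ with probability $W_1(y_1|x)W_2(y_2|x)$, memoryless. $PW_k(y)=\sum_xP(x)W_k(y|x)$, $I_k(P)=\sum_xP(x)D(W_k(\cdot|x)\|PW_k)$ (natural logarithms), $V_k(P)=\sum_xP(x)\mathrm{Var}[\log\frac{W_k(Y_k|x)}{PW_k(Y_k)}]$ with $Y_k\sim W_k(\cdot|x)$. $C=\max_P\min_kI_k(P)$, $C_k=\max_PI_k(P)$. Standing assumptions: the maximizer $P^*$ of $\min_kI_k$ is unique, $P^*(x)>0$ for all $x$, $V_k(P^* )>0$ and $C_k>C$ for $k=1,2$. An $(\bar n,M,\epsilon)$-VLF code consists of: (1) a random variable $U$ on a set $\mathcal U$ with $|\mathcal U|\le3$, known at encoder and decoders; (2) encoding functions $f_i:\mathcal U\times\{1,\dots,M\}\times\mathcal Y^{i-1}\times\mathcal Y^{i-1}\to\mathcal X$, $X_i=f_i(U,J,Y_1^{i-1},Y_2^{i-1})$,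 with $J$ uniform on $\{1,\dots,M\}$; (3) nonnegative integer-valued random variables $\tau_1,\tau_2$, $\tau_k$ a stopping time of the filtration $\sigma(U,Y_k^i)$, with $\mathbb E[\max_k\tau_k]\le\bar n$; (4) decoders $g_{k,i}:\mathcal U\times\mathcal Y^i\to\{1,\dots,M\}$ with $\mathbb P[J\ne g_{k,\tau_k}(U,Y_k^{\tau_k})]\le\epsilon$, $k=1,2$. $M^*_{\mathrm{vf}}(\bar n,\epsilon)$ is the largest $M$ for which an $(\bar n,M,\epsilon)$-VLF code exists. *)

theory Defs
  imports "HOL-Probability.Probability"
begin

definition stochastic :: "('x::finite \<Rightarrow> 'y::finite \<Rightarrow> real) \<Rightarrow> bool" where
  "stochastic W \<longleftrightarrow> (\<forall>x y. 0 \<le> W x y) \<and> (\<forall>x. (\<Sum>y\<in>UNIV. W x y) = 1)"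

definition is_dist :: "('x::finite \<Rightarrow> real) \<Rightarrow> bool" where
  "is_dist P \<longleftrightarrow> (\<forall>x. 0 \<le> P x) \<and> (\<Sum>x\<in>UNIV. P x) = 1"

definition out_dist :: "('x::finite \<Rightarrow> 'y \<Rightarrow> real) \<Rightarrow> ('x \<Rightarrow> real) \<Rightarrow> 'y \<Rightarrow> real" where
  "out_dist W P y = (\<Sum>x\<in>UNIV. P x * W x y)"

text \<open>Information density log(W(y|x)/PW(y)), with the convention 0 log 0 = 0 (natural log).\<close>
definition info_dens :: "('x::finite \<Rightarrow> 'y \<Rightarrow> real) \<Rightarrow> ('x \<Rightarrow> real) \<Rightarrow> 'x \<Rightarrow> 'y \<Rightarrow> real" where
  "info_dens W P x y = (if W x y = 0 then 0 else ln (W x y / out_dist W P y))"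

definition mutual_info :: "('x::finite \<Rightarrow> 'y::finite \<Rightarrow> real) \<Rightarrow> ('x \<Rightarrow> real) \<Rightarrow> real" where
  "mutual_info W P = (\<Sum>x\<in>UNIV. P x * (\<Sum>y\<in>UNIV. W x y * info_dens W P x y))"

definition disp :: "('x::finite \<Rightarrow> 'y::finite \<Rightarrow> real) \<Rightarrow> ('x \<Rightarrow> real) \<Rightarrow> real" where
  "disp W P = (\<Sum>x\<in>UNIV. P x *
     (\<Sum>y\<in>UNIV. W x y * (info_dens W P x y - (\<Sum>y'\<in>UNIV. W x y' * info_dens W P x y'))\<^sup>2))"

definition cap_common :: "('x::finite \<Rightarrow> 'y::finite \<Rightarrow> real) \<Rightarrow> ('x \<Rightarrow> 'y \<Rightarrow> real) \<Rightarrow> real" where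
  "cap_common W1 W2 = (SUP P\<in>{P. is_dist P}. min (mutual_info W1 P) (mutual_info W2 P))"

definition cap_single :: "('x::finite \<Rightarrow> 'y::finite \<Rightarrow> real) \<Rightarrow> real" where
  "cap_single W = (SUP P\<in>{P. is_dist P}. mutual_info W P)"

text \<open>VLF codes. U takes values in nat (support of at most 3 points), the message J is uniform on
  {1..M}. Encoder f u j y1 y2 gives X_i from U, J and the past outputs Y_1^{i-1}, Y_2^{i-1}
  (i-1 = length of the lists). A stopping time of the filtration sigma(U, Y_k^i) is represented by
  a stopping rule st: tau_k = least n such that st u (Y_k^n). Decoder g u y gives g_{k,i}(u, y^i)
  with i = length y.\<close>

definition prefix_prob ::
  "('x \<Rightarrow> 'y \<Rightarrow> real) \<Rightarrow> ('x \<Rightarrow> 'y \<Rightarrow> real) \<Rightarrow> nat pmf \<Rightarrow> nat \<Rightarrow>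
   (nat \<Rightarrow> nat \<Rightarrow> 'y list \<Rightarrow> 'y list \<Rightarrow> 'x) \<Rightarrow> nat \<Rightarrow> nat \<Rightarrow> 'y list \<Rightarrow> 'y list \<Rightarrow> real" where
  "prefix_prob W1 W2 PU M f u j a b =
     pmf PU u / real M *
     (\<Prod>i<length a. W1 (f u j (take i a) (take i b)) (a ! i) * W2 (f u j (take i a) (take i b)) (b ! i))"

definition event_prob ::
  "('x \<Rightarrow> 'y::finite \<Rightarrow> real) \<Rightarrow> ('x \<Rightarrow> 'y \<Rightarrow> real) \<Rightarrow> nat pmf \<Rightarrow> nat \<Rightarrow>
   (nat \<Rightarrow> nat \<Rightarrow> 'y list \<Rightarrow> 'y list \<Rightarrow> 'x) \<Rightarrow> nat \<Rightarrow>
   (nat \<Rightarrow> nat \<Rightarrow> 'y list \<Rightarrow> 'y list \<Rightarrow> bool) \<Rightarrow> real" where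
  "event_prob W1 W2 PU M f n E =
     (\<Sum>u\<in>set_pmf PU. \<Sum>j\<in>{1..M}. \<Sum>a\<in>{a. length a = n}. \<Sum>b\<in>{b. length b = n}.
        if E u j a b then prefix_prob W1 W2 PU M f u j a b else 0)"

definition stopped_by :: "(nat \<Rightarrow> 'y list \<Rightarrow> bool) \<Rightarrow> nat \<Rightarrow> 'y list \<Rightarrow> bool" where
  "stopped_by st u ys \<longleftrightarrow> (\<exists>m\<le>length ys. st u (take m ys))"

definition stops_at :: "(nat \<Rightarrow> 'y list \<Rightarrow> bool) \<Rightarrow> nat \<Rightarrow> 'y list \<Rightarrow> bool" where
  "stops_at st u ys \<longleftrightarrow> st u ys \<and> (\<forall>m<length ys. \<not> st u (take m ys))"

definition vlf_code ::
  "('x \<Rightarrow> 'y::finite \<Rightarrow> real) \<Rightarrow> ('x \<Rightarrow> 'y \<Rightarrow> real) \<Rightarrow> real \<Rightarrow> nat \<Rightarrow> real \<Rightarrow>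
   nat pmf \<Rightarrow> (nat \<Rightarrow> nat \<Rightarrow> 'y list \<Rightarrow> 'y list \<Rightarrow> 'x) \<Rightarrow>
   (nat \<Rightarrow> 'y list \<Rightarrow> bool) \<Rightarrow> (nat \<Rightarrow> 'y list \<Rightarrow> bool) \<Rightarrow>
   (nat \<Rightarrow> 'y list \<Rightarrow> nat) \<Rightarrow> (nat \<Rightarrow> 'y list \<Rightarrow> nat) \<Rightarrow> bool" where
  "vlf_code W1 W2 nbar M eps PU f st1 st2 g1 g2 \<longleftrightarrow>
     1 \<le> M \<and> finite (set_pmf PU) \<and> card (set_pmf PU) \<le> 3 \<and>
     (\<forall>u ys. g1 u ys \<in> {1..M}) \<and> (\<forall>u ys. g2 u ys \<in> {1..M}) \<and>
     \<comment> \<open>tau_1, tau_2 are (almost surely) finite, i.e. nonnegative integer valued\<close>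
     (\<Sum>n. ennreal (event_prob W1 W2 PU M f n (\<lambda>u j a b. stops_at st1 u a))) = 1 \<and>
     (\<Sum>n. ennreal (event_prob W1 W2 PU M f n (\<lambda>u j a b. stops_at st2 u b))) = 1 \<and>
     \<comment> \<open>E[max(tau_1, tau_2)] <= nbar\<close>
     (\<Sum>n. ennreal (real n * event_prob W1 W2 PU M f n
          (\<lambda>u j a b. stopped_by st1 u a \<and> stopped_by st2 u b \<and> (stops_at st1 u a \<or> stops_at st2 u b))))
       \<le> ennreal nbar \<and>
     \<comment> \<open>P[J ~= g_{k,tau_k}(U, Y_k^tau_k)] <= eps\<close>
     (\<Sum>n. ennreal (event_prob W1 W2 PU M f n (\<lambda>u j a b. stops_at st1 u a \<and> g1 u a \<noteq> j))) \<le> ennreal eps \<and>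
     (\<Sum>n. ennreal (event_prob W1 W2 PU M f n (\<lambda>u j a b. stops_at st2 u b \<and> g2 u b \<noteq> j))) \<le> ennreal eps"

definition vlf_achievable ::
  "('x \<Rightarrow> 'y::finite \<Rightarrow> real) \<Rightarrow> ('x \<Rightarrow> 'y \<Rightarrow> real) \<Rightarrow> real \<Rightarrow> nat \<Rightarrow> real \<Rightarrow> bool" where
  "vlf_achievable W1 W2 nbar M eps \<longleftrightarrow>
     (\<exists>PU f st1 st2 g1 g2. vlf_code W1 W2 nbar M eps PU f st1 st2 g1 g2)"

end

theory Submission
  imports Defs "HOL-Real_Asymp.Real_Asymp"
begin

text \<open>
  At \<open>P\<^sup>*\<close> the two mutual informations agree and their gradients along the simplex are opposite,
  since otherwise a common ascent direction would contradict optimality. Hence perturbing \<open>P\<^sup>*\<close> by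
  \<open>\<plusminus>d v\<close> trades the two rates against each other at a cost of only \<open>O(d\<^sup>2)\<close> per channel use.

  Let \<open>x = nbar / (1 - eps)\<close>. With an i.i.d. \<open>P\<^sup>*\<close> random code the two accumulated information
  densities drift apart by about \<open>\<surd>x\<close>. After all but \<open>O(x\<^bsup>2/3\<^esup>)\<close> of the channel uses the encoder, who
  sees both outputs, spends \<open>T \<approx> x\<^bsup>2/3\<^esup>\<close> channel uses with \<open>P\<^sup>* + d v\<close> and then \<open>P\<^sup>* - d v\<close>, where
  \<open>d \<approx> \<surd>x / T\<close> up to logarithms, switching at a time \<open>s\<close> that cancels the gap; this costs \<open>T d\<^sup>2 \<approx> x\<^bsup>1/3\<^esup> ln x\<close>.
  The fluctuations accumulated during this and the final \<open>P\<^sup>*\<close> phase are again of order \<open>x\<^bsup>1/3\<^esup>\<close> up to logarithms.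
  A receiver does not know \<open>s\<close>, but it may simply test all pairs of a message and a switching time: this
  multiplies the error probability by at most \<open>T + 1\<close>, i.e. it costs \<open>O(ln x)\<close> in \<open>ln M\<close>.
  The expected decoding time is controlled because the balanced information density is
  a convex combination of the two, whose phase-one deviation has mean zero.

  Finally \<open>U\<close> makes both receivers stop at time \<open>0\<close> with probability almost \<open>eps\<close>, which stretches
  \<open>nbar\<close> to \<open>x\<close>; a single deterministic codebook suffices since error probabilities can be charged
  to the decoding time with weight \<open>x\<^sup>2\<close>.
\<close>

section \<open>Weighted paths and random coding\<close>

text \<open>Every process below has a finite horizon, so probabilities and expectations are finite
  sums over lists with this weight; \<open>\<kappa> h z\<close> plays the role of the conditional
  probability of the next letter \<open>z\<close> after the history \<open>h\<close>.\<close>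

definition path_weight :: "('z list \<Rightarrow> 'z \<Rightarrow> real) \<Rightarrow> 'z list \<Rightarrow> real" where
  "path_weight \<kappa> h = (\<Prod>i<length h. \<kappa> (take i h) (h ! i))"

lemma finite_lists_length [simp]: "finite {h::'z::finite list. length h = n}"
  using finite_lists_length_eq[of "UNIV::'z set" n] by simp

lemma sum_lists_Suc:
  fixes \<phi> :: "'z::finite list \<Rightarrow> real"
  shows "(\<Sum>h | length h = Suc n. \<phi> h) = (\<Sum>h | length h = n. \<Sum>z\<in>UNIV. \<phi> (h @ [z]))"
proof -
  have "bij_betw (\<lambda>(h, z). h @ [z]) ({h. length h = n} \<times> UNIV) {h::'z list. length h = Suc n}"
    unfolding bij_betw_def
  proof
    show "inj_on (\<lambda>(h, z). h @ [z]) ({h::'z list. length h = n} \<times> UNIV)"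
      by (auto simp: inj_on_def)
    have "h \<in> (\<lambda>(h, z). h @ [z]) ` ({h. length h = n} \<times> UNIV)" if "length h = Suc n" for h :: "'z list"
      using that by (intro image_eqI[of _ _ "(butlast h, last h)"])
        (auto simp: length_greater_0_conv[symmetric] simp del: length_greater_0_conv)
    then show "(\<lambda>(h, z). h @ [z]) ` ({h. length h = n} \<times> UNIV) = {h::'z list. length h = Suc n}"
      by auto
  qed
  then have "(\<Sum>h | length h = Suc n. \<phi> h) = (\<Sum>(h, z)\<in>{h. length h = n} \<times> UNIV. \<phi> (h @ [z]))"
    by (subst sum.reindex_bij_betw[symmetric]) (auto simp: case_prod_unfold)
  then show ?thesis
    by (simp add: sum.cartesian_product)
qed

lemma path_weight_Nil [simp]: "path_weight \<kappa> [] = 1"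
  by (simp add: path_weight_def)

lemma path_weight_snoc: "path_weight \<kappa> (h @ [z]) = path_weight \<kappa> h * \<kappa> h z"
  by (simp add: path_weight_def nth_append)

lemma path_weight_nonneg:
  "(\<And>h z. 0 \<le> \<kappa> h z) \<Longrightarrow> 0 \<le> path_weight \<kappa> h"
  by (simp add: path_weight_def prod_nonneg)

lemma sum_path_weight_Suc:
  fixes \<kappa> :: "'z::finite list \<Rightarrow> 'z \<Rightarrow> real"
  shows "(\<Sum>h | length h = Suc n. path_weight \<kappa> h * \<phi> h)
       = (\<Sum>h | length h = n. path_weight \<kappa> h * (\<Sum>z\<in>UNIV. \<kappa> h z * \<phi> (h @ [z])))"
  by (simp add: sum_lists_Suc path_weight_snoc sum_distrib_left mult.assoc)

text \<open>The letters after position \<open>n\<close> sum out one at a time because the kernel is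
  normalised. This moves a statement about a prefix to any longer horizon and back.\<close>

lemma path_weight_marginal:
  fixes \<kappa> :: "'z::finite list \<Rightarrow> 'z \<Rightarrow> real"
  assumes "\<And>h. length h < N \<Longrightarrow> (\<Sum>z\<in>UNIV. \<kappa> h z) = 1" and "n \<le> N"
  shows "(\<Sum>h | length h = N. path_weight \<kappa> h * \<phi> (take n h))
       = (\<Sum>h | length h = n. path_weight \<kappa> h * \<phi> h)"
  using assms(2,1)
proof (induction N rule: dec_induct)
  case base
  then show ?case by (intro sum.cong) auto
next
  case (step N)
  have "(\<Sum>h | length h = Suc N. path_weight \<kappa> h * \<phi> (take n h))
      = (\<Sum>h | length h = N. path_weight \<kappa> h * (\<Sum>z\<in>UNIV. \<kappa> h z * \<phi> (take n h)))"
    unfolding sum_path_weight_Suc using step by (intro sum.cong) auto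
  also have "\<dots> = (\<Sum>h | length h = N. path_weight \<kappa> h * \<phi> (take n h))"
    using step.prems by (intro sum.cong) (auto simp: sum_distrib_right[symmetric])
  finally show ?case using step by simp
qed

lemma sum_path_weight:
  fixes \<kappa> :: "'z::finite list \<Rightarrow> 'z \<Rightarrow> real"
  assumes "\<And>h. length h < N \<Longrightarrow> (\<Sum>z\<in>UNIV. \<kappa> h z) = 1"
  shows "(\<Sum>h | length h = N. path_weight \<kappa> h) = 1"
  using path_weight_marginal[of N \<kappa> 0 "\<lambda>_. 1", OF assms] by simp

lemma sum_prod_lists:
  fixes F :: "nat \<Rightarrow> 'z::finite \<Rightarrow> real"
  shows "(\<Sum>h | length h = N. \<Prod>i<N. F i (h ! i)) = (\<Prod>i<N. \<Sum>z\<in>UNIV. F i z)"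
proof (induction N)
  case (Suc N)
  have "(\<Sum>h | length h = Suc N. \<Prod>i<Suc N. F i (h ! i))
      = (\<Sum>h | length h = N. \<Sum>z\<in>UNIV. (\<Prod>i<N. F i (h ! i)) * F N z)"
    unfolding sum_lists_Suc by (intro sum.cong) (auto simp: nth_append)
  also have "\<dots> = (\<Prod>i<Suc N. \<Sum>z\<in>UNIV. F i z)"
    by (simp add: sum_distrib_left[symmetric] sum_distrib_right[symmetric] Suc)
  finally show ?case .
qed simp

lemma sum_zip_lists:
  fixes \<phi> :: "('a::finite \<times> 'b::finite) list \<Rightarrow> real"
  shows "(\<Sum>h | length h = N. \<phi> h) = (\<Sum>a | length a = N. \<Sum>b | length b = N. \<phi> (zip a b))"
proof -
  have "bij_betw (\<lambda>(a, b). zip a b) ({a. length a = N} \<times> {b. length b = N})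
          {h::('a \<times> 'b) list. length h = N}"
    by (rule bij_betw_byWitness[where f' = "\<lambda>h. (map fst h, map snd h)"])
      (auto simp: zip_map_fst_snd)
  then have "(\<Sum>h | length h = N. \<phi> h)
      = (\<Sum>(a, b)\<in>{a. length a = N} \<times> {b. length b = N}. \<phi> (zip a b))"
    by (subst sum.reindex_bij_betw[symmetric]) (auto simp: case_prod_unfold)
  then show ?thesis by (simp add: sum.cartesian_product)
qed

section \<open>Choosing codewords with individual and pairwise costs\<close>

lemma exists_le_weighted_average:
  fixes Q :: "'s \<Rightarrow> real"
  assumes "finite S" "\<And>s. s \<in> S \<Longrightarrow> 0 \<le> Q s" "(\<Sum>s\<in>S. Q s) = 1" "(\<Sum>s\<in>S. Q s * f s) \<le> c"
  shows "\<exists>s\<in>S. f s \<le> (c::real)"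
proof (rule ccontr)
  assume "\<not> ?thesis"
  then have gt: "\<And>s. s \<in> S \<Longrightarrow> c < f s" by force
  obtain s where s: "s \<in> S" "0 < Q s"
    using assms(2,3) by (metis less_eq_real_def sum.neutral zero_neq_one)
  have "(\<Sum>s\<in>S. Q s * c) < (\<Sum>s\<in>S. Q s * f s)"
    using s gt assms(1,2)
    by (intro sum_strict_mono_ex1)
      (auto intro!: mult_left_mono mult_strict_left_mono bexI[of _ s] intro: less_imp_le)
  then show False using assms(3,4) by (simp add: sum_distrib_right[symmetric])
qed

text \<open>Generalising over \<open>F\<close> lets the induction integrate out the last codeword and absorb its
  interaction with the earlier ones into the single-codeword cost.\<close>

lemma random_coding:
  fixes Q :: "'s \<Rightarrow> real" and G :: "'s \<Rightarrow> 's \<Rightarrow> real"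
  assumes S: "finite S" "\<And>s. s \<in> S \<Longrightarrow> 0 \<le> Q s" "(\<Sum>s\<in>S. Q s) = 1"
  shows "\<exists>c. (\<forall>j. c j \<in> S) \<and>
    (\<Sum>j<M. F (c j)) + (\<Sum>j<M. \<Sum>j'\<in>{..<M} - {j}. G (c j) (c j'))
    \<le> real M * (\<Sum>s\<in>S. Q s * F s) + real M * (real M - 1) * (\<Sum>s\<in>S. Q s * (\<Sum>s'\<in>S. Q s' * G s s'))"
proof (induction M arbitrary: F)
  case 0
  have "S \<noteq> {}" using S(3) by auto
  then show ?case by auto
next
  case (Suc M)
  define EF where "EF = (\<Sum>s\<in>S. Q s * F s)"
  define EG where "EG = (\<Sum>s\<in>S. Q s * (\<Sum>s'\<in>S. Q s' * G s s'))"
  \<comment> \<open>\<open>F'\<close> charges an earlier codeword in advance with its expected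
    interaction, in both orders, with the codeword still to come.\<close>
  define F' where "F' s = F s + (\<Sum>s'\<in>S. Q s' * (G s s' + G s' s))" for s
  have "(\<Sum>s\<in>S. Q s * (\<Sum>s'\<in>S. Q s' * G s' s)) = (\<Sum>s\<in>S. \<Sum>s'\<in>S. Q s * (Q s' * G s' s))"
    by (simp add: sum_distrib_left)
  also have "\<dots> = (\<Sum>s'\<in>S. \<Sum>s\<in>S. Q s * (Q s' * G s' s))"
    by (rule sum.swap)
  also have "\<dots> = EG"
    unfolding EG_def by (simp add: sum_distrib_left mult_ac)
  finally have sw: "(\<Sum>s\<in>S. Q s * (\<Sum>s'\<in>S. Q s' * G s' s)) = EG" .
  have EF': "(\<Sum>s\<in>S. Q s * F' s) = EF + 2 * EG"
    using sw unfolding F'_def EF_def EG_def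
    by (simp add: distrib_left sum.distrib)
  obtain c where c: "\<forall>j. c j \<in> S" and
    le: "(\<Sum>j<M. F' (c j)) + (\<Sum>j<M. \<Sum>j'\<in>{..<M} - {j}. G (c j) (c j'))
      \<le> real M * (EF + 2 * EG) + real M * (real M - 1) * EG"
    using Suc.IH[of F'] unfolding EF' EG_def by auto
  \<comment> \<open>\<open>H s\<close> is the increase of the total cost when \<open>s\<close>
    becomes codeword number \<open>M\<close>, so some \<open>s\<close> does no worse than the mean
    of \<open>H\<close>.\<close>
  define H where "H s = F s + (\<Sum>j<M. G (c j) s + G s (c j))" for s
  have "(\<Sum>s\<in>S. Q s * H s) = EF + (\<Sum>s\<in>S. \<Sum>j<M. Q s * (G (c j) s + G s (c j)))"
    unfolding H_def EF_def by (simp add: distrib_left sum.distrib sum_distrib_left)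
  also have "\<dots> = EF + (\<Sum>j<M. F' (c j)) - (\<Sum>j<M. F (c j))"
    unfolding F'_def by (subst sum.swap) (simp add: sum.distrib)
  finally obtain s where s: "s \<in> S" "H s \<le> EF + (\<Sum>j<M. F' (c j)) - (\<Sum>j<M. F (c j))"
    using exists_le_weighted_average[OF S, of H] by (metis order_refl)
  define c' where "c' = c(M := s)"
  have 1: "(\<Sum>j<Suc M. F (c' j)) = (\<Sum>j<M. F (c j)) + F s"
    by (simp add: c'_def)
  have "(\<Sum>j<Suc M. \<Sum>j'\<in>{..<Suc M} - {j}. G (c' j) (c' j'))
      = (\<Sum>j<M. \<Sum>j'\<in>{..<Suc M} - {j}. G (c' j) (c' j')) + (\<Sum>j'\<in>{..<M}. G s (c j'))"
    by (auto simp: c'_def lessThan_Suc intro!: sum.cong)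
  also have "(\<Sum>j<M. \<Sum>j'\<in>{..<Suc M} - {j}. G (c' j) (c' j'))
      = (\<Sum>j<M. G (c j) s + (\<Sum>j'\<in>{..<M} - {j}. G (c j) (c j')))"
  proof (intro sum.cong refl)
    fix j assume j: "j \<in> {..<M}"
    then have "{..<Suc M} - {j} = insert M ({..<M} - {j})" by auto
    with j show "(\<Sum>j'\<in>{..<Suc M} - {j}. G (c' j) (c' j'))
      = G (c j) s + (\<Sum>j'\<in>{..<M} - {j}. G (c j) (c j'))"
      by (auto simp: c'_def intro!: sum.cong)
  qed
  finally have 2: "(\<Sum>j<Suc M. \<Sum>j'\<in>{..<Suc M} - {j}. G (c' j) (c' j'))
      = (\<Sum>j<M. G (c j) s + G s (c j)) + (\<Sum>j<M. \<Sum>j'\<in>{..<M} - {j}. G (c j) (c j'))"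
    by (simp add: sum.distrib)
  have "(\<Sum>j<Suc M. F (c' j)) + (\<Sum>j<Suc M. \<Sum>j'\<in>{..<Suc M} - {j}. G (c' j) (c' j'))
     \<le> real M * (EF + 2 * EG) + real M * (real M - 1) * EG + EF"
    using s le unfolding 1 2 H_def by linarith
  also have "\<dots> = real (Suc M) * EF + real (Suc M) * (real (Suc M) - 1) * EG"
    by (simp add: algebra_simps)
  finally show ?case
    using c s unfolding EF_def EG_def by (intro exI[of _ c']) (auto simp: c'_def)
qed

section \<open>Exponential tail bounds for bounded martingales\<close>

lemma exp_le_quadratic: "\<bar>x\<bar> \<le> 1 \<Longrightarrow> exp x \<le> 1 + x + x\<^sup>2" for x :: real
proof (cases "0 \<le> x")
  case False
  assume "\<bar>x\<bar> \<le> 1"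
  \<comment> \<open>For negative \<open>x\<close> the claim becomes a lower bound on
    \<open>exp (- x)\<close>, since \<open>(1 - x) * (1 + x + x^2) = 1 - x^3\<close>, which is at
    least 1.\<close>
  have "1 - x \<le> exp (- x)" using exp_ge_add_one_self[of "- x"] by simp
  moreover have "1 \<le> (1 - x) * (1 + x + x\<^sup>2)"
  proof -
    have "x ^ 3 \<le> 0" using False by (simp add: power_le_zero_eq)
    then show ?thesis by (simp add: algebra_simps power2_eq_square power3_eq_cube)
  qed
  moreover have "0 \<le> 1 + x + x\<^sup>2" using \<open>\<bar>x\<bar> \<le> 1\<close> by (smt (verit) zero_le_power2)
  ultimately have "1 \<le> exp (- x) * (1 + x + x\<^sup>2)"
    by (meson mult_right_mono order_trans)
  then show ?thesis by (simp add: exp_minus field_simps)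
qed (use exp_bound in auto)

text \<open>Martingale differences in kernel form: \<open>Z h z\<close> is the increment on seeing
  \<open>z\<close> after \<open>h\<close>. Centring is demanded after every history, even one of
  weight zero, so conditional expectations never involve a division.\<close>

locale martingale_differences =
  fixes \<kappa> :: "'z::finite list \<Rightarrow> 'z \<Rightarrow> real" and Z :: "'z list \<Rightarrow> 'z \<Rightarrow> real" and B :: real
  assumes nonneg: "0 \<le> \<kappa> h z" and total: "(\<Sum>z\<in>UNIV. \<kappa> h z) = 1"
    and centred: "(\<Sum>z\<in>UNIV. \<kappa> h z * Z h z) = 0"
    and bounded: "\<bar>Z h z\<bar> \<le> B" and B_pos: "0 < B"
begin

text \<open>Removing the last letter either leaves the sum alone or removes one centred increment;
  \<open>min m N\<close> covers both cases.\<close>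

lemma mean_zero:
  "m \<le> N \<Longrightarrow> (\<Sum>h | length h = N. path_weight \<kappa> h * (\<Sum>i<m. Z (take i h) (h ! i))) = 0"
proof (induction N arbitrary: m)
  case (Suc N)
  have *: "(\<Sum>z\<in>UNIV. \<kappa> h z * (\<Sum>i<m. Z (take i (h @ [z])) ((h @ [z]) ! i)))
      = (\<Sum>i<min m N. Z (take i h) (h ! i))" if "length h = N" for h
  proof (cases "m \<le> N")
    case True
    have "(\<Sum>i<m. Z (take i (h @ [z])) ((h @ [z]) ! i)) = (\<Sum>i<m. Z (take i h) (h ! i))" for z
      using True that by (intro sum.cong) (auto simp: nth_append)
    then show ?thesis using True total by (simp add: sum_distrib_right[symmetric] min_def)
  next
    case False
    with Suc.prems have m: "m = Suc N" by simp
    have "(\<Sum>i<m. Z (take i (h @ [z])) ((h @ [z]) ! i)) = (\<Sum>i<N. Z (take i h) (h ! i)) + Z h z" for z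
      unfolding m using that by (auto simp: nth_append intro!: sum.cong)
    then show ?thesis
      using m total centred by (simp add: distrib_left sum.distrib sum_distrib_right[symmetric])
  qed
  have "(\<Sum>h | length h = Suc N. path_weight \<kappa> h * (\<Sum>i<m. Z (take i h) (h ! i)))
     = (\<Sum>h | length h = N. path_weight \<kappa> h * (\<Sum>i<min m N. Z (take i h) (h ! i)))"
    unfolding sum_path_weight_Suc using * by (intro sum.cong) auto
  also have "\<dots> = 0" by (rule Suc.IH) simp
  finally show ?case .
qed simp

lemma exp_moment_step:
  assumes "\<bar>\<theta>\<bar> * B \<le> 1"
  shows "(\<Sum>z\<in>UNIV. \<kappa> h z * exp (\<theta> * Z h z)) \<le> exp (\<theta>\<^sup>2 * B\<^sup>2)"
proof -
  have "exp (\<theta> * Z h z) \<le> 1 + \<theta> * Z h z + \<theta>\<^sup>2 * B\<^sup>2" for z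
  proof -
    have "\<bar>\<theta> * Z h z\<bar> \<le> \<bar>\<theta>\<bar> * B" using bounded[of h z] by (simp add: abs_mult mult_left_mono)
    moreover from this have "(\<theta> * Z h z)\<^sup>2 \<le> (\<bar>\<theta>\<bar> * B)\<^sup>2"
      by (metis abs_ge_zero power2_abs power_mono)
    ultimately show ?thesis
      using exp_le_quadratic[of "\<theta> * Z h z"] assms by (simp add: power_mult_distrib)
  qed
  then have "(\<Sum>z\<in>UNIV. \<kappa> h z * exp (\<theta> * Z h z)) \<le> (\<Sum>z\<in>UNIV. \<kappa> h z * (1 + \<theta> * Z h z + \<theta>\<^sup>2 * B\<^sup>2))"
    by (intro sum_mono mult_left_mono nonneg)
  also have "\<dots> = (\<Sum>z\<in>UNIV. \<kappa> h z) * (1 + \<theta>\<^sup>2 * B\<^sup>2) + \<theta> * (\<Sum>z\<in>UNIV. \<kappa> h z * Z h z)"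
    by (simp add: algebra_simps sum.distrib sum_distrib_left sum_distrib_right)
  also have "\<dots> = 1 + \<theta>\<^sup>2 * B\<^sup>2" by (simp add: total centred)
  also have "\<dots> \<le> exp (\<theta>\<^sup>2 * B\<^sup>2)" by simp
  finally show ?thesis .
qed

text \<open>Conditioning on all but the last letter splits off one factor, which
  \<open>exp_moment_step\<close> bounds uniformly in the history.\<close>

lemma exp_moment:
  assumes "\<bar>\<theta>\<bar> * B \<le> 1" "lo \<le> hi"
  shows "(\<Sum>h | length h = hi. path_weight \<kappa> h * exp (\<theta> * (\<Sum>i=lo..<hi. Z (take i h) (h ! i))))
     \<le> exp (\<theta>\<^sup>2 * B\<^sup>2 * real (hi - lo))"
  using assms(2)
proof (induction hi rule: dec_induct)
  case base
  then show ?case by (simp add: sum_path_weight[OF total])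
next
  case (step hi)
  let ?S = "\<lambda>h. \<Sum>i=lo..<hi. Z (take i h) (h ! i)"
  have *: "(\<Sum>i=lo..<Suc hi. Z (take i (h @ [z])) ((h @ [z]) ! i)) = ?S h + Z h z"
    if "length h = hi" for h z
    using step.hyps that by (auto simp: nth_append intro!: sum.cong)
  have "(\<Sum>h | length h = Suc hi. path_weight \<kappa> h * exp (\<theta> * (\<Sum>i=lo..<Suc hi. Z (take i h) (h ! i))))
      = (\<Sum>h | length h = hi. path_weight \<kappa> h * (exp (\<theta> * ?S h) * (\<Sum>z\<in>UNIV. \<kappa> h z * exp (\<theta> * Z h z))))"
    unfolding sum_path_weight_Suc
  proof (intro sum.cong refl arg_cong2[of _ _ _ _ "(*)"])
    fix h :: "'z list" assume "h \<in> {h. length h = hi}"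
    then have h: "length h = hi" by simp
    show "(\<Sum>z\<in>UNIV. \<kappa> h z * exp (\<theta> * (\<Sum>i=lo..<Suc hi. Z (take i (h @ [z])) ((h @ [z]) ! i))))
      = exp (\<theta> * ?S h) * (\<Sum>z\<in>UNIV. \<kappa> h z * exp (\<theta> * Z h z))"
      unfolding *[OF h] distrib_left exp_add sum_distrib_left[of "exp (\<theta> * ?S h)"]
      by (intro sum.cong refl) (simp add: mult_ac)
  qed
  also have "\<dots> \<le> (\<Sum>h | length h = hi. path_weight \<kappa> h * (exp (\<theta> * ?S h) * exp (\<theta>\<^sup>2 * B\<^sup>2)))"
    by (intro sum_mono mult_left_mono path_weight_nonneg exp_moment_step assms nonneg) auto
  also have "\<dots> = (\<Sum>h | length h = hi. path_weight \<kappa> h * exp (\<theta> * ?S h)) * exp (\<theta>\<^sup>2 * B\<^sup>2)"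
    by (simp add: sum_distrib_right mult.assoc)
  also have "\<dots> \<le> exp (\<theta>\<^sup>2 * B\<^sup>2 * real (hi - lo)) * exp (\<theta>\<^sup>2 * B\<^sup>2)"
    using step.IH by (intro mult_right_mono) auto
  also have "\<dots> = exp (\<theta>\<^sup>2 * B\<^sup>2 * real (Suc hi - lo))"
    using step.hyps by (simp add: exp_add[symmetric] Suc_diff_le algebra_simps)
  finally show ?case .
qed

lemma upper_tail:
  assumes "lo \<le> hi" "hi \<le> N" "real (hi - lo) \<le> t" "0 < l" "l \<le> t"
  shows "(\<Sum>h | length h = N. path_weight \<kappa> h *
      of_bool (2 * B * sqrt (l * t) < (\<Sum>i=lo..<hi. Z (take i h) (h ! i)))) \<le> exp (- l)"
proof -
  \<comment> \<open>Chernoff's method: this \<open>\<theta>\<close> makes the exponential moment at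
    most \<open>exp l\<close> while the threshold contributes \<open>exp (- (2 * l))\<close>; the
    condition \<open>l \<le> t\<close> keeps \<open>\<theta> * B\<close> at most 1.\<close>
  define \<theta> where "\<theta> = sqrt (l / t) / B"
  have t: "0 < t" using assms by simp
  have th: "\<bar>\<theta>\<bar> * B \<le> 1" "0 \<le> \<theta>" using assms t B_pos by (auto simp: \<theta>_def)
  have th2: "\<theta>\<^sup>2 * B\<^sup>2 = l / t" using B_pos assms t by (simp add: \<theta>_def power_divide)
  have "sqrt (l / t) * sqrt (l * t) = sqrt (l\<^sup>2)"
    using t unfolding real_sqrt_mult[symmetric] by (simp add: power2_eq_square)
  then have thr: "\<theta> * (2 * B * sqrt (l * t)) = 2 * l"
    using B_pos assms by (simp add: \<theta>_def)
  let ?S = "\<lambda>h. \<Sum>i=lo..<hi. Z (take i h) (h ! i)"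
  have S: "?S h = ?S (take hi h)" for h
    by (intro sum.cong) (auto simp: min_def)
  have "(\<Sum>h | length h = N. path_weight \<kappa> h * of_bool (2 * B * sqrt (l * t) < ?S h))
     = (\<Sum>h | length h = N. path_weight \<kappa> h * (\<lambda>h. of_bool (2 * B * sqrt (l * t) < ?S h)) (take hi h))"
    by (subst S) simp
  also have "\<dots> = (\<Sum>h | length h = hi. path_weight \<kappa> h * of_bool (2 * B * sqrt (l * t) < ?S h))"
    using assms by (subst path_weight_marginal) (auto simp: total)
  also have "\<dots> \<le> (\<Sum>h | length h = hi. path_weight \<kappa> h * (exp (\<theta> * ?S h) * exp (- (2 * l))))"
  proof (intro sum_mono mult_left_mono path_weight_nonneg nonneg)
    fix h
    have "2 * l \<le> \<theta> * ?S h" if "2 * B * sqrt (l * t) < ?S h"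
      unfolding thr[symmetric] using that th(2) by (intro mult_left_mono) auto
    then show "of_bool (2 * B * sqrt (l * t) < ?S h) \<le> exp (\<theta> * ?S h) * exp (- (2 * l))"
      by (auto simp: exp_add[symmetric])
  qed
  also have "\<dots> = (\<Sum>h | length h = hi. path_weight \<kappa> h * exp (\<theta> * ?S h)) * exp (- (2 * l))"
    by (simp add: sum_distrib_right mult.assoc)
  also have "\<dots> \<le> exp (\<theta>\<^sup>2 * B\<^sup>2 * real (hi - lo)) * exp (- (2 * l))"
    using exp_moment[OF th(1) assms(1)] by (intro mult_right_mono) auto
  also have "\<dots> \<le> exp l * exp (- (2 * l))"
  proof -
    have "l / t * real (hi - lo) \<le> l / t * t" using assms t by (intro mult_left_mono) auto
    then show ?thesis using t unfolding th2 by simp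
  qed
  also have "\<dots> = exp (- l)" by (simp add: exp_add[symmetric])
  finally show ?thesis .
qed

end

lemma (in martingale_differences) lower_tail:
  assumes "lo \<le> hi" "hi \<le> N" "real (hi - lo) \<le> t" "0 < l" "l \<le> t"
  shows "(\<Sum>h | length h = N. path_weight \<kappa> h *
      of_bool ((\<Sum>i=lo..<hi. Z (take i h) (h ! i)) < - (2 * B * sqrt (l * t)))) \<le> exp (- l)"
proof -
  interpret neg: martingale_differences \<kappa> "\<lambda>h z. - Z h z" B
    using nonneg total centred bounded B_pos by unfold_locales (auto simp: sum_negf)
  show ?thesis
    using neg.upper_tail[OF assms] by (simp add: sum_negf less_minus_iff)
qed

section \<open>Mutual information near the optimal input\<close>

text \<open>This is D(W(.|x) || PW). For positive \<open>P\<close> it is the gradient of the mutual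
  information at \<open>P\<close>, up to an additive constant that is invisible along the
  simplex.\<close>

definition rel_info :: "('x::finite \<Rightarrow> 'y::finite \<Rightarrow> real) \<Rightarrow> ('x \<Rightarrow> real) \<Rightarrow> 'x \<Rightarrow> real" where
  "rel_info W P x = (\<Sum>y\<in>UNIV. W x y * info_dens W P x y)"

lemma out_dist_nonneg: "stochastic W \<Longrightarrow> is_dist P \<Longrightarrow> 0 \<le> out_dist W P y"
  by (auto simp: out_dist_def stochastic_def is_dist_def intro!: sum_nonneg)

lemma out_dist_pos:
  assumes "stochastic W" "is_dist P" "0 < P x" "0 < W x y"
  shows "0 < out_dist W P y"
proof -
  have "0 < P x * W x y" using assms by simp
  also have "\<dots> \<le> out_dist W P y"
    unfolding out_dist_def using assms
    by (intro member_le_sum) (auto simp: stochastic_def is_dist_def)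
  finally show ?thesis .
qed

lemma sum_out_dist:
  assumes "stochastic W" "is_dist P" shows "(\<Sum>y\<in>UNIV. out_dist W P y) = 1"
  unfolding out_dist_def using assms
  by (subst sum.swap) (simp add: stochastic_def is_dist_def sum_distrib_left[symmetric])

lemma sum_out_dist_mult:
  "(\<Sum>x\<in>UNIV. P x * (\<Sum>y\<in>UNIV. W x y * f y)) = (\<Sum>y\<in>UNIV. out_dist W P y * f y)"
  unfolding out_dist_def sum_distrib_left sum_distrib_right
  by (subst sum.swap) (simp add: mult.assoc)

text \<open>Concavity: mutual information lies below its tangent plane at \<open>P0\<close>, the gap
  being the relative entropy between the two output laws. The inequality
  \<open>ln t \<le> t - 1\<close> gives the sign of this gap.\<close>

lemma mutual_info_le:
  assumes W: "stochastic W" and P: "is_dist P" and P0: "is_dist P0" "\<And>x. 0 < P0 x"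
  shows "mutual_info W P \<le> (\<Sum>x\<in>UNIV. P x * rel_info W P0 x)"
proof -
  have 1: "P x * (W x y * info_dens W P x y) \<le> P x * (W x y * info_dens W P0 x y)
      + P x * (W x y * (out_dist W P0 y / out_dist W P y - 1))" for x y
  proof (cases "P x = 0 \<or> W x y = 0")
    case False
    then have pos: "0 < P x" "0 < W x y"
      using W P by (auto simp: stochastic_def is_dist_def less_le)
    have q: "0 < out_dist W P y" "0 < out_dist W P0 y"
      using pos out_dist_pos W P P0 by blast+
    have "info_dens W P x y - info_dens W P0 x y = ln (out_dist W P0 y / out_dist W P y)"
      using pos q by (simp add: info_dens_def ln_div)
    also have "\<dots> \<le> out_dist W P0 y / out_dist W P y - 1"
      using q by (intro ln_le_minus_one) simp
    finally have "P x * W x y * (info_dens W P x y - info_dens W P0 x y)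
        \<le> P x * W x y * (out_dist W P0 y / out_dist W P y - 1)"
      using pos by (intro mult_left_mono) auto
    then show ?thesis by (simp add: algebra_simps)
  qed auto
  have "mutual_info W P \<le> (\<Sum>x\<in>UNIV. P x * rel_info W P0 x)
      + (\<Sum>x\<in>UNIV. P x * (\<Sum>y\<in>UNIV. W x y * (out_dist W P0 y / out_dist W P y - 1)))"
    unfolding mutual_info_def rel_info_def sum_distrib_left sum.distrib[symmetric]
    by (intro sum_mono 1)
  also have "(\<Sum>x\<in>UNIV. P x * (\<Sum>y\<in>UNIV. W x y * (out_dist W P0 y / out_dist W P y - 1)))
      = (\<Sum>y\<in>UNIV. out_dist W P y * (out_dist W P0 y / out_dist W P y - 1))"
    by (rule sum_out_dist_mult)
  \<comment> \<open>Only an inequality: a letter with \<open>out_dist W P y = 0\<close> contributes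
    0 on the left.\<close>
  also have "\<dots> \<le> (\<Sum>y\<in>UNIV. out_dist W P0 y - out_dist W P y)"
    using out_dist_nonneg[OF W P0(1)] by (intro sum_mono) (auto simp: field_simps)
  also have "\<dots> = 0" by (simp add: sum_subtractf sum_out_dist W P P0)
  finally show ?thesis by simp
qed

text \<open>The converse estimate: the gap to the tangent plane is at most the chi-square distance
  of the output laws, again by \<open>ln t \<le> t - 1\<close>, now applied to the inverse
  ratio.\<close>

lemma mutual_info_ge:
  assumes W: "stochastic W" and P: "is_dist P" and P0: "is_dist P0" "\<And>x. 0 < P0 x"
  shows "(\<Sum>x\<in>UNIV. P x * rel_info W P0 x)
      - (\<Sum>y\<in>UNIV. (out_dist W P y - out_dist W P0 y)\<^sup>2 / out_dist W P0 y) \<le> mutual_info W P"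
proof -
  have 1: "P x * (W x y * info_dens W P0 x y) \<le> P x * (W x y * info_dens W P x y)
      + P x * (W x y * (out_dist W P y / out_dist W P0 y - 1))" for x y
  proof (cases "P x = 0 \<or> W x y = 0")
    case False
    then have pos: "0 < P x" "0 < W x y"
      using W P by (auto simp: stochastic_def is_dist_def less_le)
    have q: "0 < out_dist W P y" "0 < out_dist W P0 y"
      using pos out_dist_pos W P P0 by blast+
    have "info_dens W P0 x y - info_dens W P x y = ln (out_dist W P y / out_dist W P0 y)"
      using pos q by (simp add: info_dens_def ln_div)
    also have "\<dots> \<le> out_dist W P y / out_dist W P0 y - 1"
      using q by (intro ln_le_minus_one) simp
    finally have "P x * W x y * (info_dens W P0 x y - info_dens W P x y)
        \<le> P x * W x y * (out_dist W P y / out_dist W P0 y - 1)"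
      using pos by (intro mult_left_mono) auto
    then show ?thesis by (simp add: algebra_simps)
  qed auto
  \<comment> \<open>Since \<open>P0\<close> is positive everywhere, an output letter that is
    impossible under \<open>P0\<close> is impossible under every input, so division by zero is
    harmless in the chi-square sum.\<close>
  have q0: "out_dist W P y = 0" if "out_dist W P0 y = 0" for y
  proof -
    have "W x y = 0" for x
      using out_dist_pos[OF W P0, of x y] that W by (force simp: stochastic_def less_le)
    then show ?thesis by (simp add: out_dist_def)
  qed
  have "(\<Sum>x\<in>UNIV. P x * rel_info W P0 x) \<le> mutual_info W P
      + (\<Sum>x\<in>UNIV. P x * (\<Sum>y\<in>UNIV. W x y * (out_dist W P y / out_dist W P0 y - 1)))"
    unfolding mutual_info_def rel_info_def sum_distrib_left sum.distrib[symmetric]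
    by (intro sum_mono 1)
  also have "(\<Sum>x\<in>UNIV. P x * (\<Sum>y\<in>UNIV. W x y * (out_dist W P y / out_dist W P0 y - 1)))
      = (\<Sum>y\<in>UNIV. out_dist W P y * (out_dist W P y / out_dist W P0 y - 1))"
    by (rule sum_out_dist_mult)
  also have "\<dots> = (\<Sum>y\<in>UNIV. (out_dist W P y - out_dist W P0 y)\<^sup>2 / out_dist W P0 y
      + (out_dist W P y - out_dist W P0 y))"
  proof (intro sum.cong refl)
    fix y show "out_dist W P y * (out_dist W P y / out_dist W P0 y - 1)
      = (out_dist W P y - out_dist W P0 y)\<^sup>2 / out_dist W P0 y + (out_dist W P y - out_dist W P0 y)"
      using q0[of y] by (cases "out_dist W P0 y = 0") (simp_all add: field_simps power2_eq_square)
  qed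
  also have "\<dots> = (\<Sum>y\<in>UNIV. (out_dist W P y - out_dist W P0 y)\<^sup>2 / out_dist W P0 y)"
    by (simp add: sum.distrib sum_subtractf sum_out_dist W P P0)
  finally show ?thesis by simp
qed

lemma mutual_info_eq_rel_info:
  "mutual_info W P = (\<Sum>x\<in>UNIV. P x * rel_info W P x)"
  by (simp add: mutual_info_def rel_info_def)

text \<open>Along a line the chi-square distance is quadratic in \<open>t\<close>. Moving by
  \<open>t\<close> therefore trades rates linearly at a loss of order \<open>t^2\<close>
  only.\<close>

lemma mutual_info_perturb:
  assumes W: "stochastic W" and P0: "is_dist P0" "\<And>x. 0 < P0 x"
    and P: "is_dist (\<lambda>x. P0 x + t * v x)"
  shows "mutual_info W P0 + t * (\<Sum>x\<in>UNIV. v x * rel_info W P0 x)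
      - t\<^sup>2 * (\<Sum>y\<in>UNIV. (out_dist W v y)\<^sup>2 / out_dist W P0 y)
      \<le> mutual_info W (\<lambda>x. P0 x + t * v x)"
proof -
  have o: "out_dist W (\<lambda>x. P0 x + t * v x) y - out_dist W P0 y = t * out_dist W v y" for y
    by (simp add: out_dist_def algebra_simps sum.distrib sum_distrib_left)
  have "(\<Sum>x\<in>UNIV. (P0 x + t * v x) * rel_info W P0 x)
      = mutual_info W P0 + t * (\<Sum>x\<in>UNIV. v x * rel_info W P0 x)"
    by (simp add: mutual_info_eq_rel_info distrib_right sum.distrib sum_distrib_left mult.assoc)
  moreover have "(\<Sum>y\<in>UNIV. (t * out_dist W v y)\<^sup>2 / out_dist W P0 y)
      = t\<^sup>2 * (\<Sum>y\<in>UNIV. (out_dist W v y)\<^sup>2 / out_dist W P0 y)"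
    by (simp add: power_mult_distrib sum_distrib_left)
  ultimately show ?thesis
    using mutual_info_ge[OF W P P0] by (simp add: o)
qed

text \<open>A real supremum says something only about a set that is bounded above; the tangent plane
  provides the bound.\<close>

lemma bdd_above_mutual_info:
  fixes W :: "'x::finite \<Rightarrow> 'y::finite \<Rightarrow> real" and P0 :: "'x \<Rightarrow> real"
  assumes W: "stochastic W" and P0: "is_dist P0" "\<And>x. 0 < P0 x"
  shows "\<exists>b. \<forall>P. is_dist P \<longrightarrow> mutual_info W P \<le> b"
proof (intro exI allI impI)
  fix P :: "'x \<Rightarrow> real" assume P: "is_dist P"
  have P1: "P x \<le> 1" for x
    using P member_le_sum[of x UNIV P] by (auto simp: is_dist_def)
  have "mutual_info W P \<le> (\<Sum>x\<in>UNIV. P x * rel_info W P0 x)"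
    by (rule mutual_info_le[OF W P P0])
  also have "\<dots> \<le> (\<Sum>x\<in>UNIV. \<bar>rel_info W P0 x\<bar>)"
  proof (intro sum_mono)
    fix x
    have "P x * rel_info W P0 x \<le> P x * \<bar>rel_info W P0 x\<bar>"
      using P by (intro mult_left_mono) (auto simp: is_dist_def)
    also have "\<dots> \<le> 1 * \<bar>rel_info W P0 x\<bar>"
      using P1 by (intro mult_right_mono) auto
    finally show "P x * rel_info W P0 x \<le> \<bar>rel_info W P0 x\<bar>" by simp
  qed
  finally show "mutual_info W P \<le> (\<Sum>x\<in>UNIV. \<bar>rel_info W P0 x\<bar>)" .
qed

section \<open>First-order conditions at the optimal input\<close>

lemma min_mutual_info_le_cap_common:
  fixes W1 :: "'x::finite \<Rightarrow> 'y::finite \<Rightarrow> real" and P0 :: "'x \<Rightarrow> real"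
  assumes "stochastic W1" "is_dist P0" "\<And>x. 0 < P0 x" "is_dist P"
  shows "min (mutual_info W1 P) (mutual_info W2 P) \<le> cap_common W1 W2"
proof -
  obtain b where "\<forall>P. is_dist P \<longrightarrow> mutual_info W1 P \<le> b"
    using bdd_above_mutual_info[OF assms(1-3)] by blast
  then have "bdd_above ((\<lambda>P. min (mutual_info W1 P) (mutual_info W2 P)) ` {P. is_dist P})"
    by (intro bdd_aboveI2[of _ _ b]) (simp add: min.coboundedI1)
  then show ?thesis
    unfolding cap_common_def using assms(4) by (intro cSUP_upper) auto
qed

lemma eventually_quadratic_gt:
  fixes a c C i :: real
  assumes "C < i \<or> C = i \<and> 0 < a"
  shows "\<forall>\<^sub>F t in at_right 0. C < i + t * a - t\<^sup>2 * c"
  using assms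
proof
  assume "C < i"
  moreover have "((\<lambda>t. i + t * a - t\<^sup>2 * c) \<longlongrightarrow> i + 0 * a - 0\<^sup>2 * c) (at_right 0)"
    by (intro tendsto_intros)
  ultimately show ?thesis
    by (intro order_tendstoD) auto
next
  assume *: "C = i \<and> 0 < a"
  have "((\<lambda>t. a - t * c) \<longlongrightarrow> a - 0 * c) (at_right 0)"
    by (intro tendsto_intros)
  then have "\<forall>\<^sub>F t in at_right 0. 0 < a - t * c"
    using * by (intro order_tendstoD) auto
  moreover have "\<forall>\<^sub>F t::real in at_right 0. 0 < t"
    by (simp add: eventually_at_right_less)
  ultimately show ?thesis
  proof eventually_elim
    case (elim t)
    then have "0 < t * (a - t * c)" by simp
    then show ?case using * by (simp add: algebra_simps power2_eq_square)
  qed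
qed

lemma eventually_is_dist:
  assumes P0: "is_dist P0" "\<And>x. 0 < P0 x" and v: "(\<Sum>x\<in>UNIV. v x) = 0"
  shows "\<forall>\<^sub>F t in at_right 0. is_dist (\<lambda>x. P0 x + t * v x)"
proof -
  have "\<forall>\<^sub>F t in at_right 0. 0 < P0 x + t * v x" for x
  proof -
    have "((\<lambda>t. P0 x + t * v x) \<longlongrightarrow> P0 x + 0 * v x) (at_right 0)"
      by (intro tendsto_intros)
    then show ?thesis using P0 by (intro order_tendstoD) auto
  qed
  then have "\<forall>\<^sub>F t in at_right 0. \<forall>x. 0 < P0 x + t * v x"
    by (rule eventually_all_finite)
  then show ?thesis
  proof eventually_elim
    case (elim t)
    then show ?case using P0(1) v
      by (auto simp: is_dist_def sum.distrib sum_distrib_left[symmetric] intro: less_imp_le)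
  qed
qed

text \<open>A receiver with slack keeps it under a small step, and one without slack gains to first
  order, which beats the quadratic loss. A small step in direction \<open>v\<close> stays in the
  simplex because \<open>P0\<close> is interior, so it would exceed the maximum.\<close>

lemma no_common_ascent_direction:
  assumes W: "stochastic W1" "stochastic W2" and P0: "is_dist P0" "\<And>x. 0 < P0 x"
    and opt: "min (mutual_info W1 P0) (mutual_info W2 P0) = cap_common W1 W2"
    and v: "(\<Sum>x\<in>UNIV. v x) = 0"
    and up1: "cap_common W1 W2 < mutual_info W1 P0 \<or> 0 < (\<Sum>x\<in>UNIV. v x * rel_info W1 P0 x)"
    and up2: "cap_common W1 W2 < mutual_info W2 P0 \<or> 0 < (\<Sum>x\<in>UNIV. v x * rel_info W2 P0 x)"
  shows False
proof -
  let ?C = "cap_common W1 W2"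
  let ?q = "\<lambda>W t. mutual_info W P0 + t * (\<Sum>x\<in>UNIV. v x * rel_info W P0 x)
      - t\<^sup>2 * (\<Sum>y\<in>UNIV. (out_dist W v y)\<^sup>2 / out_dist W P0 y)"
  have "\<forall>\<^sub>F t in at_right 0. ?C < ?q W1 t"
    using opt up1 by (intro eventually_quadratic_gt) linarith
  moreover have "\<forall>\<^sub>F t in at_right 0. ?C < ?q W2 t"
    using opt up2 by (intro eventually_quadratic_gt) linarith
  moreover have "\<forall>\<^sub>F t in at_right 0. is_dist (\<lambda>x. P0 x + t * v x)"
    by (rule eventually_is_dist[OF P0 v])
  ultimately have "\<forall>\<^sub>F t::real in at_right 0. False"
  proof eventually_elim
    case (elim t)
    have "?C < min (mutual_info W1 (\<lambda>x. P0 x + t * v x)) (mutual_info W2 (\<lambda>x. P0 x + t * v x))"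
      using elim mutual_info_perturb[OF W(1) P0 elim(3)] mutual_info_perturb[OF W(2) P0 elim(3)]
      by linarith
    then show ?case
      using min_mutual_info_le_cap_common[OF W(1) P0 elim(3), of W2] by linarith
  qed
  then show False by simp
qed

text \<open>The gradient projected onto the vectors with coordinate sum zero, i.e. the tangent
  directions of the simplex. It is a vector in \<open>real ^ 'x\<close> so that norm and inner
  product are available.\<close>

definition centred_info :: "('x::finite \<Rightarrow> 'y::finite \<Rightarrow> real) \<Rightarrow> ('x \<Rightarrow> real) \<Rightarrow> real ^ 'x" where
  "centred_info W P = (\<chi> x. rel_info W P x - (\<Sum>x'\<in>UNIV. rel_info W P x') / CARD('x))"

lemma sum_centred_info: "(\<Sum>x\<in>UNIV. centred_info W P $ x) = 0"
  by (simp add: centred_info_def sum_subtractf)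

lemma inner_centred_info:
  assumes "(\<Sum>x\<in>UNIV. v $ x) = 0"
  shows "(\<Sum>x\<in>UNIV. v $ x * rel_info W P x) = v \<bullet> centred_info W P"
proof -
  define r where "r = (\<Sum>x'\<in>UNIV. rel_info W P x') / CARD('a)"
  have "v \<bullet> centred_info W P = (\<Sum>x\<in>UNIV. v $ x * rel_info W P x) - (\<Sum>x\<in>UNIV. v $ x) * r"
    by (simp add: inner_vec_def centred_info_def r_def[symmetric] right_diff_distrib sum_subtractf
        sum_distrib_right)
  then show ?thesis using assms by simp
qed

text \<open>If the projected gradient vanished, the tangent plane at \<open>P0\<close> would be
  constant on the simplex and \<open>P0\<close> would attain the capacity of this single
  receiver.\<close>

lemma centred_info_nonzero:
  assumes W: "stochastic W" and P0: "is_dist P0" "\<And>x. 0 < P0 x"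
    and gt: "mutual_info W P0 < cap_single W"
  shows "centred_info W P0 \<noteq> 0"
proof
  assume "centred_info W P0 = 0"
  define r where "r = (\<Sum>x'\<in>UNIV. rel_info W P0 x') / CARD('a)"
  have "centred_info W P0 $ x = rel_info W P0 x - r" for x
    by (simp add: centred_info_def r_def)
  then have r: "rel_info W P0 x = r" for x
    using \<open>centred_info W P0 = 0\<close> by (metis eq_iff_diff_eq_0 zero_index)
  have "(\<Sum>x\<in>UNIV. P x * rel_info W P0 x) = r" if "is_dist P" for P
    using that by (simp add: r is_dist_def sum_distrib_right[symmetric])
  then have "mutual_info W P \<le> mutual_info W P0" if "is_dist P" for P
    using mutual_info_le[OF W that P0] P0(1) that by (simp add: mutual_info_eq_rel_info[of W P0])
  then have "cap_single W \<le> mutual_info W P0"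
    unfolding cap_single_def using P0(1) by (intro cSUP_least) auto
  then show False using gt by simp
qed

text \<open>If the two projected gradients were not exactly opposite, the sum of their normalisations
  would be a direction in which both mutual informations increase.\<close>

lemma balancing_direction:
  assumes W: "stochastic W1" "stochastic W2" and P0: "is_dist P0" "\<And>x. 0 < P0 x"
    and opt: "min (mutual_info W1 P0) (mutual_info W2 P0) = cap_common W1 W2"
    and cap: "cap_common W1 W2 < cap_single W1" "cap_common W1 W2 < cap_single W2"
  obtains v \<rho> where "mutual_info W1 P0 = cap_common W1 W2" "mutual_info W2 P0 = cap_common W1 W2"
    "(\<Sum>x\<in>UNIV. v x) = 0" "(\<Sum>x\<in>UNIV. v x * rel_info W1 P0 x) = 1"
    "(\<Sum>x\<in>UNIV. v x * rel_info W2 P0 x) = - \<rho>" "0 < \<rho>"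
proof -
  let ?C = "cap_common W1 W2"
  let ?g1 = "centred_info W1 P0" and ?g2 = "centred_info W2 P0"
  have ascent: False
    if "(\<Sum>x\<in>UNIV. v $ x) = 0" "?C < mutual_info W1 P0 \<or> 0 < v \<bullet> ?g1"
      "?C < mutual_info W2 P0 \<or> 0 < v \<bullet> ?g2" for v
    using no_common_ascent_direction[OF W P0 opt, of "\<lambda>x. v $ x"] that
    by (simp add: inner_centred_info)
  \<comment> \<open>If receiver 2 had slack, the nonzero gradient of receiver 1 would itself be a
    forbidden direction.\<close>
  have "\<not> ?C < mutual_info W2 P0"
  proof
    assume gt: "?C < mutual_info W2 P0"
    then have "mutual_info W1 P0 = ?C" using opt by linarith
    then have "0 < ?g1 \<bullet> ?g1" using centred_info_nonzero[OF W(1) P0] cap by simp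
    then show False using ascent[OF sum_centred_info[of W1 P0]] gt by blast
  qed
  moreover have "\<not> ?C < mutual_info W1 P0"
  proof
    assume gt: "?C < mutual_info W1 P0"
    then have "mutual_info W2 P0 = ?C" using opt by linarith
    then have "0 < ?g2 \<bullet> ?g2" using centred_info_nonzero[OF W(2) P0] cap by simp
    then show False using ascent[OF sum_centred_info[of W2 P0]] gt by blast
  qed
  ultimately have eq: "mutual_info W1 P0 = ?C" "mutual_info W2 P0 = ?C"
    using opt by linarith+
  have nz: "?g1 \<noteq> 0" "?g2 \<noteq> 0"
    using centred_info_nonzero[OF W(1) P0] centred_info_nonzero[OF W(2) P0] eq cap by simp_all
  \<comment> \<open>The sum of the normalised gradients, scaled by both norms to avoid division. Its
    inner products with the two gradients contain a common factor, which must be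
    nonpositive.\<close>
  have s: "(\<Sum>x\<in>UNIV. (norm ?g2 *\<^sub>R ?g1 + norm ?g1 *\<^sub>R ?g2) $ x) = 0"
    using sum_centred_info[of W1 P0] sum_centred_info[of W2 P0]
    by (simp add: sum.distrib sum_distrib_left[symmetric])
  have i1: "(norm ?g2 *\<^sub>R ?g1 + norm ?g1 *\<^sub>R ?g2) \<bullet> ?g1 = norm ?g1 * (norm ?g1 * norm ?g2 + ?g1 \<bullet> ?g2)"
    by (simp add: inner_add_left inner_commute[of ?g2] dot_square_norm power2_eq_square algebra_simps)
  have i2: "(norm ?g2 *\<^sub>R ?g1 + norm ?g1 *\<^sub>R ?g2) \<bullet> ?g2 = norm ?g2 * (norm ?g1 * norm ?g2 + ?g1 \<bullet> ?g2)"
    by (simp add: inner_add_left dot_square_norm power2_eq_square algebra_simps)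
  have "norm ?g1 * norm ?g2 + ?g1 \<bullet> ?g2 \<le> 0"
    using ascent[OF s] nz unfolding i1 i2
    by (metis linorder_not_less mult_pos_pos zero_less_norm_iff)
  moreover have "0 < norm ?g1 * norm ?g2" using nz by simp
  ultimately have neg: "?g1 \<bullet> ?g2 < 0" by linarith
  \<comment> \<open>Scaled so that receiver 1 gains at unit rate; \<open>\<rho>\<close> is then the
    rate at which receiver 2 loses.\<close>
  define v where "v = (1 / (?g1 \<bullet> ?g1)) *\<^sub>R ?g1"
  have v0: "(\<Sum>x\<in>UNIV. v $ x) = 0"
    using sum_centred_info[of W1 P0] by (simp add: v_def sum_divide_distrib[symmetric])
  show ?thesis
  proof (rule that[OF eq, of "\<lambda>x. v $ x" "- (v \<bullet> ?g2)"])
    show "(\<Sum>x\<in>UNIV. v $ x * rel_info W1 P0 x) = 1"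
      using nz unfolding inner_centred_info[OF v0] by (simp add: v_def)
    show "0 < - (v \<bullet> ?g2)"
      using neg nz by (simp add: v_def field_simps)
  qed (use v0 in \<open>simp_all add: inner_centred_info[OF v0]\<close>)
qed

text \<open>The bound is uniform over all inputs above \<open>P0 / 2\<close>, so it also serves the
  perturbed inputs, whose distance from \<open>P0\<close> will vary with the blocklength.\<close>

lemma info_dens_bounded:
  assumes W: "stochastic W" and P0: "is_dist P0" "\<And>x. 0 < P0 x"
  obtains B where "0 < B"
    "\<And>P x y. is_dist P \<Longrightarrow> (\<And>x. P0 x / 2 \<le> P x) \<Longrightarrow> \<bar>info_dens W P x y\<bar> \<le> B"
proof -
  define B where "B = 1 + (\<Sum>x\<in>UNIV. \<Sum>y\<in>UNIV. \<bar>ln (W x y)\<bar>) + (\<Sum>y\<in>UNIV. \<bar>ln (out_dist W P0 y / 2)\<bar>)"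
  have B0: "0 < B" unfolding B_def by (intro add_pos_nonneg sum_nonneg) auto
  have "\<bar>info_dens W P x y\<bar> \<le> B" if P: "is_dist P" and half: "\<And>x. P0 x / 2 \<le> P x" for P x y
  proof (cases "W x y = 0")
    case False
    then have w: "0 < W x y" using W by (auto simp: stochastic_def less_le)
    have Pp: "0 < P x" using half[of x] P0(2)[of x] by linarith
    have q: "0 < out_dist W P y" "0 < out_dist W P0 y"
      using out_dist_pos W P P0 Pp w by blast+
    have "out_dist W P y \<le> 1"
      using member_le_sum[of y UNIV "out_dist W P"] out_dist_nonneg[OF W P] sum_out_dist[OF W P] by auto
    moreover have "out_dist W P0 y / 2 \<le> out_dist W P y"
      unfolding out_dist_def sum_divide_distrib
    proof (intro sum_mono)
      fix x show "P0 x * W x y / 2 \<le> P x * W x y"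
        using half[of x] W mult_right_mono[of "P0 x / 2" "P x" "W x y"] by (simp add: stochastic_def)
    qed
    ultimately have "ln (out_dist W P0 y / 2) \<le> ln (out_dist W P y)" "ln (out_dist W P y) \<le> 0"
      using q by simp_all
    moreover have "info_dens W P x y = ln (W x y) - ln (out_dist W P y)"
      using False w q by (simp add: info_dens_def ln_div)
    ultimately have "\<bar>info_dens W P x y\<bar> \<le> \<bar>ln (W x y)\<bar> + \<bar>ln (out_dist W P0 y / 2)\<bar>"
      by linarith
    moreover have "\<bar>ln (out_dist W P0 y / 2)\<bar> \<le> (\<Sum>y\<in>UNIV. \<bar>ln (out_dist W P0 y / 2)\<bar>)"
      by (intro member_le_sum) auto
    moreover have "\<bar>ln (W x y)\<bar> \<le> (\<Sum>y\<in>UNIV. \<bar>ln (W x y)\<bar>)"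
      by (intro member_le_sum) auto
    moreover have "(\<Sum>y\<in>UNIV. \<bar>ln (W x y)\<bar>) \<le> (\<Sum>x\<in>UNIV. \<Sum>y\<in>UNIV. \<bar>ln (W x y)\<bar>)"
      by (intro member_le_sum sum_nonneg) auto
    ultimately show ?thesis unfolding B_def by linarith
  qed (use B0 in \<open>simp add: info_dens_def\<close>)
  with B0 show ?thesis using that by blast
qed

section \<open>The three-phase scheme\<close>

definition receiver :: "bool \<Rightarrow> 'y \<times> 'y \<Rightarrow> 'y" where
  "receiver k y = (if k then fst y else snd y)"

text \<open>Receiver 1 is \<open>True\<close>, receiver 2 is \<open>False\<close>. Modes \<open>0, 1, 2\<close> stand for the input distributions
  \<open>P\<^sup>*, P\<^sup>* + d v, P\<^sup>* - d v\<close>. A codeword is a list of letters, each of which carries an input symbol for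
  every mode; \<open>pick\<close> is the switching time chosen by the encoder after the first \<open>n\<close> channel uses.\<close>

locale scheme =
  fixes W :: "bool \<Rightarrow> 'x::finite \<Rightarrow> 'y::finite \<Rightarrow> real"
    and P :: "nat \<Rightarrow> 'x \<Rightarrow> real"
    and R :: "'w::finite \<Rightarrow> real" and letter :: "nat \<Rightarrow> 'w \<Rightarrow> 'x"
    and n T :: nat and \<gamma> :: real
    and pick :: "('w \<times> 'y \<times> 'y) list \<Rightarrow> nat"
  assumes W: "stochastic (W k)"
    and P: "is_dist (P m)" "0 < P m x"
    and R: "is_dist R"
    and letter: "(\<Sum>w\<in>UNIV. R w * f (letter m w)) = (\<Sum>x\<in>UNIV. P m x * f x)"
    and pick: "pick h \<le> T"
begin

text \<open>\<open>T\<close> uses for balancing and \<open>2 * T\<close> more. The threshold will be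
  \<open>C * (n + 2 * T)\<close>, which puts the nominal crossing time \<open>T\<close> uses after
  the balancing phase and \<open>T\<close> uses before the horizon.\<close>

definition N where "N = n + 3 * T"

definition mode :: "nat \<Rightarrow> nat \<Rightarrow> nat" where
  "mode s i = (if i < n \<or> n + T \<le> i then 0 else if i < n + s then 1 else 2)"

text \<open>Before time \<open>n\<close> the list \<open>take n h\<close> is an incomplete history,
  but then \<open>mode\<close> is 0 for every switching time.\<close>

definition cur_mode :: "('w \<times> 'y \<times> 'y) list \<Rightarrow> nat" where
  "cur_mode h = mode (pick (take n h)) (length h)"

text \<open>Codeword letter and output pair are drawn together, so that the random code and the
  channel with feedback form one path measure; \<open>chan\<close> is the same process with the
  codeword frozen.\<close>

definition joint :: "('w \<times> 'y \<times> 'y) list \<Rightarrow> 'w \<times> 'y \<times> 'y \<Rightarrow> real" where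
  "joint h z = (let x = letter (cur_mode h) (fst z) in
     R (fst z) * (W True x (fst (snd z)) * W False x (snd (snd z))))"

definition chan :: "'w list \<Rightarrow> ('y \<times> 'y) list \<Rightarrow> 'y \<times> 'y \<Rightarrow> real" where
  "chan w c y = (let x = letter (cur_mode (zip w c)) (w ! length c) in W True x (fst y) * W False x (snd y))"

definition step_info :: "bool \<Rightarrow> ('w \<times> 'y \<times> 'y) list \<Rightarrow> 'w \<times> 'y \<times> 'y \<Rightarrow> real" where
  "step_info k h z = info_dens (W k) (P (cur_mode h)) (letter (cur_mode h) (fst z)) (receiver k (snd z))"

definition centred_step :: "bool \<Rightarrow> ('w \<times> 'y \<times> 'y) list \<Rightarrow> 'w \<times> 'y \<times> 'y \<Rightarrow> real" where
  "centred_step k h z = step_info k h z - mutual_info (W k) (P (cur_mode h))"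

text \<open>The accumulated information density reaches \<open>\<gamma>\<close>, written with
  products. Positivity is required separately, since \<open>info_dens\<close> would treat an
  impossible letter as neutral. Only one receiver's outputs and a hypothetical switching time
  \<open>s\<close> enter, so the receiver can evaluate it.\<close>

definition crosses :: "bool \<Rightarrow> 'w list \<Rightarrow> nat \<Rightarrow> 'y list \<Rightarrow> bool" where
  "crosses k w s ys \<longleftrightarrow>
     (\<forall>i<length ys. 0 < W k (letter (mode s i) (w ! i)) (ys ! i)) \<and>
     exp \<gamma> * (\<Prod>i<length ys. out_dist (W k) (P (mode s i)) (ys ! i))
       \<le> (\<Prod>i<length ys. W k (letter (mode s i) (w ! i)) (ys ! i))"

lemma W_nonneg: "0 \<le> W k x y" and W_sum: "(\<Sum>y\<in>UNIV. W k x y) = 1"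
  using W[of k] by (auto simp: stochastic_def)

lemma R_nonneg: "0 \<le> R w" and R_sum: "(\<Sum>w\<in>UNIV. R w) = 1"
  using R by (auto simp: is_dist_def)

lemma chan_nonneg: "0 \<le> chan w c y"
  by (simp add: chan_def Let_def W_nonneg)

lemma joint_nonneg: "0 \<le> joint h z"
  by (simp add: joint_def Let_def W_nonneg R_nonneg)

lemma sum_pair_output:
  "(\<Sum>y\<in>UNIV. W True x (fst y) * W False x (snd y) * f (receiver k y)) = (\<Sum>y\<in>UNIV. W k x y * f y)"
proof -
  have "(\<Sum>y\<in>UNIV. W True x (fst y) * W False x (snd y) * f (receiver k y))
      = (\<Sum>a\<in>UNIV. \<Sum>b\<in>UNIV. W True x a * W False x b * f (receiver k (a, b)))"
    unfolding UNIV_Times_UNIV[symmetric] sum.cartesian_product by (simp add: case_prod_unfold)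
  also have "\<dots> = (\<Sum>y\<in>UNIV. W k x y * f y)"
  proof (cases k)
    case True
    then show ?thesis
      by (simp add: receiver_def sum_distrib_left[symmetric] sum_distrib_right[symmetric] W_sum)
  next
    case False
    then show ?thesis
      by (subst sum.swap)
        (simp add: receiver_def sum_distrib_left[symmetric] sum_distrib_right[symmetric] W_sum)
  qed
  finally show ?thesis .
qed

lemma chan_sum: "(\<Sum>y\<in>UNIV. chan w c y) = 1"
  using sum_pair_output[where f = "\<lambda>_. 1"] by (simp add: chan_def Let_def W_sum)

lemma sum_joint:
  "(\<Sum>z\<in>UNIV. joint h z * f (letter (cur_mode h) (fst z)) (receiver k (snd z)))
    = (\<Sum>x\<in>UNIV. P (cur_mode h) x * (\<Sum>y\<in>UNIV. W k x y * f x y))"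
proof -
  let ?x = "\<lambda>w. letter (cur_mode h) w"
  have "(\<Sum>z\<in>UNIV. joint h z * f (?x (fst z)) (receiver k (snd z)))
      = (\<Sum>w\<in>UNIV. \<Sum>y\<in>UNIV. R w * (W True (?x w) (fst y) * W False (?x w) (snd y)) * f (?x w) (receiver k y))"
    unfolding UNIV_Times_UNIV[where 'a = 'w, symmetric] sum.cartesian_product
    by (simp add: case_prod_unfold joint_def Let_def)
  also have "\<dots> = (\<Sum>w\<in>UNIV. R w * (\<Sum>y\<in>UNIV. W k (?x w) y * f (?x w) y))"
    by (simp add: sum_pair_output[symmetric] sum_distrib_left mult.assoc)
  also have "\<dots> = (\<Sum>x\<in>UNIV. P (cur_mode h) x * (\<Sum>y\<in>UNIV. W k x y * f x y))"
    by (rule letter)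
  finally show ?thesis .
qed

lemma joint_sum: "(\<Sum>z\<in>UNIV. joint h z) = 1"
  using sum_joint[of h "\<lambda>_ _. 1" True] P(1) by (simp add: W_sum is_dist_def)

lemma mutual_info_bound:
  assumes "\<And>x y. \<bar>info_dens (W k) (P m) x y\<bar> \<le> B"
  shows "\<bar>mutual_info (W k) (P m)\<bar> \<le> B"
proof -
  have "\<bar>mutual_info (W k) (P m)\<bar> \<le> (\<Sum>x\<in>UNIV. P m x * (\<Sum>y\<in>UNIV. W k x y * B))"
    unfolding mutual_info_def
  proof (rule order_trans[OF sum_abs], rule sum_mono)
    fix x
    have "\<bar>\<Sum>y\<in>UNIV. W k x y * info_dens (W k) (P m) x y\<bar> \<le> (\<Sum>y\<in>UNIV. W k x y * B)"
      by (rule order_trans[OF sum_abs], rule sum_mono)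
        (simp add: abs_mult W_nonneg mult_left_mono assms)
    then show "\<bar>P m x * (\<Sum>y\<in>UNIV. W k x y * info_dens (W k) (P m) x y)\<bar> \<le> P m x * (\<Sum>y\<in>UNIV. W k x y * B)"
      using P(2)[of m x] by (simp add: abs_mult mult_left_mono)
  qed
  also have "\<dots> = B"
    using P(1)[of m] by (simp add: sum_distrib_right[symmetric] W_sum is_dist_def)
  finally show ?thesis .
qed

text \<open>The mode is a function of the history, so given the history the expected information
  density is the mutual information of that mode's input.\<close>

lemma martingale_centred_step:
  assumes B: "\<And>m x y. \<bar>info_dens (W k) (P m) x y\<bar> \<le> B" "0 < B"
  shows "martingale_differences joint (centred_step k) (2 * B)"
proof
  fix h z
  have "(\<Sum>z\<in>UNIV. joint h z * centred_step k h z) = (\<Sum>z\<in>UNIV. joint h z * step_info k h z)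
      - (\<Sum>z\<in>UNIV. joint h z) * mutual_info (W k) (P (cur_mode h))"
    by (simp add: centred_step_def right_diff_distrib sum_subtractf sum_distrib_right)
  also have "(\<Sum>z\<in>UNIV. joint h z * step_info k h z) = mutual_info (W k) (P (cur_mode h))"
    unfolding step_info_def by (subst sum_joint) (simp add: mutual_info_def)
  finally show "(\<Sum>z\<in>UNIV. joint h z * centred_step k h z) = 0" by (simp add: joint_sum)
  have "\<bar>step_info k h z\<bar> \<le> B" unfolding step_info_def by (rule B)
  moreover have "\<bar>mutual_info (W k) (P (cur_mode h))\<bar> \<le> B" by (intro mutual_info_bound B)
  ultimately show "\<bar>centred_step k h z\<bar> \<le> 2 * B" unfolding centred_step_def by linarith
qed (use joint_nonneg joint_sum B in auto)

lemma cur_mode_take: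
  assumes "i \<le> length h" shows "cur_mode (take i h) = mode (pick (take n h)) i"
proof (cases "i < n")
  case True
  then show ?thesis using assms by (simp add: cur_mode_def mode_def)
next
  case False
  then have "take n (take i h) = take n h" by (simp add: min_def)
  then show ?thesis using assms by (simp add: cur_mode_def)
qed

text \<open>A path of positive weight uses only transitions of positive probability, so the sum of
  logarithms can be exponentiated into the product form.\<close>

lemma crosses_if_step_info:
  assumes h: "0 < path_weight joint h" "t \<le> length h"
    and ge: "\<gamma> \<le> (\<Sum>i<t. step_info k (take i h) (h ! i))"
  shows "crosses k (map fst h) (pick (take n h)) (map (\<lambda>z. receiver k (snd z)) (take t h))"
proof -
  define s where "s = pick (take n h)"
  define a where "a i = W k (letter (mode s i) (fst (h ! i))) (receiver k (snd (h ! i)))" for i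
  define q where "q i = out_dist (W k) (P (mode s i)) (receiver k (snd (h ! i)))" for i
  have m: "cur_mode (take i h) = mode s i" if "i < t" for i
    using cur_mode_take[of i h] that h(2) by (simp add: s_def)
  have a: "0 < a i" if "i < t" for i
  proof -
    have "i \<in> {..<length h}" using that h(2) by simp
    moreover have "(\<Prod>i<length h. joint (take i h) (h ! i)) \<noteq> 0"
      using h(1) unfolding path_weight_def by linarith
    ultimately have "joint (take i h) (h ! i) \<noteq> 0"
      by (meson finite_lessThan prod_zero)
    then have "a i \<noteq> 0"
      using m[OF that] by (auto simp: joint_def Let_def a_def receiver_def)
    then show ?thesis using W_nonneg by (auto simp: a_def less_le)
  qed
  have q: "0 < q i" if "i < t" for i
    using out_dist_pos[OF W P(1) P(2)] a[OF that] unfolding a_def q_def by blast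
  have "step_info k (take i h) (h ! i) = ln (a i / q i)" if "i < t" for i
    using a[OF that] m[OF that] by (simp add: step_info_def info_dens_def a_def q_def)
  then have "exp \<gamma> \<le> exp (\<Sum>i<t. ln (a i / q i))" using ge by simp
  also have "\<dots> = (\<Prod>i<t. a i / q i)"
    using a q by (simp add: exp_sum)
  also have "\<dots> = (\<Prod>i<t. a i) / (\<Prod>i<t. q i)" by (rule prod_dividef)
  finally have "exp \<gamma> \<le> (\<Prod>i<t. a i) / (\<Prod>i<t. q i)" .
  moreover have "0 < (\<Prod>i<t. q i)" using q by (intro prod_pos) auto
  ultimately have "exp \<gamma> * (\<Prod>i<t. q i) \<le> (\<Prod>i<t. a i)" by (simp add: pos_le_divide_eq)
  then show ?thesis
    using a h(2) unfolding crosses_def s_def[symmetric] by (simp add: a_def q_def min_def)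
qed

text \<open>Change of measure: for fixed outputs, the likelihood ratio of an independently drawn
  codeword is a product of independent factors with mean at most 1, and Markov's inequality
  applies.\<close>

lemma wrong_codeword_crosses:
  assumes "length ys \<le> L"
  shows "(\<Sum>w | length w = L. path_weight (\<lambda>_. R) w * of_bool (crosses k w s ys)) \<le> exp (- \<gamma>)"
proof -
  define q where "q i = out_dist (W k) (P (mode s i)) (ys ! i)" for i
  define a where "a i w = W k (letter (mode s i) w) (ys ! i)" for i w
  define F where "F i w = R w * (if i < length ys then a i w / q i else 1)" for i w
  have F0: "0 \<le> F i w" for i w
    using R_nonneg W_nonneg out_dist_nonneg[OF W P(1)] by (simp add: F_def a_def q_def)
  have 1: "path_weight (\<lambda>_. R) w * of_bool (crosses k w s ys) \<le> exp (- \<gamma>) * (\<Prod>i<L. F i (w ! i))"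
    if len: "length w = L" for w
  proof (cases "crosses k w s ys")
    case True
    then have a: "\<And>i. i < length ys \<Longrightarrow> 0 < a i (w ! i)"
      and ge: "exp \<gamma> * (\<Prod>i<length ys. q i) \<le> (\<Prod>i<length ys. a i (w ! i))"
      by (auto simp: crosses_def a_def q_def)
    have q: "0 < q i" if "i < length ys" for i
      using out_dist_pos[OF W P(1) P(2)] a[OF that] unfolding a_def q_def by blast
    have "(\<Prod>i<L. F i (w ! i)) = (\<Prod>i<L. R (w ! i)) * (\<Prod>i<L. if i < length ys then a i (w ! i) / q i else 1)"
      unfolding F_def by (rule prod.distrib)
    also have "(\<Prod>i<L. if i < length ys then a i (w ! i) / q i else 1) = (\<Prod>i<length ys. a i (w ! i) / q i)"
      using assms by (intro prod.mono_neutral_cong_right) auto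
    also have "\<dots> = (\<Prod>i<length ys. a i (w ! i)) / (\<Prod>i<length ys. q i)" by (rule prod_dividef)
    finally have F: "(\<Prod>i<L. F i (w ! i))
        = (\<Prod>i<L. R (w ! i)) * ((\<Prod>i<length ys. a i (w ! i)) / (\<Prod>i<length ys. q i))" .
    have "0 < (\<Prod>i<length ys. q i)" using q by (intro prod_pos) auto
    then have "exp \<gamma> \<le> (\<Prod>i<length ys. a i (w ! i)) / (\<Prod>i<length ys. q i)"
      using ge by (simp add: pos_le_divide_eq)
    then have "path_weight (\<lambda>_. R) w * exp \<gamma> \<le> (\<Prod>i<L. F i (w ! i))"
      unfolding F path_weight_def len by (intro mult_left_mono prod_nonneg) (simp_all add: R_nonneg)
    then have "exp (- \<gamma>) * (path_weight (\<lambda>_. R) w * exp \<gamma>) \<le> exp (- \<gamma>) * (\<Prod>i<L. F i (w ! i))"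
      by simp
    moreover have "exp (- \<gamma>) * (path_weight (\<lambda>_. R) w * exp \<gamma>) = path_weight (\<lambda>_. R) w"
      by (simp add: exp_minus)
    ultimately show ?thesis using True by simp
  next
    case False
    then show ?thesis using F0 by (simp add: prod_nonneg)
  qed
  have "(\<Sum>w | length w = L. path_weight (\<lambda>_. R) w * of_bool (crosses k w s ys))
      \<le> (\<Sum>w | length w = L. exp (- \<gamma>) * (\<Prod>i<L. F i (w ! i)))"
    using 1 by (intro sum_mono) auto
  also have "\<dots> = exp (- \<gamma>) * (\<Prod>i<L. \<Sum>w\<in>UNIV. F i w)"
    unfolding sum_distrib_left[symmetric] by (simp add: sum_prod_lists)
  also have "(\<Prod>i<L. \<Sum>w\<in>UNIV. F i w) \<le> 1"
  proof (intro prod_le_1)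
    fix i
    show "0 \<le> (\<Sum>w\<in>UNIV. F i w) \<and> (\<Sum>w\<in>UNIV. F i w) \<le> 1"
    proof (cases "i < length ys")
      case True
      then have "(\<Sum>w\<in>UNIV. F i w) = (\<Sum>w\<in>UNIV. R w * (W k (letter (mode s i) w) (ys ! i) / q i))"
        by (simp add: F_def a_def)
      also have "\<dots> = (\<Sum>x\<in>UNIV. P (mode s i) x * (W k x (ys ! i) / q i))" by (rule letter)
      \<comment> \<open>The quotient is 1, or 0 when \<open>q i = 0\<close>; hence a bound rather
        than an equality.\<close>
      also have "\<dots> = q i / q i" by (simp only: q_def out_dist_def times_divide_eq_right sum_divide_distrib[symmetric])
      finally show ?thesis by simp
    next
      case False
      then show ?thesis by (simp add: F_def R_sum)
    qed
  qed
  then show ?thesis using calculation by (simp add: order_trans)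
qed

section \<open>The random code ensemble and the choice of a codebook\<close>

lemma path_weight_joint_zip:
  assumes "length w = length c"
  shows "path_weight joint (zip w c) = path_weight (\<lambda>_. R) w * path_weight (chan w) c"
proof -
  have "joint (take i (zip w c)) (zip w c ! i) = R (w ! i) * chan w (take i c) (c ! i)"
    if "i < length c" for i
  proof -
    have "take i (zip w c) = zip w (take i c)"
      using that assms by (intro nth_equalityI) auto
    then show ?thesis using that assms by (simp add: joint_def chan_def Let_def)
  qed
  then show ?thesis
    unfolding path_weight_def prod.distrib[symmetric] using assms
    by (simp add: prod.distrib)
qed

text \<open>The joint law factorises into a codeword and the outputs given it, which turns bounds on
  the joint process into ensemble averages.\<close>

lemma sum_joint_paths:
  "(\<Sum>h | length h = L. path_weight joint h * \<phi> h)
    = (\<Sum>w | length w = L. path_weight (\<lambda>_. R) w * (\<Sum>c | length c = L. path_weight (chan w) c * \<phi> (zip w c)))"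
  unfolding sum_zip_lists sum_distrib_left
  by (intro sum.cong refl) (auto simp: path_weight_joint_zip)

text \<open>Both receivers pass the test with the true codeword and the true switching time at the
  same \<open>t\<close>. The first such time bounds the maximum of the two stopping times.\<close>

definition hit :: "'w list \<Rightarrow> ('y \<times> 'y) list \<Rightarrow> nat \<Rightarrow> bool" where
  "hit w c t \<longleftrightarrow> t \<le> N \<and>
     (\<forall>k. crosses k w (pick (take n (zip w c))) (map (receiver k) (take t c)))"

definition fails :: "'w list \<Rightarrow> ('y \<times> 'y) list \<Rightarrow> bool" where
  "fails w c \<longleftrightarrow> \<not> (\<exists>t. hit w c t)"

text \<open>The value \<open>N\<close> on failure matches the horizon at which the receivers are
  forced to stop.\<close>

definition hit_time :: "'w list \<Rightarrow> ('y \<times> 'y) list \<Rightarrow> nat" where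
  "hit_time w c = (if fails w c then N else (LEAST t. hit w c t))"

text \<open>All switching times and all prefixes are included, so the event does not depend on the
  transmitted codeword except through the outputs \<open>c\<close>.\<close>

definition confusable :: "'w list \<Rightarrow> ('y \<times> 'y) list \<Rightarrow> bool" where
  "confusable w' c \<longleftrightarrow> (\<exists>k. \<exists>s\<le>T. \<exists>t\<le>N. crosses k w' s (map (receiver k) (take t c)))"

lemma hit_time_le_N: "hit_time w c \<le> N"
proof (cases "fails w c")
  case False
  then have "hit w c (LEAST t. hit w c t)" unfolding fails_def by (blast intro: LeastI_ex)
  moreover have "t \<le> N" if "hit w c t" for t using that by (simp add: hit_def)
  ultimately show ?thesis using False by (simp add: hit_time_def)
qed (simp add: hit_time_def)

lemma hit_time_le: "hit w c t \<Longrightarrow> hit_time w c \<le> t"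
  using Least_le[of "hit w c" t] by (auto simp: hit_time_def fails_def)

text \<open>A union bound over 2 receivers, \<open>T + 1\<close> switching times and
  \<open>N + 1\<close> prefix lengths, with the outputs held fixed while the wrong codeword is
  random.\<close>

lemma confusable_prob:
  "(\<Sum>w | length w = N. path_weight (\<lambda>_. R) w * of_bool (confusable w c))
    \<le> 2 * real (T + 1) * real (N + 1) * exp (- \<gamma>)"
proof -
  let ?c = "\<lambda>w k s t. of_bool (crosses k w s (map (receiver k) (take t c))) :: real"
  have "of_bool (confusable w c) \<le> (\<Sum>k\<in>UNIV. \<Sum>s\<le>T. \<Sum>t\<le>N. ?c w k s t)" for w
  proof (cases "confusable w c")
    case True
    then obtain k s t where *: "s \<le> T" "t \<le> N" "crosses k w s (map (receiver k) (take t c))"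
      unfolding confusable_def by blast
    then have "1 = ?c w k s t" by simp
    also have "\<dots> \<le> (\<Sum>t\<le>N. ?c w k s t)" using * by (intro member_le_sum) auto
    also have "\<dots> \<le> (\<Sum>s\<le>T. \<Sum>t\<le>N. ?c w k s t)"
      using * by (intro member_le_sum sum_nonneg) auto
    also have "\<dots> \<le> (\<Sum>k\<in>UNIV. \<Sum>s\<le>T. \<Sum>t\<le>N. ?c w k s t)"
      by (intro member_le_sum sum_nonneg) auto
    finally show ?thesis by simp
  qed (auto intro!: sum_nonneg)
  then have "(\<Sum>w | length w = N. path_weight (\<lambda>_. R) w * of_bool (confusable w c))
      \<le> (\<Sum>w | length w = N. path_weight (\<lambda>_. R) w * (\<Sum>k\<in>UNIV. \<Sum>s\<le>T. \<Sum>t\<le>N. ?c w k s t))"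
    by (intro sum_mono mult_left_mono path_weight_nonneg R_nonneg) auto
  also have "\<dots> = (\<Sum>w | length w = N. \<Sum>k\<in>UNIV. \<Sum>s\<le>T. \<Sum>t\<le>N. path_weight (\<lambda>_. R) w * ?c w k s t)"
    by (simp only: sum_distrib_left)
  also have "\<dots> = (\<Sum>k\<in>UNIV. \<Sum>w | length w = N. \<Sum>s\<le>T. \<Sum>t\<le>N. path_weight (\<lambda>_. R) w * ?c w k s t)"
    by (rule sum.swap)
  also have "\<dots> = (\<Sum>k\<in>UNIV. \<Sum>s\<le>T. \<Sum>w | length w = N. \<Sum>t\<le>N. path_weight (\<lambda>_. R) w * ?c w k s t)"
    by (intro sum.cong refl, rule sum.swap)
  also have "\<dots> = (\<Sum>k\<in>UNIV. \<Sum>s\<le>T. \<Sum>t\<le>N. \<Sum>w | length w = N. path_weight (\<lambda>_. R) w * ?c w k s t)"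
    by (intro sum.cong refl, rule sum.swap)
  also have "\<dots> \<le> (\<Sum>k\<in>(UNIV::bool set). \<Sum>s\<le>T. \<Sum>t\<le>N. exp (- \<gamma>))"
    by (intro sum_mono wrong_codeword_crosses) auto
  also have "\<dots> = 2 * real (T + 1) * real (N + 1) * exp (- \<gamma>)" by simp
  finally show ?thesis .
qed

text \<open>Failures and confusions are charged as \<open>lam\<close> units of time. A single
  average then controls time and errors together, so one deterministic codebook is good for both;
  confusion is the pairwise cost in \<open>random_coding\<close>.\<close>

lemma exists_codebook:
  assumes cost: "(\<Sum>h | length h = N. path_weight joint h *
      (real (hit_time (map fst h) (map snd h)) + lam * of_bool (fails (map fst h) (map snd h)))) \<le> X"
    and lam: "0 \<le> lam" and M: "1 \<le> M"
  shows "\<exists>cw. (\<forall>j. length (cw j) = N) \<and>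
    (\<Sum>j<M. \<Sum>c | length c = N. path_weight (chan (cw j)) c *
       (real (hit_time (cw j) c) + lam * of_bool (fails (cw j) c)
        + lam * of_bool (\<exists>j'<M. j' \<noteq> j \<and> confusable (cw j') c)))
    \<le> real M * (X + real (M - 1) * lam * (2 * real (T + 1) * real (N + 1) * exp (- \<gamma>)))"
proof -
  define F where "F w = (\<Sum>c | length c = N. path_weight (chan w) c *
      (real (hit_time w c) + lam * of_bool (fails w c)))" for w
  define G where "G w w' = lam * (\<Sum>c | length c = N. path_weight (chan w) c * of_bool (confusable w' c))"
    for w w'
  let ?Q = "path_weight (\<lambda>_. R)"
  let ?e = "2 * real (T + 1) * real (N + 1) * exp (- \<gamma>)"
  have K0: "0 \<le> path_weight (chan w) c" for w c by (intro path_weight_nonneg chan_nonneg)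
  have K1: "(\<Sum>c | length c = N. path_weight (chan w) c) = 1" for w
    by (intro sum_path_weight chan_sum)
  have Q0: "0 \<le> ?Q w" for w by (intro path_weight_nonneg R_nonneg)
  have Q1: "(\<Sum>w | length w = N. ?Q w) = 1" by (intro sum_path_weight R_sum)
  have EF: "(\<Sum>w | length w = N. ?Q w * F w) \<le> X"
    using cost unfolding sum_joint_paths F_def by simp
  have "(\<Sum>w' | length w' = N. ?Q w' * G w w') \<le> lam * ?e" for w
  proof -
    have "(\<Sum>w' | length w' = N. ?Q w' * G w w')
      = (\<Sum>w' | length w' = N. \<Sum>c | length c = N.
           lam * (path_weight (chan w) c * (?Q w' * of_bool (confusable w' c))))"
      unfolding G_def sum_distrib_left by (simp add: mult_ac)
    also have "\<dots> = (\<Sum>c | length c = N. \<Sum>w' | length w' = N.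
           lam * (path_weight (chan w) c * (?Q w' * of_bool (confusable w' c))))"
      by (rule sum.swap)
    also have "\<dots> = lam * (\<Sum>c | length c = N. path_weight (chan w) c *
        (\<Sum>w' | length w' = N. ?Q w' * of_bool (confusable w' c)))"
      by (simp only: sum_distrib_left)
    also have "\<dots> \<le> lam * (\<Sum>c | length c = N. path_weight (chan w) c * ?e)"
      by (intro mult_left_mono sum_mono confusable_prob K0 lam)
    also have "\<dots> = lam * ?e"
      unfolding sum_distrib_right[symmetric] K1 by simp
    finally show ?thesis .
  qed
  then have "(\<Sum>w | length w = N. ?Q w * (\<Sum>w' | length w' = N. ?Q w' * G w w'))
      \<le> (\<Sum>w | length w = N. ?Q w * (lam * ?e))"
    by (intro sum_mono mult_left_mono Q0) auto
  also have "\<dots> = lam * ?e"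
    unfolding sum_distrib_right[symmetric] Q1 by simp
  finally have EG: "(\<Sum>w | length w = N. ?Q w * (\<Sum>w' | length w' = N. ?Q w' * G w w')) \<le> lam * ?e" .
  obtain cw where cw: "\<forall>j. cw j \<in> {w. length w = N}" and
    le: "(\<Sum>j<M. F (cw j)) + (\<Sum>j<M. \<Sum>j'\<in>{..<M} - {j}. G (cw j) (cw j'))
      \<le> real M * (\<Sum>w | length w = N. ?Q w * F w)
       + real M * (real M - 1) * (\<Sum>w | length w = N. ?Q w * (\<Sum>w' | length w' = N. ?Q w' * G w w'))"
    using random_coding[of "{w. length w = N}" ?Q, where M = M and F = F and G = G] Q0 Q1 by auto
  have u: "of_bool (\<exists>j'<M. j' \<noteq> j \<and> confusable (cw j') c)
      \<le> (\<Sum>j'\<in>{..<M} - {j}. of_bool (confusable (cw j') c) :: real)" for j c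
  proof (cases "\<exists>j'<M. j' \<noteq> j \<and> confusable (cw j') c")
    case True
    then obtain j' where j': "j' < M" "j' \<noteq> j" "confusable (cw j') c" by blast
    then have "1 = (of_bool (confusable (cw j') c) :: real)" by simp
    also have "\<dots> \<le> (\<Sum>j'\<in>{..<M} - {j}. of_bool (confusable (cw j') c))"
      using j' by (intro member_le_sum) auto
    finally show ?thesis by simp
  qed (auto intro!: sum_nonneg)
  have "(\<Sum>c | length c = N. path_weight (chan (cw j)) c *
       (real (hit_time (cw j) c) + lam * of_bool (fails (cw j) c)
        + lam * of_bool (\<exists>j'<M. j' \<noteq> j \<and> confusable (cw j') c)))
     \<le> F (cw j) + (\<Sum>j'\<in>{..<M} - {j}. G (cw j) (cw j'))" for j
  proof -
    have "(\<Sum>c | length c = N. path_weight (chan (cw j)) c *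
       (real (hit_time (cw j) c) + lam * of_bool (fails (cw j) c)
        + lam * of_bool (\<exists>j'<M. j' \<noteq> j \<and> confusable (cw j') c)))
      \<le> (\<Sum>c | length c = N. path_weight (chan (cw j)) c *
       (real (hit_time (cw j) c) + lam * of_bool (fails (cw j) c)
        + lam * (\<Sum>j'\<in>{..<M} - {j}. of_bool (confusable (cw j') c))))"
      by (intro sum_mono mult_left_mono add_left_mono u K0 lam)
    also have "\<dots> = F (cw j) + (\<Sum>c | length c = N. \<Sum>j'\<in>{..<M} - {j}.
        lam * (path_weight (chan (cw j)) c * of_bool (confusable (cw j') c)))"
      unfolding F_def sum.distrib[symmetric]
      by (intro sum.cong refl) (simp only: distrib_left sum_distrib_left mult_ac)
    also have "\<dots> = F (cw j) + (\<Sum>j'\<in>{..<M} - {j}. G (cw j) (cw j'))"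
      unfolding G_def sum_distrib_left by (subst sum.swap) simp
    finally show ?thesis .
  qed
  then have "(\<Sum>j<M. \<Sum>c | length c = N. path_weight (chan (cw j)) c *
       (real (hit_time (cw j) c) + lam * of_bool (fails (cw j) c)
        + lam * of_bool (\<exists>j'<M. j' \<noteq> j \<and> confusable (cw j') c)))
     \<le> (\<Sum>j<M. F (cw j) + (\<Sum>j'\<in>{..<M} - {j}. G (cw j) (cw j')))"
    by (intro sum_mono)
  also have "\<dots> \<le> real M * (\<Sum>w | length w = N. ?Q w * F w)
       + real M * (real M - 1) * (\<Sum>w | length w = N. ?Q w * (\<Sum>w' | length w' = N. ?Q w' * G w w'))"
    using le by (simp add: sum.distrib)
  also have "\<dots> \<le> real M * X + real M * (real M - 1) * (lam * ?e)"
    using EF EG M by (intro add_mono mult_left_mono) auto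
  also have "\<dots> = real M * (X + real (M - 1) * lam * ?e)"
    using M by (simp add: of_nat_diff algebra_simps)
  finally show ?thesis using cw by blast
qed

end

section \<open>Balancing the receivers\<close>

text \<open>Stated outside the locale because \<open>pick\<close> is a parameter of
  \<open>scheme\<close> and is to be built from it. On full histories it equals the sum of the first
  \<open>n\<close> centred steps.\<close>

definition phase_one_deviation ::
  "(bool \<Rightarrow> 'x::finite \<Rightarrow> 'y::finite \<Rightarrow> real) \<Rightarrow> ('x \<Rightarrow> real) \<Rightarrow> ('w \<Rightarrow> 'x) \<Rightarrow> nat \<Rightarrow> real \<Rightarrow>
   bool \<Rightarrow> ('w \<times> 'y \<times> 'y) list \<Rightarrow> real" where
  "phase_one_deviation W P0 \<xi> n C k h =
     (\<Sum>i<n. info_dens (W k) P0 (\<xi> (fst (h ! i))) (receiver k (snd (h ! i))) - C)"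

text \<open>With \<open>s\<close> steps of \<open>P\<^sub>+\<close> and \<open>T - s\<close> steps of \<open>P\<^sub>-\<close> the drifts of the two receivers are
  shifted by \<open>(2 s - T) d\<close> and \<open>- \<rho> (2 s - T) d\<close>; this \<open>s\<close> makes the shifted deviations
  equal up to rounding.\<close>

definition balancing_split :: "real \<Rightarrow> real \<Rightarrow> nat \<Rightarrow> (bool \<Rightarrow> real) \<Rightarrow> nat" where
  "balancing_split \<rho> d T D = min T (nat \<lfloor>((D False - D True) / (1 + \<rho>) / d + real T) / 2\<rfloor>)"

locale balanced_scheme = scheme W P R letter n T \<gamma> pick
  for W :: "bool \<Rightarrow> 'x::finite \<Rightarrow> 'y::finite \<Rightarrow> real" and P
    and R :: "'w::finite \<Rightarrow> real" and letter n T \<gamma> pick +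
  fixes C d \<rho> B c0 l x :: real
  assumes pick_eq: "pick h = balancing_split \<rho> d T (\<lambda>k. phase_one_deviation W (P 0) (letter 0) n C k h)"
    and C: "mutual_info (W k) (P 0) = C" "0 < C"
    and \<rho>: "0 < \<rho>" and d: "0 < d"
    and plus: "C + d * (if k then 1 else - \<rho>) - c0 * d\<^sup>2 \<le> mutual_info (W k) (P 1)"
    and minus: "C - d * (if k then 1 else - \<rho>) - c0 * d\<^sup>2 \<le> mutual_info (W k) (P 2)"
    and B: "\<bar>info_dens (W k) (P m) a b\<bar> \<le> B" "0 < B"
    and c0: "0 \<le> c0"
    and l: "0 < l" "l \<le> real (3 * T)" "l \<le> x" and n_le: "real n \<le> x"
    and gamma_eq: "\<gamma> = C * real (n + 2 * T)"
begin

text \<open>Bound on the phase-one deviations up to probability \<open>exp (- l)\<close>; the factor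
  4 arises because the increments are bounded by \<open>2 * B\<close>.\<close>

definition "A = 4 * B * sqrt (l * x)"
text \<open>In this order: rounding of the switching time, quadratic cost of the perturbed inputs,
  and fluctuations after phase one.\<close>

definition "err = 2 * d + c0 * real T * d\<^sup>2 + 4 * B * sqrt (l * real (3 * T))"

abbreviation "dev k h \<equiv> (\<Sum>i<n. centred_step k (take i h) (h ! i))"
abbreviation "tail k t h \<equiv> (\<Sum>i=n..<t. centred_step k (take i h) (h ! i))"

text \<open>The convex combination that is invariant under shifting the two deviations by
  \<open>z\<close> and \<open>- \<rho> * z\<close>, hence the common value that balancing
  produces.\<close>

definition "mean_dev h = (\<rho> * dev True h + dev False h) / (1 + \<rho>)"

definition good :: "('w \<times> 'y \<times> 'y) list \<Rightarrow> bool" where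
  "good h \<longleftrightarrow> (\<forall>k. \<bar>dev k h\<bar> \<le> A \<and> (\<forall>t\<in>{n+T..N}. - (4 * B * sqrt (l * real (3 * T))) \<le> tail k t h))"

sublocale md: martingale_differences joint "centred_step k" "2 * B" for k
  by (intro martingale_centred_step B)

lemma err_nonneg: "0 \<le> err"
  using d c0 B l by (auto simp: err_def intro!: add_nonneg_nonneg mult_nonneg_nonneg)

lemma phase_one_deviation_eq:
  assumes "length h = N"
  shows "phase_one_deviation W (P 0) (letter 0) n C k (take n h) = dev k h"
  unfolding phase_one_deviation_def
  using assms C(1) by (intro sum.cong refl)
    (simp add: centred_step_def step_info_def cur_mode_def mode_def N_def)

text \<open>The condition \<open>2 * A \<le> real T * d\<close> keeps the ideal split within
  \<open>{0..T}\<close>, so no truncation occurs. Rounding it down by less than one lowers the shift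
  by at most \<open>2 * d\<close>.\<close>

lemma balanced_split_bounds:
  assumes "\<bar>D True\<bar> \<le> A" "\<bar>D False\<bar> \<le> A" "2 * A \<le> real T * d"
  defines "e \<equiv> (D False - D True) / (1 + \<rho>)"
  defines "s \<equiv> balancing_split \<rho> d T D"
  shows "(2 * real s - real T) * d \<le> e" "e - 2 * d \<le> (2 * real s - real T) * d"
proof -
  have "\<bar>e\<bar> \<le> \<bar>D False - D True\<bar>"
    using \<rho> unfolding e_def by (simp add: abs_divide divide_le_eq mult_le_cancel_left1)
  then have "\<bar>e\<bar> \<le> real T * d" using assms by linarith
  then have ed: "\<bar>e / d\<bar> \<le> real T" using d by (simp add: abs_divide divide_le_eq)
  define u where "u = (e / d + real T) / 2"
  have u: "0 \<le> u" "u \<le> real T" using abs_le_D1[OF ed] abs_le_D2[OF ed] by (simp_all add: u_def)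
  then have "s = nat \<lfloor>u\<rfloor>"
    unfolding s_def balancing_split_def e_def[symmetric] u_def[symmetric]
    by (simp add: le_floor_iff floor_le_iff nat_le_iff min_def) linarith
  then have s: "real s \<le> u" "u < real s + 1" using u(1) by (simp_all add: of_nat_nat)
  have e: "e = (2 * u - real T) * d" using d by (simp add: u_def field_simps)
  show "(2 * real s - real T) * d \<le> e" unfolding e using s d by (intro mult_right_mono) auto
  have "(2 * u - real T) * d - 2 * d = (2 * (u - 1) - real T) * d" by (simp add: algebra_simps)
  also have "\<dots> \<le> (2 * real s - real T) * d" using s d by (intro mult_right_mono) auto
  finally show "e - 2 * d \<le> (2 * real s - real T) * d" unfolding e .
qed

lemma drift_sum:
  assumes s: "s \<le> T" and t: "n + T \<le> t"
  shows "C * real (t - n) + (2 * real s - real T) * d * (if k then 1 else - \<rho>) - c0 * real T * d\<^sup>2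
    \<le> (\<Sum>i=n..<t. mutual_info (W k) (P (mode s i)))"
proof -
  let ?f = "\<lambda>i. mutual_info (W k) (P (mode s i))" and ?g = "if k then 1 else - \<rho>"
  have "(\<Sum>i=n..<t. ?f i) = (\<Sum>i=n..<n+s. ?f i) + (\<Sum>i=n+s..<n+T. ?f i) + (\<Sum>i=n+T..<t. ?f i)"
    using s t by (simp add: sum.atLeastLessThan_concat)
  moreover have "(\<Sum>i=n..<n+s. ?f i) = real s * mutual_info (W k) (P 1)"
    using s by (simp add: mode_def)
  moreover have "(\<Sum>i=n+s..<n+T. ?f i) = real (T - s) * mutual_info (W k) (P 2)"
    using s by (simp add: mode_def)
  moreover have "(\<Sum>i=n+T..<t. ?f i) = real (t - (n + T)) * C"
    by (simp add: mode_def C)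
  moreover have "real s * (C + d * ?g - c0 * d\<^sup>2) \<le> real s * mutual_info (W k) (P 1)"
    by (intro mult_left_mono plus) auto
  moreover have "real (T - s) * (C - d * ?g - c0 * d\<^sup>2) \<le> real (T - s) * mutual_info (W k) (P 2)"
    by (intro mult_left_mono minus) auto
  moreover have "real s * (C + d * ?g - c0 * d\<^sup>2) + real (T - s) * (C - d * ?g - c0 * d\<^sup>2)
      + real (t - (n + T)) * C
    = C * real (t - n) + (2 * real s - real T) * d * ?g - c0 * real T * d\<^sup>2"
    using s t by (simp add: of_nat_diff algebra_simps)
  ultimately show ?thesis by linarith
qed

text \<open>After balancing both receivers are ahead or behind by the same
  \<open>mean_dev h\<close>, up to \<open>err\<close>; all later losses are collected from
  \<open>drift_sum\<close> and the tail bound.\<close>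

lemma good_step_info:
  assumes h: "length h = N" "good h" and A: "2 * A \<le> real T * d" and t: "n + T \<le> t" "t \<le> N"
  shows "C * real t + mean_dev h - err \<le> (\<Sum>i<t. step_info k (take i h) (h ! i))"
proof -
  define s where "s = pick (take n h)"
  define D where "D k = dev k h" for k
  have s: "s = balancing_split \<rho> d T D"
    unfolding s_def D_def phase_one_deviation_eq[OF h(1), symmetric] by (rule pick_eq)
  have D: "\<bar>D True\<bar> \<le> A" "\<bar>D False\<bar> \<le> A"
    using h(2) by (auto simp: good_def D_def)
  have tail: "- (4 * B * sqrt (l * real (3 * T))) \<le> tail k t h"
    using h(2) t by (auto simp: good_def)
  have sT: "s \<le> T" unfolding s_def by (rule pick)
  have info: "step_info k (take i h) (h ! i)
      = centred_step k (take i h) (h ! i) + mutual_info (W k) (P (mode s i))" if "i < t" for i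
    using that t h(1) by (simp add: centred_step_def cur_mode_take s_def)
  have "(\<Sum>i<t. step_info k (take i h) (h ! i))
      = (\<Sum>i<n. step_info k (take i h) (h ! i)) + (\<Sum>i=n..<t. step_info k (take i h) (h ! i))"
    using t sum.atLeastLessThan_concat[of 0 n t "\<lambda>i. step_info k (take i h) (h ! i)"]
    by (simp add: atLeast0LessThan)
  also have "(\<Sum>i<n. step_info k (take i h) (h ! i)) = D k + C * real n"
    unfolding D_def using info t by (simp add: sum.distrib mode_def C)
  also have "(\<Sum>i=n..<t. step_info k (take i h) (h ! i))
      = tail k t h + (\<Sum>i=n..<t. mutual_info (W k) (P (mode s i)))"
    using info by (simp add: sum.distrib)
  finally have eq: "(\<Sum>i<t. step_info k (take i h) (h ! i)) = D k + C * real n + (tail k t h +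
      (\<Sum>i=n..<t. mutual_info (W k) (P (mode s i))))" .
  let ?g = "if k then 1 else - \<rho>" and ?z = "(2 * real s - real T) * d"
  \<comment> \<open>Rounding down costs receiver 1 at most \<open>2 * d\<close>; for receiver 2 it
    works in the favourable direction, since its shift has the opposite sign.\<close>
  have bal: "mean_dev h - 2 * d \<le> D k + ?z * ?g"
  proof (cases k)
    case True
    have "mean_dev h = D True + (D False - D True) / (1 + \<rho>)"
      using \<rho> by (simp add: mean_dev_def D_def field_simps)
    then show ?thesis using balanced_split_bounds(2)[OF D A] True s by simp
  next
    case False
    have "mean_dev h = D False - \<rho> * ((D False - D True) / (1 + \<rho>))"
      using \<rho> by (simp add: mean_dev_def D_def field_simps)
    moreover have "\<rho> * ?z \<le> \<rho> * ((D False - D True) / (1 + \<rho>))"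
      using balanced_split_bounds(1)[OF D A] \<rho> s by (intro mult_left_mono) auto
    ultimately have "mean_dev h \<le> D False - \<rho> * ?z" by linarith
    then show ?thesis using False d by (simp add: mult.commute)
  qed
  have "C * real n + C * real (t - n) = C * real t"
    using t by (simp add: of_nat_diff algebra_simps)
  then show ?thesis
    using eq bal tail drift_sum[OF sT t(1), of k] unfolding err_def by linarith
qed

lemma mean_dev_le:
  assumes "\<bar>dev True h\<bar> \<le> b" "\<bar>dev False h\<bar> \<le> b" shows "\<bar>mean_dev h\<bar> \<le> b"
proof -
  have "\<bar>\<rho> * dev True h + dev False h\<bar> \<le> \<rho> * \<bar>dev True h\<bar> + \<bar>dev False h\<bar>"
    using \<rho> abs_triangle_ineq[of "\<rho> * dev True h" "dev False h"] by (simp add: abs_mult)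
  also have "\<dots> \<le> \<rho> * b + b" using assms \<rho> by (intro add_mono mult_left_mono) auto
  finally show ?thesis using \<rho> by (simp add: mean_dev_def abs_divide divide_le_eq algebra_simps)
qed

lemma good_hit:
  assumes h: "length h = N" "0 < path_weight joint h" "good h"
    and A: "2 * A \<le> real T * d" and T: "(A + err) / C + 1 \<le> real T"
  shows "\<not> fails (map fst h) (map snd h)"
    "real (hit_time (map fst h) (map snd h)) \<le> (\<gamma> + err - mean_dev h) / C + 1"
proof -
  have md: "\<bar>mean_dev h\<bar> \<le> A" using h(3) by (intro mean_dev_le) (auto simp: good_def)
  \<comment> \<open>At time \<open>r\<close> the guaranteed information equals the threshold. The
    lower bound on \<open>T\<close> keeps \<open>r\<close>, even rounded up, between the end of
    balancing and the horizon.\<close>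
  define r where "r = (\<gamma> + err - mean_dev h) / C"
  have r_eq: "r = real (n + 2 * T) + (err - mean_dev h) / C"
    using C by (simp add: r_def gamma_eq field_simps)
  have "(err - mean_dev h) / C \<le> (A + err) / C" using md C by (intro divide_right_mono) auto
  then have up: "r + 1 \<le> real (n + 3 * T)" using T unfolding r_eq by simp
  have "(- (A + err)) / C \<le> (err - mean_dev h) / C"
    using md C err_nonneg by (intro divide_right_mono) auto
  then have lo: "real (n + T) \<le> r"
    using T unfolding r_eq minus_divide_left[symmetric] of_nat_add of_nat_mult by linarith
  define t where "t = nat \<lceil>r\<rceil>"
  have t: "r \<le> real t" "real t \<le> r + 1" using lo unfolding t_def by linarith+
  have nt: "n + T \<le> t" using lo t by linarith
  have tN: "t \<le> N" using up t unfolding N_def by linarith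
  have "C * r = \<gamma> + err - mean_dev h" using C by (simp add: r_def)
  then have "\<gamma> \<le> C * real t + mean_dev h - err"
    using mult_left_mono[OF t(1), of C] C by linarith
  then have ge: "\<gamma> \<le> (\<Sum>i<t. step_info k (take i h) (h ! i))" for k
    using good_step_info[OF h(1,3) A nt tN, of k] by linarith
  have "hit (map fst h) (map snd h) t"
    unfolding hit_def
  proof (intro conjI allI tN)
    fix k
    show "crosses k (map fst h) (pick (take n (zip (map fst h) (map snd h))))
        (map (receiver k) (take t (map snd h)))"
      using crosses_if_step_info[OF h(2) _ ge, of k] tN h(1)
      by (simp add: zip_map_fst_snd take_map comp_def)
  qed
  then show "\<not> fails (map fst h) (map snd h)"
    "real (hit_time (map fst h) (map snd h)) \<le> (\<gamma> + err - mean_dev h) / C + 1"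
    using hit_time_le[of "map fst h" "map snd h" t] t by (auto simp: fails_def r_def)
qed

text \<open>Four phase-one tails (two receivers, two signs) and \<open>2 * (2 * T + 1)\<close> later
  ones, each of probability at most \<open>exp (- l)\<close>.\<close>

lemma bad_prob:
  "(\<Sum>h | length h = N. path_weight joint h * of_bool (\<not> good h)) \<le> real (4 * T + 6) * exp (- l)"
proof -
  let ?r = "4 * B * sqrt (l * real (3 * T))"
  let ?u = "\<lambda>k h. of_bool (A < dev k h) :: real"
  let ?v = "\<lambda>k h. of_bool (dev k h < - A) :: real"
  let ?w = "\<lambda>k t h. of_bool (tail k t h < - ?r) :: real"
  have pos: "0 \<le> path_weight joint h" for h by (intro path_weight_nonneg joint_nonneg)
  have le: "of_bool (\<not> good h) \<le> (\<Sum>k\<in>UNIV. ?u k h + ?v k h + (\<Sum>t=n+T..N. ?w k t h))" for h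
  proof (cases "good h")
    case False
    then obtain k where "\<not> \<bar>dev k h\<bar> \<le> A \<or> (\<exists>t\<in>{n+T..N}. tail k t h < - ?r)"
      unfolding good_def by (meson linorder_not_less)
    then have k: "A < dev k h \<or> dev k h < - A \<or> (\<exists>t\<in>{n+T..N}. tail k t h < - ?r)"
      by linarith
    have uv: "0 \<le> ?u k h" "0 \<le> ?v k h" by simp_all
    have ws: "0 \<le> (\<Sum>t=n+T..N. ?w k t h)" by (intro sum_nonneg) simp
    from k have "1 \<le> ?u k h + ?v k h + (\<Sum>t=n+T..N. ?w k t h)"
    proof (elim disjE bexE)
      assume "A < dev k h"
      then have "?u k h = 1" by simp
      then show ?thesis using uv ws by linarith
    next
      assume "dev k h < - A"
      then have "?v k h = 1" by simp
      then show ?thesis using uv ws by linarith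
    next
      fix t assume t: "t \<in> {n+T..N}" "tail k t h < - ?r"
      then have "1 = ?w k t h" by simp
      also have "\<dots> \<le> (\<Sum>t=n+T..N. ?w k t h)" using t(1) by (intro member_le_sum) auto
      finally show ?thesis using uv by linarith
    qed
    also have "\<dots> \<le> (\<Sum>k\<in>UNIV. ?u k h + ?v k h + (\<Sum>t=n+T..N. ?w k t h))"
      by (intro member_le_sum add_nonneg_nonneg sum_nonneg) auto
    finally show ?thesis by simp
  qed (auto intro!: sum_nonneg add_nonneg_nonneg)
  have dv: "dev k h = (\<Sum>i=0..<n. centred_step k (take i h) (h ! i))" for k h
    by (simp add: atLeast0LessThan)
  have u: "(\<Sum>h | length h = N. path_weight joint h * ?u k h) \<le> exp (- l)" for k
    using md.upper_tail[of 0 n N x l k] l n_le unfolding dv A_def by (simp add: N_def)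
  have v: "(\<Sum>h | length h = N. path_weight joint h * ?v k h) \<le> exp (- l)" for k
    using md.lower_tail[of 0 n N x l k] l n_le unfolding dv A_def by (simp add: N_def)
  have w: "(\<Sum>h | length h = N. path_weight joint h * ?w k t h) \<le> exp (- l)" if "t \<in> {n+T..N}" for k t
    using md.lower_tail[of n t N "real (3 * T)" l k] l that by (simp add: N_def)
  have "(\<Sum>h | length h = N. path_weight joint h * of_bool (\<not> good h))
      \<le> (\<Sum>h | length h = N. path_weight joint h * (\<Sum>k\<in>UNIV. ?u k h + ?v k h + (\<Sum>t=n+T..N. ?w k t h)))"
    by (intro sum_mono mult_left_mono le pos)
  also have "\<dots> = (\<Sum>h | length h = N. \<Sum>k\<in>UNIV. path_weight joint h * ?u k h + path_weight joint h * ?v k h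
        + (\<Sum>t=n+T..N. path_weight joint h * ?w k t h))"
    by (simp only: sum_distrib_left distrib_left)
  also have "\<dots> = (\<Sum>k\<in>UNIV. \<Sum>h | length h = N. path_weight joint h * ?u k h + path_weight joint h * ?v k h
        + (\<Sum>t=n+T..N. path_weight joint h * ?w k t h))"
    by (rule sum.swap)
  also have "\<dots> = (\<Sum>k\<in>UNIV. (\<Sum>h | length h = N. path_weight joint h * ?u k h)
      + (\<Sum>h | length h = N. path_weight joint h * ?v k h)
      + (\<Sum>t=n+T..N. \<Sum>h | length h = N. path_weight joint h * ?w k t h))"
    unfolding sum.distrib by (subst sum.swap[of _ "{n+T..N}"]) (rule refl)
  also have "\<dots> \<le> (\<Sum>k\<in>(UNIV::bool set). exp (- l) + exp (- l) + (\<Sum>t=n+T..N. exp (- l)))"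
    by (intro sum_mono add_mono u v w)
  also have "\<dots> = real (4 * T + 6) * exp (- l)"
    by (simp add: N_def algebra_simps)
  finally show ?thesis .
qed

text \<open>This removes the fluctuation of order \<open>\<surd>x\<close> from the expected decoding
  time: the common deviation is a fixed linear combination of two martingales.\<close>

lemma mean_dev_zero: "(\<Sum>h | length h = N. path_weight joint h * mean_dev h) = 0"
proof -
  have "(\<Sum>h | length h = N. path_weight joint h * dev k h) = 0" for k
    by (rule md.mean_zero) (simp add: N_def)
  moreover have "path_weight joint h * mean_dev h
    = (\<rho> * (path_weight joint h * dev True h) + path_weight joint h * dev False h) / (1 + \<rho>)" for h
  proof -
    have "p * ((\<rho> * a + b) / (1 + \<rho>)) = (\<rho> * (p * a) + p * b) / (1 + \<rho>)" for p a b
      by (simp add: algebra_simps)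
    then show ?thesis unfolding mean_dev_def .
  qed
  ultimately show ?thesis
    by (simp only: sum_divide_distrib[symmetric] sum.distrib sum_distrib_left[symmetric]) simp
qed

text \<open>The term \<open>- mean_dev h / C\<close> is kept on bad paths too, so that its full
  expectation vanishes. There the crude bound \<open>2 * B * real n / C\<close> compensates for it,
  next to the worst-case time \<open>N\<close> and the penalty \<open>lam\<close>.\<close>

lemma expected_cost:
  assumes A: "2 * A \<le> real T * d" and T: "(A + err) / C + 1 \<le> real T" and lam: "0 \<le> lam"
  shows "(\<Sum>h | length h = N. path_weight joint h *
      (real (hit_time (map fst h) (map snd h)) + lam * of_bool (fails (map fst h) (map snd h))))
    \<le> (\<gamma> + err) / C + 1 + (real N + lam + 2 * B * real n / C) * (real (4 * T + 6) * exp (- l))"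
proof -
  let ?K = "real N + lam + 2 * B * real n / C"
  have pos: "0 \<le> path_weight joint h" for h by (intro path_weight_nonneg joint_nonneg)
  have K: "0 \<le> ?K" using lam B C by simp
  have pt: "path_weight joint h * (real (hit_time (map fst h) (map snd h)) + lam * of_bool (fails (map fst h) (map snd h)))
    \<le> path_weight joint h * ((\<gamma> + err) / C + 1 - mean_dev h / C + ?K * of_bool (\<not> good h))"
    if len: "length h = N" for h
  proof (cases "path_weight joint h = 0")
    case False
    then have pw: "0 < path_weight joint h" using pos[of h] by simp
    show ?thesis
    proof (cases "good h")
      case True
      from good_hit[OF len pw True A T] True show ?thesis
        by (intro mult_left_mono pos) (simp add: diff_divide_distrib add_divide_distrib)
    next
      case bad: False
      have "\<bar>dev k h\<bar> \<le> 2 * B * real n" for k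
      proof -
        have "\<bar>dev k h\<bar> \<le> (\<Sum>i<n. 2 * B)"
          by (rule order_trans[OF sum_abs], rule sum_mono) (rule md.bounded)
        then show ?thesis by (simp add: mult_ac)
      qed
      then have "\<bar>mean_dev h\<bar> \<le> 2 * B * real n" by (intro mean_dev_le)
      then have 1: "mean_dev h / C \<le> 2 * B * real n / C" using C by (intro divide_right_mono) auto
      have 2: "0 \<le> (\<gamma> + err) / C" using err_nonneg C by (simp add: gamma_eq)
      have "lam * of_bool (fails (map fst h) (map snd h)) \<le> lam" using lam by simp
      then show ?thesis
        using bad 1 2 hit_time_le_N[of "map fst h" "map snd h"]
        by (intro mult_left_mono pos) simp
    qed
  qed simp
  have "(\<Sum>h | length h = N. path_weight joint h *
      (real (hit_time (map fst h) (map snd h)) + lam * of_bool (fails (map fst h) (map snd h))))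
    \<le> (\<Sum>h | length h = N. path_weight joint h * ((\<gamma> + err) / C + 1 - mean_dev h / C + ?K * of_bool (\<not> good h)))"
    using pt by (intro sum_mono) auto
  also have "\<dots> = (\<Sum>h | length h = N. path_weight joint h) * ((\<gamma> + err) / C + 1)
      - (\<Sum>h | length h = N. path_weight joint h * mean_dev h) / C
      + ?K * (\<Sum>h | length h = N. path_weight joint h * of_bool (\<not> good h))"
    unfolding sum_distrib_right sum_distrib_left sum_divide_distrib sum_subtractf[symmetric] sum.distrib[symmetric]
    by (intro sum.cong refl) (simp only: algebra_simps times_divide_eq_right times_divide_eq_left)
  also have "\<dots> \<le> (\<gamma> + err) / C + 1 + ?K * (real (4 * T + 6) * exp (- l))"
    using mult_left_mono[OF bad_prob K] by (simp add: sum_path_weight[OF joint_sum] mean_dev_zero)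
  finally show ?thesis .
qed

end

section \<open>Codes with a bounded horizon\<close>

definition pair_kernel ::
  "('x \<Rightarrow> 'y \<Rightarrow> real) \<Rightarrow> ('x \<Rightarrow> 'y \<Rightarrow> real) \<Rightarrow> (nat \<Rightarrow> nat \<Rightarrow> 'y list \<Rightarrow> 'y list \<Rightarrow> 'x) \<Rightarrow>
   nat \<Rightarrow> nat \<Rightarrow> ('y \<times> 'y) list \<Rightarrow> 'y \<times> 'y \<Rightarrow> real" where
  "pair_kernel W1 W2 f u j c y =
     (let x = f u j (map fst c) (map snd c) in W1 x (fst y) * W2 x (snd y))"

definition code_average ::
  "('x \<Rightarrow> 'y::finite \<Rightarrow> real) \<Rightarrow> ('x \<Rightarrow> 'y \<Rightarrow> real) \<Rightarrow> nat pmf \<Rightarrow> nat \<Rightarrow>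
   (nat \<Rightarrow> nat \<Rightarrow> 'y list \<Rightarrow> 'y list \<Rightarrow> 'x) \<Rightarrow> nat \<Rightarrow>
   (nat \<Rightarrow> nat \<Rightarrow> ('y \<times> 'y) list \<Rightarrow> real) \<Rightarrow> real" where
  "code_average W1 W2 PU M f n \<phi> = (\<Sum>u\<in>set_pmf PU. \<Sum>j\<in>{1..M}. pmf PU u / real M *
     (\<Sum>c | length c = n. path_weight (pair_kernel W1 W2 f u j) c * \<phi> u j c))"

text \<open>Meaningful when the rule fires on some prefix, as it does for the rules below, which
  fire at length \<open>N\<close> at the latest.\<close>

definition stop_time :: "(nat \<Rightarrow> 'y list \<Rightarrow> bool) \<Rightarrow> nat \<Rightarrow> 'y list \<Rightarrow> nat" where
  "stop_time st u ys = (LEAST m. st u (take m ys))"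

lemma prefix_prob_eq_path_weight:
  assumes "length a = length b"
  shows "prefix_prob W1 W2 PU M f u j a b = pmf PU u / real M * path_weight (pair_kernel W1 W2 f u j) (zip a b)"
  unfolding prefix_prob_def path_weight_def using assms
  by (auto simp: pair_kernel_def Let_def take_zip intro!: prod.cong)

lemma event_prob_eq_code_average:
  "event_prob W1 W2 PU M f n E
    = code_average W1 W2 PU M f n (\<lambda>u j c. of_bool (E u j (map fst c) (map snd c)))"
  unfolding event_prob_def code_average_def sum_zip_lists sum_distrib_left
  by (intro sum.cong refl) (auto simp: prefix_prob_eq_path_weight)

lemma stop_time_le:
  assumes "\<And>ys. length ys = N \<Longrightarrow> st u ys" "length ys = N"
  shows "stop_time st u ys \<le> N" "st u (take (stop_time st u ys) ys)"
proof -
  have "st u (take N ys)" using assms by simp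
  then show "stop_time st u ys \<le> N" "st u (take (stop_time st u ys) ys)"
    unfolding stop_time_def by (rule Least_le, rule LeastI)
qed

lemma stop_time_minimal: "st u (take m ys) \<Longrightarrow> stop_time st u ys \<le> m"
  unfolding stop_time_def by (rule Least_le)

lemma stops_at_iff:
  assumes "\<And>ys. length ys = N \<Longrightarrow> st u ys" "length ys = N" "m \<le> N"
  shows "stops_at st u (take m ys) \<longleftrightarrow> m = stop_time st u ys"
proof -
  have *: "stops_at st u (take m ys) \<longleftrightarrow> st u (take m ys) \<and> (\<forall>m'<m. \<not> st u (take m' ys))"
    using assms(2,3) unfolding stops_at_def by (auto simp: min_def)
  show ?thesis
    unfolding * using stop_time_le[of N st u ys, OF assms(1,2)] stop_time_minimal[of st u _ ys]
    by (metis linorder_not_less nat_less_le)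
qed

lemma stopped_by_iff:
  assumes "\<And>ys. length ys = N \<Longrightarrow> st u ys" "length ys = N" "m \<le> N"
  shows "stopped_by st u (take m ys) \<longleftrightarrow> stop_time st u ys \<le> m"
proof -
  have *: "stopped_by st u (take m ys) \<longleftrightarrow> (\<exists>m'\<le>m. st u (take m' ys))"
    using assms(2,3) unfolding stopped_by_def by (auto simp: min_def)
  show ?thesis
    unfolding * using stop_time_le[of N st u ys, OF assms(1,2)] stop_time_minimal[of st u _ ys]
    by (metis order_trans)
qed

lemma not_stops_at_beyond:
  assumes "\<And>ys. length ys = N \<Longrightarrow> st u ys" "N < length ys"
  shows "\<not> stops_at st u ys"
  using assms by (auto simp: stops_at_def intro!: exI[of _ N])

context
  fixes W1 W2 :: "'x::finite \<Rightarrow> 'y::finite \<Rightarrow> real"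
  assumes W: "stochastic W1" "stochastic W2"
begin

lemma pair_kernel_nonneg: "0 \<le> pair_kernel W1 W2 f u j c y"
  using W by (simp add: pair_kernel_def Let_def stochastic_def)

lemma pair_kernel_sum: "(\<Sum>y\<in>UNIV. pair_kernel W1 W2 f u j c y) = 1"
proof -
  let ?x = "f u j (map fst c) (map snd c)"
  have "(\<Sum>y\<in>UNIV. pair_kernel W1 W2 f u j c y) = (\<Sum>a\<in>UNIV. \<Sum>b\<in>UNIV. W1 ?x a * W2 ?x b)"
    unfolding UNIV_Times_UNIV[symmetric] sum.cartesian_product
    by (simp add: case_prod_unfold pair_kernel_def Let_def)
  also have "\<dots> = 1"
    using W by (simp add: stochastic_def sum_distrib_left[symmetric])
  finally show ?thesis .
qed

lemma code_average_mono:
  assumes "\<And>u j c. u \<in> set_pmf PU \<Longrightarrow> j \<in> {1..M} \<Longrightarrow> length c = n \<Longrightarrow> \<phi> u j c \<le> \<psi> u j c"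
  shows "code_average W1 W2 PU M f n \<phi> \<le> code_average W1 W2 PU M f n \<psi>"
  unfolding code_average_def using assms
  by (intro sum_mono mult_left_mono path_weight_nonneg pair_kernel_nonneg) auto

lemma code_average_const:
  assumes "finite (set_pmf PU)" "1 \<le> M"
  shows "code_average W1 W2 PU M f n (\<lambda>_ _ _. r) = r"
proof -
  have "code_average W1 W2 PU M f n (\<lambda>_ _ _. r) = (\<Sum>u\<in>set_pmf PU. pmf PU u) * r"
    unfolding code_average_def sum_distrib_right[symmetric] sum_path_weight[OF pair_kernel_sum]
    using assms(2) by (simp add: sum_distrib_right)
  also have "(\<Sum>u\<in>set_pmf PU. pmf PU u) = 1" using assms(1) by (intro sum_pmf_eq_1) auto
  finally show ?thesis by simp
qed

lemma code_average_take:
  assumes "m \<le> n"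
  shows "code_average W1 W2 PU M f m \<phi> = code_average W1 W2 PU M f n (\<lambda>u j c. \<phi> u j (take m c))"
  unfolding code_average_def using assms
  by (intro sum.cong refl arg_cong2[of _ _ _ _ "(*)"] path_weight_marginal[symmetric])
    (auto simp: pair_kernel_sum)

lemma code_average_sum:
  "(\<Sum>m\<in>A. x m * code_average W1 W2 PU M f n (\<phi> m))
    = code_average W1 W2 PU M f n (\<lambda>u j c. \<Sum>m\<in>A. x m * \<phi> m u j c)"
proof -
  have "(\<Sum>m\<in>A. x m * code_average W1 W2 PU M f n (\<phi> m))
    = (\<Sum>m\<in>A. \<Sum>u\<in>set_pmf PU. \<Sum>j\<in>{1..M}. \<Sum>c | length c = n.
        pmf PU u / real M * (path_weight (pair_kernel W1 W2 f u j) c * (x m * \<phi> m u j c)))"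
    unfolding code_average_def sum_distrib_left by (intro sum.cong refl) (simp add: mult_ac)
  also have "\<dots> = (\<Sum>u\<in>set_pmf PU. \<Sum>m\<in>A. \<Sum>j\<in>{1..M}. \<Sum>c | length c = n.
        pmf PU u / real M * (path_weight (pair_kernel W1 W2 f u j) c * (x m * \<phi> m u j c)))"
    by (rule sum.swap)
  also have "\<dots> = (\<Sum>u\<in>set_pmf PU. \<Sum>j\<in>{1..M}. \<Sum>m\<in>A. \<Sum>c | length c = n.
        pmf PU u / real M * (path_weight (pair_kernel W1 W2 f u j) c * (x m * \<phi> m u j c)))"
    by (intro sum.cong refl, rule sum.swap)
  also have "\<dots> = (\<Sum>u\<in>set_pmf PU. \<Sum>j\<in>{1..M}. \<Sum>c | length c = n. \<Sum>m\<in>A.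
        pmf PU u / real M * (path_weight (pair_kernel W1 W2 f u j) c * (x m * \<phi> m u j c)))"
    by (intro sum.cong refl, rule sum.swap)
  also have "\<dots> = code_average W1 W2 PU M f n (\<lambda>u j c. \<Sum>m\<in>A. x m * \<phi> m u j c)"
    unfolding code_average_def by (simp only: sum_distrib_left)
  finally show ?thesis .
qed

text \<open>Terms beyond the horizon vanish, and every earlier prefix event can be evaluated on
  paths of the common length \<open>N\<close>, so the series becomes one finite expectation.\<close>

lemma suminf_event_prob:
  assumes x: "\<And>m. 0 \<le> x m"
    and E: "\<And>u j a b. N < length a \<Longrightarrow> length a = length b \<Longrightarrow> \<not> E u j a b"
  shows "(\<Sum>m. ennreal (x m * event_prob W1 W2 PU M f m E))
    = ennreal (code_average W1 W2 PU M f N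
        (\<lambda>u j c. \<Sum>m\<le>N. x m * of_bool (E u j (take m (map fst c)) (take m (map snd c)))))"
proof -
  have pos: "0 \<le> event_prob W1 W2 PU M f m E" for m
    unfolding event_prob_eq_code_average code_average_def
    by (intro sum_nonneg mult_nonneg_nonneg path_weight_nonneg pair_kernel_nonneg) auto
  have "event_prob W1 W2 PU M f m E = 0" if "N < m" for m
    unfolding event_prob_eq_code_average code_average_def using E that
    by (intro sum.neutral ballI) auto
  then have "(\<Sum>m. ennreal (x m * event_prob W1 W2 PU M f m E))
      = (\<Sum>m\<le>N. ennreal (x m * event_prob W1 W2 PU M f m E))"
    by (intro suminf_finite) auto
  also have "\<dots> = ennreal (\<Sum>m\<le>N. x m * event_prob W1 W2 PU M f m E)"
    using x pos by (intro sum_ennreal) auto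
  also have "(\<Sum>m\<le>N. x m * event_prob W1 W2 PU M f m E) = (\<Sum>m\<le>N. x m *
      code_average W1 W2 PU M f N (\<lambda>u j c. of_bool (E u j (map fst (take m c)) (map snd (take m c)))))"
    unfolding event_prob_eq_code_average
    by (intro sum.cong refl arg_cong2[of _ _ _ _ "(*)"] code_average_take) auto
  also have "\<dots> = code_average W1 W2 PU M f N
        (\<lambda>u j c. \<Sum>m\<le>N. x m * of_bool (E u j (take m (map fst c)) (take m (map snd c))))"
    unfolding code_average_sum by (simp add: take_map)
  finally show ?thesis .
qed

text \<open>Since both rules fire by time \<open>N\<close>, the series conditions of
  \<open>vlf_code\<close> turn into ordinary expectations of functions of the stopping
  times.\<close>

lemma vlf_code_bounded_horizon:
  assumes M: "1 \<le> M" and PU: "finite (set_pmf PU)" "card (set_pmf PU) \<le> 3"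
    and g: "\<And>u ys. g1 u ys \<in> {1..M}" "\<And>u ys. g2 u ys \<in> {1..M}"
    and st: "\<And>u ys. length ys = N \<Longrightarrow> st1 u ys" "\<And>u ys. length ys = N \<Longrightarrow> st2 u ys"
    and time: "code_average W1 W2 PU M f N
        (\<lambda>u j c. real (max (stop_time st1 u (map fst c)) (stop_time st2 u (map snd c)))) \<le> nbar"
    and err1: "code_average W1 W2 PU M f N
        (\<lambda>u j c. of_bool (g1 u (take (stop_time st1 u (map fst c)) (map fst c)) \<noteq> j)) \<le> eps"
    and err2: "code_average W1 W2 PU M f N
        (\<lambda>u j c. of_bool (g2 u (take (stop_time st2 u (map snd c)) (map snd c)) \<noteq> j)) \<le> eps"
  shows "vlf_code W1 W2 nbar M eps PU f st1 st2 g1 g2"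
proof -
  let ?t1 = "\<lambda>u c. stop_time st1 u (map fst c)" and ?t2 = "\<lambda>u c. stop_time st2 u (map snd c)"
  have cong: "code_average W1 W2 PU M f N \<phi> = code_average W1 W2 PU M f N \<psi>"
    if "\<And>u j c. length c = N \<Longrightarrow> \<phi> u j c = \<psi> u j c" for \<phi> \<psi>
    unfolding code_average_def using that by (intro sum.cong refl arg_cong2[of _ _ _ _ "(*)"]) auto
  have single: "(\<Sum>m\<le>N. x m * of_bool (m = t \<and> Q m)) = x t * of_bool (Q t)"
    if "t \<le> N" for x :: "nat \<Rightarrow> real" and t Q
  proof -
    have "(\<Sum>m\<le>N. x m * of_bool (m = t \<and> Q m)) = (\<Sum>m\<in>{t}. x m * of_bool (m = t \<and> Q m))"
      using that by (intro sum.mono_neutral_right) auto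
    then show ?thesis by simp
  qed
  have nb: "\<not> stops_at st1 u ys" "\<not> stops_at st2 u ys" if "N < length ys" for u ys
    using not_stops_at_beyond st that by blast+
  have tl: "?t1 u c \<le> N" "?t2 u c \<le> N" if "length c = N" for u c
    using that by (auto intro!: stop_time_le(1) st)
  have s1: "stops_at st1 u (take m (map fst c)) \<longleftrightarrow> m = ?t1 u c"
    and s2: "stops_at st2 u (take m (map snd c)) \<longleftrightarrow> m = ?t2 u c"
    and b1: "stopped_by st1 u (take m (map fst c)) \<longleftrightarrow> ?t1 u c \<le> m"
    and b2: "stopped_by st2 u (take m (map snd c)) \<longleftrightarrow> ?t2 u c \<le> m"
    if "length c = N" "m \<le> N" for u c m
    using stops_at_iff[OF st(1), where ys = "map fst c" and m = m and u = u]
      stops_at_iff[OF st(2), where ys = "map snd c" and m = m and u = u]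
      stopped_by_iff[OF st(1), where ys = "map fst c" and m = m and u = u]
      stopped_by_iff[OF st(2), where ys = "map snd c" and m = m and u = u] that
    by simp_all
  have 1: "(\<Sum>n. ennreal (event_prob W1 W2 PU M f n (\<lambda>u j a b. stops_at st1 u a))) = 1"
  proof -
    have "code_average W1 W2 PU M f N (\<lambda>u j c. \<Sum>m\<le>N. 1 * of_bool (stops_at st1 u (take m (map fst c))))
      = code_average W1 W2 PU M f N (\<lambda>_ _ _. 1)"
    proof (rule cong)
      fix u j :: nat and c :: "('y \<times> 'y) list" assume c: "length c = N"
      have "(\<Sum>m\<le>N. 1 * of_bool (stops_at st1 u (take m (map fst c))))
        = (\<Sum>m\<le>N. (1::real) * of_bool (m = ?t1 u c \<and> True))"
        using c by (intro sum.cong refl) (simp only: atMost_iff s1 simp_thms)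
      also have "\<dots> = 1 * of_bool True" using tl[OF c] by (intro single) simp
      finally show "(\<Sum>m\<le>N. 1 * of_bool (stops_at st1 u (take m (map fst c)))) = (1 :: real)" by simp
    qed
    also have "\<dots> = 1" by (rule code_average_const[OF PU(1) M])
    finally show ?thesis
      using suminf_event_prob[of "\<lambda>_. 1" N "\<lambda>u j a b. stops_at st1 u a"] nb by simp
  qed
  have 2: "(\<Sum>n. ennreal (event_prob W1 W2 PU M f n (\<lambda>u j a b. stops_at st2 u b))) = 1"
  proof -
    have "code_average W1 W2 PU M f N (\<lambda>u j c. \<Sum>m\<le>N. 1 * of_bool (stops_at st2 u (take m (map snd c))))
      = code_average W1 W2 PU M f N (\<lambda>_ _ _. 1)"
    proof (rule cong)
      fix u j :: nat and c :: "('y \<times> 'y) list" assume c: "length c = N"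
      have "(\<Sum>m\<le>N. 1 * of_bool (stops_at st2 u (take m (map snd c))))
        = (\<Sum>m\<le>N. (1::real) * of_bool (m = ?t2 u c \<and> True))"
        using c by (intro sum.cong refl) (simp only: atMost_iff s2 simp_thms)
      also have "\<dots> = 1 * of_bool True" using tl[OF c] by (intro single) simp
      finally show "(\<Sum>m\<le>N. 1 * of_bool (stops_at st2 u (take m (map snd c)))) = (1 :: real)" by simp
    qed
    also have "\<dots> = 1" by (rule code_average_const[OF PU(1) M])
    finally show ?thesis
      using suminf_event_prob[of "\<lambda>_. 1" N "\<lambda>u j a b. stops_at st2 u b"] nb by simp
  qed
  have 3: "(\<Sum>n. ennreal (real n * event_prob W1 W2 PU M f n
      (\<lambda>u j a b. stopped_by st1 u a \<and> stopped_by st2 u b \<and> (stops_at st1 u a \<or> stops_at st2 u b))))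
      \<le> ennreal nbar"
  proof -
    \<comment> \<open>Both receivers have stopped by \<open>m\<close> and one stops exactly at
      \<open>m\<close>: this singles out \<open>m\<close> as the maximum of the stopping
      times.\<close>
    have eq: "(?t1 u c \<le> m \<and> ?t2 u c \<le> m \<and> (m = ?t1 u c \<or> m = ?t2 u c))
        \<longleftrightarrow> (m = max (?t1 u c) (?t2 u c) \<and> True)" for u m c
      by (auto simp: max_def)
    have "code_average W1 W2 PU M f N (\<lambda>u j c. \<Sum>m\<le>N. real m * of_bool (
          stopped_by st1 u (take m (map fst c)) \<and> stopped_by st2 u (take m (map snd c)) \<and>
          (stops_at st1 u (take m (map fst c)) \<or> stops_at st2 u (take m (map snd c)))))
       = code_average W1 W2 PU M f N (\<lambda>u j c. real (max (?t1 u c) (?t2 u c)))"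
    proof (rule cong)
      fix u j :: nat and c :: "('y \<times> 'y) list" assume c: "length c = N"
      have "(\<Sum>m\<le>N. real m * of_bool (
          stopped_by st1 u (take m (map fst c)) \<and> stopped_by st2 u (take m (map snd c)) \<and>
          (stops_at st1 u (take m (map fst c)) \<or> stops_at st2 u (take m (map snd c)))))
        = (\<Sum>m\<le>N. real m * of_bool (m = max (?t1 u c) (?t2 u c) \<and> True))"
        using c by (intro sum.cong refl) (simp only: atMost_iff s1 s2 b1 b2 eq)
      also have "\<dots> = real (max (?t1 u c) (?t2 u c)) * of_bool True"
        using tl[OF c] by (intro single) simp
      finally show "(\<Sum>m\<le>N. real m * of_bool (
          stopped_by st1 u (take m (map fst c)) \<and> stopped_by st2 u (take m (map snd c)) \<and>
          (stops_at st1 u (take m (map fst c)) \<or> stops_at st2 u (take m (map snd c)))))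
        = real (max (?t1 u c) (?t2 u c))" by simp
    qed
    then show ?thesis
      using time nb by (subst suminf_event_prob[where N = N]) (auto intro!: ennreal_leI)
  qed
  have 4: "(\<Sum>n. ennreal (event_prob W1 W2 PU M f n (\<lambda>u j a b. stops_at st1 u a \<and> g1 u a \<noteq> j)))
      \<le> ennreal eps"
  proof -
    have "code_average W1 W2 PU M f N (\<lambda>u j c. \<Sum>m\<le>N. 1 * of_bool (
          stops_at st1 u (take m (map fst c)) \<and> g1 u (take m (map fst c)) \<noteq> j))
      = code_average W1 W2 PU M f N (\<lambda>u j c. of_bool (g1 u (take (?t1 u c) (map fst c)) \<noteq> j))"
    proof (rule cong)
      fix u j :: nat and c :: "('y \<times> 'y) list" assume c: "length c = N"
      have "(\<Sum>m\<le>N. 1 * of_bool (stops_at st1 u (take m (map fst c)) \<and> g1 u (take m (map fst c)) \<noteq> j))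
        = (\<Sum>m\<le>N. (1::real) * of_bool (m = ?t1 u c \<and> g1 u (take m (map fst c)) \<noteq> j))"
        using c by (intro sum.cong refl) (simp only: atMost_iff s1)
      also have "\<dots> = 1 * of_bool (g1 u (take (?t1 u c) (map fst c)) \<noteq> j)"
        using tl[OF c] by (intro single) simp
      finally show "(\<Sum>m\<le>N. 1 * of_bool (stops_at st1 u (take m (map fst c)) \<and> g1 u (take m (map fst c)) \<noteq> j))
        = (of_bool (g1 u (take (?t1 u c) (map fst c)) \<noteq> j) :: real)" by simp
    qed
    then show ?thesis
      using suminf_event_prob[of "\<lambda>_. 1" N "\<lambda>u j a b. stops_at st1 u a \<and> g1 u a \<noteq> j" PU M f] nb err1
      by (simp add: ennreal_leI)
  qed
  have 5: "(\<Sum>n. ennreal (event_prob W1 W2 PU M f n (\<lambda>u j a b. stops_at st2 u b \<and> g2 u b \<noteq> j)))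
      \<le> ennreal eps"
  proof -
    have "code_average W1 W2 PU M f N (\<lambda>u j c. \<Sum>m\<le>N. 1 * of_bool (
          stops_at st2 u (take m (map snd c)) \<and> g2 u (take m (map snd c)) \<noteq> j))
      = code_average W1 W2 PU M f N (\<lambda>u j c. of_bool (g2 u (take (?t2 u c) (map snd c)) \<noteq> j))"
    proof (rule cong)
      fix u j :: nat and c :: "('y \<times> 'y) list" assume c: "length c = N"
      have "(\<Sum>m\<le>N. 1 * of_bool (stops_at st2 u (take m (map snd c)) \<and> g2 u (take m (map snd c)) \<noteq> j))
        = (\<Sum>m\<le>N. (1::real) * of_bool (m = ?t2 u c \<and> g2 u (take m (map snd c)) \<noteq> j))"
        using c by (intro sum.cong refl) (simp only: atMost_iff s2)
      also have "\<dots> = 1 * of_bool (g2 u (take (?t2 u c) (map snd c)) \<noteq> j)"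
        using tl[OF c] by (intro single) simp
      finally show "(\<Sum>m\<le>N. 1 * of_bool (stops_at st2 u (take m (map snd c)) \<and> g2 u (take m (map snd c)) \<noteq> j))
        = (of_bool (g2 u (take (?t2 u c) (map snd c)) \<noteq> j) :: real)" by simp
    qed
    then show ?thesis
      using suminf_event_prob[of "\<lambda>_. 1" N "\<lambda>u j a b. stops_at st2 u b \<and> g2 u b \<noteq> j" PU M f] nb err2
      by (simp add: ennreal_leI)
  qed
  show ?thesis
    unfolding vlf_code_def using M PU g 1 2 3 4 5 by blast
qed

end

section \<open>From codebooks to codes\<close>

context scheme
begin

text \<open>Messages run from 1 and codewords are indexed from 0, hence \<open>j - 1\<close>. The
  existential over \<open>s\<close> makes up for the receiver's ignorance of the switching
  time.\<close>

definition decodes :: "(nat \<Rightarrow> 'w list) \<Rightarrow> bool \<Rightarrow> 'y list \<Rightarrow> nat \<Rightarrow> bool" where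
  "decodes cw k ys j \<longleftrightarrow> (\<exists>s\<le>T. crosses k (cw (j - 1)) s ys)"

text \<open>The value \<open>u = 0\<close> is the branch in which both receivers give up at time 0;
  the clause on \<open>N\<close> forces a bounded horizon.\<close>

definition stop_rule :: "(nat \<Rightarrow> 'w list) \<Rightarrow> nat \<Rightarrow> bool \<Rightarrow> nat \<Rightarrow> 'y list \<Rightarrow> bool" where
  "stop_rule cw M k u ys \<longleftrightarrow> u = 0 \<or> N \<le> length ys \<or> (\<exists>j\<in>{1..M}. decodes cw k ys j)"

definition decoder :: "(nat \<Rightarrow> 'w list) \<Rightarrow> nat \<Rightarrow> bool \<Rightarrow> nat \<Rightarrow> 'y list \<Rightarrow> nat" where
  "decoder cw M k u ys =
     (if \<exists>j\<in>{1..M}. decodes cw k ys j then SOME j. j \<in> {1..M} \<and> decodes cw k ys j else 1)"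

definition encoder :: "(nat \<Rightarrow> 'w list) \<Rightarrow> nat \<Rightarrow> nat \<Rightarrow> 'y list \<Rightarrow> 'y list \<Rightarrow> 'x" where
  "encoder cw u j a b = letter (cur_mode (zip (cw (j - 1)) (zip a b))) (cw (j - 1) ! length a)"

lemma pair_kernel_encoder:
  "pair_kernel (W True) (W False) (encoder cw) u j = chan (cw (j - 1))"
  by (intro ext) (simp add: pair_kernel_def chan_def encoder_def zip_map_fst_snd)

lemma decoder_SOME:
  assumes "\<exists>j\<in>{1..M}. decodes cw k ys j"
  shows "decoder cw M k u ys \<in> {1..M} \<and> decodes cw k ys (decoder cw M k u ys)"
proof -
  from assms have "\<exists>j. j \<in> {1..M} \<and> decodes cw k ys j" by blast
  from someI_ex[OF this] show ?thesis using assms by (simp add: decoder_def)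
qed

lemma decoder_range: "1 \<le> M \<Longrightarrow> decoder cw M k u ys \<in> {1..M}"
  using decoder_SOME[of M cw k ys u] by (cases "\<exists>j\<in>{1..M}. decodes cw k ys j") (auto simp: decoder_def)

lemma hit_decodes:
  assumes "hit (cw (j - 1)) c t"
  shows "decodes cw k (take t (map (receiver k) c)) j"
  using assms pick unfolding hit_def decodes_def by (auto simp: take_map)

lemma stop_time_le_hit_time:
  assumes "j \<in> {1..M}" "length c = N"
  shows "stop_time (stop_rule cw M k) u (map (receiver k) c) \<le> hit_time (cw (j - 1)) c"
proof (cases "fails (cw (j - 1)) c")
  case True
  then show ?thesis
    using assms by (intro stop_time_minimal) (simp add: hit_time_def stop_rule_def)
next
  case False
  then have "hit (cw (j - 1)) c (hit_time (cw (j - 1)) c)"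
    unfolding hit_time_def fails_def by (auto intro: LeastI_ex)
  then show ?thesis
    using assms(1) hit_decodes unfolding stop_rule_def by (intro stop_time_minimal) blast
qed

text \<open>A receiver stopped by some test and deciding wrongly has accepted a wrong codeword,
  whose confusability is witnessed at that time. Otherwise it ran to the horizon, and then the true
  codeword never had a hit.\<close>

lemma decoding_error:
  assumes j: "j \<in> {1..M}" and c: "length c = N" and u: "u \<noteq> 0"
    and err: "decoder cw M k u (take (stop_time (stop_rule cw M k) u (map (receiver k) c)) (map (receiver k) c)) \<noteq> j"
  shows "fails (cw (j - 1)) c \<or> (\<exists>j'<M. j' \<noteq> j - 1 \<and> confusable (cw j') c)"
proof -
  define t where "t = stop_time (stop_rule cw M k) u (map (receiver k) c)"
  define ys where "ys = take t (map (receiver k) c)"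
  have st: "\<And>ys. length ys = N \<Longrightarrow> stop_rule cw M k u ys" by (simp add: stop_rule_def)
  have tN: "t \<le> N" and stop: "stop_rule cw M k u ys"
    using stop_time_le[of N "stop_rule cw M k" u "map (receiver k) c"] st c by (auto simp: t_def ys_def)
  show ?thesis
  proof (cases "\<exists>j\<in>{1..M}. decodes cw k ys j")
    case True
    define j' where "j' = decoder cw M k u ys"
    have j': "j' \<in> {1..M}" "decodes cw k ys j'" "j' \<noteq> j"
      using decoder_SOME[OF True, of u] err by (auto simp: j'_def ys_def t_def)
    then obtain s where "s \<le> T" "crosses k (cw (j' - 1)) s (map (receiver k) (take t c))"
      by (auto simp: decodes_def ys_def take_map)
    then have "confusable (cw (j' - 1)) c" using tN unfolding confusable_def by blast
    moreover have "j' - 1 < M" "j' - 1 \<noteq> j - 1" using j j' by auto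
    ultimately show ?thesis by blast
  next
    case False
    then have "N \<le> length ys" using stop u by (auto simp: stop_rule_def)
    then have t: "t = N" using tN c by (simp add: ys_def)
    \<comment> \<open>A hit before \<open>N\<close> would have stopped the receiver earlier, and a
      hit at \<open>N\<close> would have made message \<open>j\<close> decodable.\<close>
    have "\<not> hit (cw (j - 1)) c t'" for t'
    proof
      assume hit: "hit (cw (j - 1)) c t'"
      then have "stop_rule cw M k u (take t' (map (receiver k) c))"
        using hit_decodes j unfolding stop_rule_def by blast
      then have "t \<le> t'" unfolding t_def by (rule stop_time_minimal)
      moreover have "t' \<le> N" using hit by (simp add: hit_def)
      ultimately have "t' = t" using t by simp
      then show False using False j hit hit_decodes[of cw j c t' k] by (auto simp: ys_def)
    qed
    then show ?thesis by (auto simp: fails_def)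
  qed
qed

text \<open>\<open>U\<close> is 0 with probability \<open>1 - q\<close>, which takes no time and is
  counted entirely as error. With probability \<open>q\<close> the codebook is used, at expected
  time at most \<open>Y\<close> and error probability at most \<open>Y / lam\<close>.\<close>

lemma achievable_from_codebook:
  assumes M: "1 \<le> M" and lam: "0 < lam" and q: "0 \<le> q" "q \<le> 1"
    and cw: "(\<Sum>j<M. \<Sum>c | length c = N. path_weight (chan (cw j)) c *
       (real (hit_time (cw j) c) + lam * of_bool (fails (cw j) c)
        + lam * of_bool (\<exists>j'<M. j' \<noteq> j \<and> confusable (cw j') c))) \<le> real M * Y"
    and time: "q * Y \<le> nbar" and err: "(1 - q) + q * (Y / lam) \<le> eps"
  shows "vlf_achievable (W True) (W False) nbar M eps"
proof -
  define PU where "PU = map_pmf (of_bool :: bool \<Rightarrow> nat) (bernoulli_pmf q)"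
  have inj: "inj (of_bool :: bool \<Rightarrow> nat)" by (auto simp: inj_def)
  have PU1: "pmf PU 1 = q" and PU0: "pmf PU 0 = 1 - q"
    using pmf_map_inj'[OF inj, of "bernoulli_pmf q" True] pmf_map_inj'[OF inj, of "bernoulli_pmf q" False] q
    by (simp_all add: PU_def)
  have sub: "set_pmf PU \<subseteq> {0, 1}" unfolding PU_def by auto
  then have fin: "finite (set_pmf PU)" "card (set_pmf PU) \<le> 3"
    using finite_subset[OF sub] card_mono[OF _ sub] by auto
  define bad where "bad j c = (of_bool (fails (cw j) c) + of_bool (\<exists>j'<M. j' \<noteq> j \<and> confusable (cw j') c) :: real)"
    for j c
  have pw: "0 \<le> path_weight (chan w) c" for w c by (intro path_weight_nonneg chan_nonneg)
  let ?avg = "code_average (W True) (W False) PU M (encoder cw) N"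
  let ?st = "stop_rule cw M" and ?g = "decoder cw M"
  have avg: "?avg (\<lambda>u j c. if u = 0 then r else \<phi> (j - 1) c)
      = (1 - q) * r + q * ((\<Sum>j<M. \<Sum>c | length c = N. path_weight (chan (cw j)) c * \<phi> j c) / real M)" for r \<phi>
  proof -
    have "?avg (\<lambda>u j c. if u = 0 then r else \<phi> (j - 1) c)
      = (\<Sum>u\<in>{0, 1}. \<Sum>j\<in>{1..M}. pmf PU u / real M *
         (\<Sum>c | length c = N. path_weight (chan (cw (j - 1))) c * (if u = 0 then r else \<phi> (j - 1) c)))"
      unfolding code_average_def pair_kernel_encoder
      using sub by (intro sum.mono_neutral_left) (auto simp: set_pmf_iff)
    also have "\<dots> = (1 - q) * r + (\<Sum>j\<in>{1..M}. q / real M *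
         (\<Sum>c | length c = N. path_weight (chan (cw (j - 1))) c * \<phi> (j - 1) c))"
      using M by (simp add: PU0 PU1[simplified] sum_distrib_right[symmetric] sum_path_weight[OF chan_sum])
    also have "(\<Sum>j\<in>{1..M}. q / real M *
         (\<Sum>c | length c = N. path_weight (chan (cw (j - 1))) c * \<phi> (j - 1) c))
      = (\<Sum>j<M. q / real M * (\<Sum>c | length c = N. path_weight (chan (cw j)) c * \<phi> j c))"
      by (simp add: sum.atLeast1_atMost_eq)
    also have "\<dots> = q * ((\<Sum>j<M. \<Sum>c | length c = N. path_weight (chan (cw j)) c * \<phi> j c) / real M)"
      by (simp only: sum_distrib_left[symmetric] sum_divide_distrib[symmetric] times_divide_eq_left times_divide_eq_right)
    finally show ?thesis .
  qed
  define H where "H = (\<Sum>j<M. \<Sum>c | length c = N. path_weight (chan (cw j)) c * real (hit_time (cw j) c))"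
  define Z where "Z = (\<Sum>j<M. \<Sum>c | length c = N. path_weight (chan (cw j)) c * bad j c)"
  have H0: "0 \<le> H" and Z0: "0 \<le> Z"
    unfolding H_def Z_def bad_def by (auto intro!: sum_nonneg mult_nonneg_nonneg pw add_nonneg_nonneg)
  have "H + lam * Z = (\<Sum>j<M. \<Sum>c | length c = N. path_weight (chan (cw j)) c *
       (real (hit_time (cw j) c) + lam * of_bool (fails (cw j) c)
        + lam * of_bool (\<exists>j'<M. j' \<noteq> j \<and> confusable (cw j') c)))"
    unfolding H_def Z_def sum_distrib_left sum.distrib[symmetric] bad_def
    by (intro sum.cong refl) (simp only: algebra_simps)
  then have HZ: "H + lam * Z \<le> real M * Y" using cw by simp
  have "0 \<le> lam * Z" using lam Z0 by simp
  \<comment> \<open>Time and weighted error are both nonnegative, so each is bounded by their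
    sum.\<close>
  then have "H \<le> real M * Y" "lam * Z \<le> real M * Y" using HZ H0 by linarith+
  then have H: "H / real M \<le> Y" and Z: "Z / real M \<le> Y / lam"
    using lam M by (simp_all add: field_simps)
  have st0: "stop_time (?st k) 0 ys = 0" for k ys
    using stop_time_minimal[of "?st k" 0 0 ys] by (simp add: stop_rule_def)
  have stN: "?st k u ys" if "length ys = N" for k u ys using that by (simp add: stop_rule_def)
  have rec: "map fst c = map (receiver True) c" "map snd c = map (receiver False) c" for c :: "('y \<times> 'y) list"
    by (simp_all add: receiver_def)
  have t: "?avg (\<lambda>u j c. real (max (stop_time (?st True) u (map fst c)) (stop_time (?st False) u (map snd c)))) \<le> nbar"
  proof -
    have "?avg (\<lambda>u j c. real (max (stop_time (?st True) u (map fst c)) (stop_time (?st False) u (map snd c))))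
       \<le> ?avg (\<lambda>u j c. if u = 0 then 0 else real (hit_time (cw (j - 1)) c))"
      unfolding rec
    proof (intro code_average_mono W)
      fix u j :: nat and c :: "('y \<times> 'y) list"
      assume "j \<in> {1..M}" "length c = N"
      then have "stop_time (?st k) u (map (receiver k) c) \<le> hit_time (cw (j - 1)) c" for k
        by (rule stop_time_le_hit_time)
      then show "real (max (stop_time (?st True) u (map (receiver True) c))
            (stop_time (?st False) u (map (receiver False) c)))
          \<le> (if u = 0 then 0 else real (hit_time (cw (j - 1)) c))"
        by (cases "u = 0") (simp_all add: st0)
    qed
    also have "\<dots> = (1 - q) * 0 + q * (H / real M)" unfolding H_def by (rule avg)
    also have "\<dots> \<le> q * Y" using mult_left_mono[OF H q(1)] by simp
    finally show ?thesis using time by linarith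
  qed
  have e: "?avg (\<lambda>u j c. of_bool (?g k u (take (stop_time (?st k) u (map (receiver k) c)) (map (receiver k) c)) \<noteq> j)) \<le> eps"
    for k
  proof -
    have "?avg (\<lambda>u j c. of_bool (?g k u (take (stop_time (?st k) u (map (receiver k) c)) (map (receiver k) c)) \<noteq> j))
       \<le> ?avg (\<lambda>u j c. if u = 0 then 1 else bad (j - 1) c)"
    proof (intro code_average_mono W)
      fix u j :: nat and c :: "('y \<times> 'y) list"
      assume j: "j \<in> {1..M}" and c: "length c = N"
      show "of_bool (?g k u (take (stop_time (?st k) u (map (receiver k) c)) (map (receiver k) c)) \<noteq> j)
        \<le> (if u = 0 then 1 else bad (j - 1) c)"
        using decoding_error[OF j c, of u cw k] unfolding bad_def by auto
    qed
    also have "\<dots> = (1 - q) * 1 + q * (Z / real M)" unfolding Z_def by (rule avg)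
    also have "\<dots> \<le> (1 - q) + q * (Y / lam)" using mult_left_mono[OF Z q(1)] by simp
    finally show ?thesis using err by linarith
  qed
  have "vlf_code (W True) (W False) nbar M eps PU (encoder cw) (?st True) (?st False) (?g True) (?g False)"
    using t e[of True] e[of False] M fin unfolding rec[symmetric]
    by (intro vlf_code_bounded_horizon[where N = N] W decoder_range stN) auto
  then show ?thesis unfolding vlf_achievable_def by blast
qed

end

text \<open>\<open>A'\<close> and \<open>err'\<close> restate the locale constants, so that the
  bounds can be supplied in terms of quantities chosen before the locale is interpreted.\<close>

lemma (in balanced_scheme) achievable:
  fixes A' err' :: real
  assumes A': "A' = 4 * B * sqrt (l * x)"
    and err': "err' = 2 * d + c0 * real T * d\<^sup>2 + 4 * B * sqrt (l * real (3 * T))"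
    and A: "2 * A' \<le> real T * d" and T: "(A' + err') / C + 1 \<le> real T"
    and lam: "0 < lam" and M: "1 \<le> M" and q: "0 \<le> q" "q \<le> 1"
    and Y: "real (n + 2 * T) + err' / C + 1
        + (real (n + 3 * T) + lam + 2 * B * real n / C) * (real (4 * T + 6) * exp (- l))
        + real M * lam * (2 * real (T + 1) * real (n + 3 * T + 1) * exp (- \<gamma>)) \<le> Y"
    and time: "q * Y \<le> nbar" and err: "(1 - q) + q * (Y / lam) \<le> eps"
  shows "vlf_achievable (W True) (W False) nbar M eps"
proof -
  let ?X = "(\<gamma> + err) / C + 1 + (real N + lam + 2 * B * real n / C) * (real (4 * T + 6) * exp (- l))"
  let ?e = "2 * real (T + 1) * real (N + 1) * exp (- \<gamma>)"
  have A_err: "A' = A" "err' = local.err" by (simp_all add: A' err' A_def err_def)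
  obtain cw where cw: "(\<Sum>j<M. \<Sum>c | length c = N. path_weight (chan (cw j)) c *
       (real (hit_time (cw j) c) + lam * of_bool (fails (cw j) c)
        + lam * of_bool (\<exists>j'<M. j' \<noteq> j \<and> confusable (cw j') c)))
      \<le> real M * (?X + real (M - 1) * lam * ?e)"
    using exists_codebook[OF expected_cost[OF A[unfolded A_err] T[unfolded A_err] less_imp_le[OF lam]]
        less_imp_le[OF lam] M] by blast
  have "real (M - 1) * lam * ?e \<le> real M * lam * ?e"
    using lam by (intro mult_right_mono) auto
  moreover have "(\<gamma> + local.err) / C = real (n + 2 * T) + local.err / C"
    using C by (simp add: gamma_eq field_simps)
  ultimately have "?X + real (M - 1) * lam * ?e \<le> Y"
    using Y unfolding A_err N_def[symmetric] by linarith
  then have "real M * (?X + real (M - 1) * lam * ?e) \<le> real M * Y"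
    by (intro mult_left_mono) auto
  with cw have "(\<Sum>j<M. \<Sum>c | length c = N. path_weight (chan (cw j)) c *
       (real (hit_time (cw j) c) + lam * of_bool (fails (cw j) c)
        + lam * of_bool (\<exists>j'<M. j' \<noteq> j \<and> confusable (cw j') c))) \<le> real M * Y"
    by (rule order_trans)
  then show ?thesis using achievable_from_codebook M lam q time err by blast
qed

text \<open>One message and stopping at time 0; this settles the case of nonpositive common
  capacity.\<close>

lemma trivial_code:
  fixes W1 W2 :: "'x::finite \<Rightarrow> 'y::finite \<Rightarrow> real"
  assumes W: "stochastic W1" "stochastic W2" and "0 \<le> nbar" "0 \<le> eps"
  shows "vlf_achievable W1 W2 nbar 1 eps"
proof -
  let ?PU = "return_pmf 0 :: nat pmf" and ?f = "\<lambda>_ _ _ _. undefined :: 'x"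
  let ?st = "\<lambda>(_::nat) (_::'y list). True" and ?g = "\<lambda>(_::nat) (_::'y list). 1 :: nat"
  have 0: "code_average W1 W2 ?PU 1 ?f 0 (\<lambda>_ _ _. 0) = 0"
    by (rule code_average_const[OF W]) auto
  have e: "code_average W1 W2 ?PU 1 ?f 0 (\<lambda>u j c. of_bool (1 \<noteq> j)) \<le> code_average W1 W2 ?PU 1 ?f 0 (\<lambda>_ _ _. 0)"
    by (rule code_average_mono[OF W]) auto
  have "vlf_code W1 W2 nbar 1 eps ?PU ?f ?st ?st ?g ?g"
    using 0 e assms(3,4)
    by (intro vlf_code_bounded_horizon[OF W, where N = 0]) (auto simp: stop_time_def)
  then show ?thesis unfolding vlf_achievable_def by blast
qed

section \<open>Three input laws carried by one codeword letter\<close>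

definition perturbed :: "('x \<Rightarrow> real) \<Rightarrow> ('x \<Rightarrow> real) \<Rightarrow> real \<Rightarrow> nat \<Rightarrow> 'x \<Rightarrow> real" where
  "perturbed P0 v d m z = P0 z + (if m = 0 then 0 else if m = 1 then d else - d) * v z"

definition triple_letter :: "nat \<Rightarrow> 'x \<times> 'x \<times> 'x \<Rightarrow> 'x" where
  "triple_letter m w = (if m = 0 then fst w else if m = 1 then fst (snd w) else snd (snd w))"

text \<open>The three symbols are drawn independently. Only one of them is ever sent at a given
  position, so just the marginals matter.\<close>

definition triple_weight :: "(nat \<Rightarrow> 'x \<Rightarrow> real) \<Rightarrow> 'x \<times> 'x \<times> 'x \<Rightarrow> real" where
  "triple_weight P w = P 0 (fst w) * (P 1 (fst (snd w)) * P 2 (snd (snd w)))"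

lemma sum_triple:
  fixes F :: "'x::finite \<times> 'x \<times> 'x \<Rightarrow> real"
  shows "(\<Sum>w\<in>UNIV. F w) = (\<Sum>a\<in>UNIV. \<Sum>b\<in>UNIV. \<Sum>c\<in>UNIV. F (a, b, c))"
  unfolding UNIV_Times_UNIV[symmetric] sum.cartesian_product by (simp add: case_prod_unfold)

lemma triple_weight_marginal:
  fixes P :: "nat \<Rightarrow> 'x::finite \<Rightarrow> real"
  assumes P: "\<And>m. is_dist (P m)" and P2: "\<And>m. 2 \<le> m \<Longrightarrow> P m = P 2"
  shows "(\<Sum>w\<in>UNIV. triple_weight P w * f (triple_letter m w)) = (\<Sum>z\<in>UNIV. P m z * f z)"
proof -
  have s: "(\<Sum>z\<in>UNIV. P m z) = 1" for m using P[of m] by (simp add: is_dist_def)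
  consider "m = 0" | "m = 1" | "2 \<le> m" by linarith
  then show ?thesis
  proof cases
    case 1
    have "(\<Sum>w\<in>UNIV. triple_weight P w * f (triple_letter m w))
        = (\<Sum>a\<in>UNIV. \<Sum>b\<in>UNIV. \<Sum>c\<in>UNIV. (P 0 a * f a) * (P 1 b * P 2 c))"
      unfolding sum_triple by (simp add: 1 triple_weight_def triple_letter_def mult_ac)
    then show ?thesis by (simp add: 1 sum_distrib_left[symmetric] s)
  next
    case 2
    have "(\<Sum>w\<in>UNIV. triple_weight P w * f (triple_letter m w))
        = (\<Sum>a\<in>UNIV. \<Sum>b\<in>UNIV. \<Sum>c\<in>UNIV. P 0 a * ((P 1 b * f b) * P 2 c))"
      unfolding sum_triple by (simp add: 2 triple_weight_def triple_letter_def mult_ac)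
    then show ?thesis
      by (simp add: 2 sum_distrib_left[symmetric] sum_distrib_right[symmetric] s[simplified])
  next
    case 3
    have "(\<Sum>w\<in>UNIV. triple_weight P w * f (triple_letter m w))
        = (\<Sum>a\<in>UNIV. \<Sum>b\<in>UNIV. \<Sum>c\<in>UNIV. P 0 a * (P 1 b * (P 2 c * f c)))"
      unfolding sum_triple using 3 by (simp add: triple_weight_def triple_letter_def mult_ac)
    then show ?thesis
      by (simp add: P2[OF 3] sum_distrib_left[symmetric] sum_distrib_right[symmetric] s[simplified])
  qed
qed

lemma is_dist_triple_weight:
  fixes P :: "nat \<Rightarrow> 'x::finite \<Rightarrow> real"
  assumes P: "\<And>m. is_dist (P m)" and P2: "\<And>m. 2 \<le> m \<Longrightarrow> P m = P 2"
  shows "is_dist (triple_weight P)"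
  using triple_weight_marginal[of P "\<lambda>_. 1" 0, OF P P2] P
  by (auto simp: is_dist_def triple_weight_def)

text \<open>The bound on \<open>d\<close> keeps the perturbed inputs above \<open>P0 / 2\<close>, so
  one \<open>B\<close> serves all modes, and \<open>mutual_info_perturb\<close> at \<open>d\<close>
  and \<open>- d\<close> supplies the two drift conditions.\<close>

lemma achievable_at:
  fixes W1 W2 :: "'x::finite \<Rightarrow> 'y::finite \<Rightarrow> real" and P0 v :: "'x \<Rightarrow> real"
  assumes W: "stochastic W1" "stochastic W2" and P0: "is_dist P0" "\<And>z. 0 < P0 z"
    and C: "mutual_info W1 P0 = C" "mutual_info W2 P0 = C" "0 < C"
    and v: "(\<Sum>z\<in>UNIV. v z) = 0" "(\<Sum>z\<in>UNIV. v z * rel_info W1 P0 z) = 1"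
      "(\<Sum>z\<in>UNIV. v z * rel_info W2 P0 z) = - \<rho>" "0 < \<rho>"
    and B: "0 < B"
      "\<And>P z y. is_dist P \<Longrightarrow> (\<And>z. P0 z / 2 \<le> P z) \<Longrightarrow> \<bar>info_dens W1 P z y\<bar> \<le> B"
      "\<And>P z y. is_dist P \<Longrightarrow> (\<And>z. P0 z / 2 \<le> P z) \<Longrightarrow> \<bar>info_dens W2 P z y\<bar> \<le> B"
    and c0: "(\<Sum>y\<in>UNIV. (out_dist W1 v y)\<^sup>2 / out_dist W1 P0 y) \<le> c0"
      "(\<Sum>y\<in>UNIV. (out_dist W2 v y)\<^sup>2 / out_dist W2 P0 y) \<le> c0" "0 \<le> c0"
    and d: "0 < d" "\<And>z. d * \<bar>v z\<bar> \<le> P0 z / 2"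
    and l: "0 < l" "l \<le> real (3 * T)" "l \<le> x" and n: "real n \<le> x"
    and A': "A' = 4 * B * sqrt (l * x)"
    and err': "err' = 2 * d + c0 * real T * d\<^sup>2 + 4 * B * sqrt (l * real (3 * T))"
    and A: "2 * A' \<le> real T * d" and T: "(A' + err') / C + 1 \<le> real T"
    and lam: "0 < lam" and M: "1 \<le> M" and q: "0 \<le> q" "q \<le> 1"
    and Y: "real (n + 2 * T) + err' / C + 1
        + (real (n + 3 * T) + lam + 2 * B * real n / C) * (real (4 * T + 6) * exp (- l))
        + real M * lam * (2 * real (T + 1) * real (n + 3 * T + 1) * exp (- (C * real (n + 2 * T)))) \<le> Y"
    and time: "q * Y \<le> nbar" and err: "(1 - q) + q * (Y / lam) \<le> eps"
  shows "vlf_achievable W1 W2 nbar M eps"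
proof -
  define W where "W k = (if k then W1 else W2)" for k
  define P where "P = perturbed P0 v d"
  have half: "P0 z / 2 \<le> P m z" for m z
  proof -
    have "\<bar>d * v z\<bar> \<le> P0 z / 2" using d(2)[of z] d(1) by (simp add: abs_mult)
    then show ?thesis using P0(2)[of z] by (auto simp: P_def perturbed_def abs_le_iff)
  qed
  have Ppos: "0 < P m z" for m z using half[of z m] P0(2)[of z] by linarith
  have dist: "is_dist (P m)" for m
  proof -
    have "(\<Sum>z\<in>UNIV. P m z) = (\<Sum>z\<in>UNIV. P0 z) + (if m = 0 then 0 else if m = 1 then d else - d) * (\<Sum>z\<in>UNIV. v z)"
      unfolding P_def perturbed_def by (simp only: sum.distrib sum_distrib_left)
    then show ?thesis using P0(1) v(1) Ppos by (auto simp: is_dist_def intro: less_imp_le)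
  qed
  have P2: "P m = P 2" if "2 \<le> m" for m using that by (auto simp: P_def perturbed_def)
  have P_0: "P 0 = P0" by (auto simp: P_def perturbed_def)
  have P_1: "P 1 = (\<lambda>z. P0 z + d * v z)" and P_2: "P 2 = (\<lambda>z. P0 z + (- d) * v z)"
    by (auto simp: P_def perturbed_def)
  have c0d: "d\<^sup>2 * (\<Sum>y\<in>UNIV. (out_dist W1 v y)\<^sup>2 / out_dist W1 P0 y) \<le> c0 * d\<^sup>2"
    "d\<^sup>2 * (\<Sum>y\<in>UNIV. (out_dist W2 v y)\<^sup>2 / out_dist W2 P0 y) \<le> c0 * d\<^sup>2"
    using mult_left_mono[OF c0(1), of "d\<^sup>2"] mult_left_mono[OF c0(2), of "d\<^sup>2"] by (simp_all add: mult.commute)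
  interpret balanced_scheme W P "triple_weight P" triple_letter n T "C * real (n + 2 * T)"
    "\<lambda>h. balancing_split \<rho> d T (\<lambda>k. phase_one_deviation W (P 0) (triple_letter 0) n C k h)"
    C d \<rho> B c0 l x
  proof unfold_locales
    show "stochastic (W k)" for k using \<open>stochastic W1\<close> \<open>stochastic W2\<close> by (simp add: W_def)
    show "is_dist (P m)" for m by (rule dist)
    show "0 < P m z" for m z by (rule Ppos)
    show "is_dist (triple_weight P)" using dist P2 by (rule is_dist_triple_weight)
    show "(\<Sum>w\<in>UNIV. triple_weight P w * f (triple_letter m w)) = (\<Sum>z\<in>UNIV. P m z * f z)" for f m
      using dist P2 by (rule triple_weight_marginal)
    show "balancing_split \<rho> d T D \<le> T" for D by (simp add: balancing_split_def)
    show "mutual_info (W k) (P 0) = C" for k using C by (simp add: W_def P_0)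
    show "C + d * (if k then 1 else - \<rho>) - c0 * d\<^sup>2 \<le> mutual_info (W k) (P 1)" for k
      using mutual_info_perturb[OF \<open>stochastic W1\<close> P0, of d v] mutual_info_perturb[OF \<open>stochastic W2\<close> P0, of d v]
        dist[of 1] c0d v(2,3) C
      unfolding P_1 W_def by (cases k) auto
    show "C - d * (if k then 1 else - \<rho>) - c0 * d\<^sup>2 \<le> mutual_info (W k) (P 2)" for k
      using mutual_info_perturb[OF \<open>stochastic W1\<close> P0, of "- d" v] mutual_info_perturb[OF \<open>stochastic W2\<close> P0, of "- d" v]
        dist[of 2] c0d v(2,3) C
      unfolding P_2 W_def by (cases k) auto
    show "\<bar>info_dens (W k) (P m) a b\<bar> \<le> B" for k m a b
      using B(2,3)[OF dist half] by (simp add: W_def)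
  qed (use C d v B c0 l n in auto)
  have "vlf_achievable (W True) (W False) nbar M eps"
    by (rule achievable[OF A' err' A T lam M q Y time err])
  then show ?thesis by (simp add: W_def)
qed

section \<open>Asymptotics\<close>

lemma achievable_asymptotic:
  fixes W1 W2 :: "'x::finite \<Rightarrow> 'y::finite \<Rightarrow> real" and P0 v :: "'x \<Rightarrow> real"
  assumes W: "stochastic W1" "stochastic W2" and P0: "is_dist P0" "\<And>z. 0 < P0 z"
    and C: "mutual_info W1 P0 = C" "mutual_info W2 P0 = C" "0 < C"
    and v: "(\<Sum>z\<in>UNIV. v z) = 0" "(\<Sum>z\<in>UNIV. v z * rel_info W1 P0 z) = 1"
      "(\<Sum>z\<in>UNIV. v z * rel_info W2 P0 z) = - \<rho>" "0 < \<rho>"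
    and eps: "0 < eps" "eps < 1"
  shows "\<exists>K>0. \<forall>\<^sub>F x in at_top. \<exists>M. vlf_achievable W1 W2 ((1 - eps) * x) M eps \<and>
    C * x - K * (x powr (1/3) * ln x) \<le> ln (real M)"
proof -
  obtain B1 where B1: "0 < B1"
    "\<And>P z y. is_dist P \<Longrightarrow> (\<And>z. P0 z / 2 \<le> P z) \<Longrightarrow> \<bar>info_dens W1 P z y\<bar> \<le> B1"
    using info_dens_bounded[OF W(1) P0] by metis
  obtain B2 where B2: "0 < B2"
    "\<And>P z y. is_dist P \<Longrightarrow> (\<And>z. P0 z / 2 \<le> P z) \<Longrightarrow> \<bar>info_dens W2 P z y\<bar> \<le> B2"
    using info_dens_bounded[OF W(2) P0] by metis
  define B where "B = max B1 B2"
  have B: "0 < B"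
    "\<And>P z y. is_dist P \<Longrightarrow> (\<And>z. P0 z / 2 \<le> P z) \<Longrightarrow> \<bar>info_dens W1 P z y\<bar> \<le> B"
    "\<And>P z y. is_dist P \<Longrightarrow> (\<And>z. P0 z / 2 \<le> P z) \<Longrightarrow> \<bar>info_dens W2 P z y\<bar> \<le> B"
    using B1 B2 by (auto simp: B_def intro: max.coboundedI1 max.coboundedI2)
  define chi2 where "chi2 U = (\<Sum>y\<in>UNIV. (out_dist U v y)\<^sup>2 / out_dist U P0 y)" for U :: "'x \<Rightarrow> 'y \<Rightarrow> real"
  have chi2: "0 \<le> chi2 W1" "0 \<le> chi2 W2"
    unfolding chi2_def using out_dist_nonneg[OF W(1) P0(1)] out_dist_nonneg[OF W(2) P0(1)]
    by (auto intro!: sum_nonneg divide_nonneg_nonneg)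
  define c0 where "c0 = chi2 W1 + chi2 W2"
  have c0: "chi2 W1 \<le> c0" "chi2 W2 \<le> c0" "0 \<le> c0" using chi2 by (auto simp: c0_def)
  \<comment> \<open>Any \<open>d\<close> up to \<open>\<eta>\<close> keeps the perturbed inputs
    above \<open>P0 / 2\<close>; the summand 1 guards against \<open>v z = 0\<close>.\<close>
  define \<eta> where "\<eta> = Min (range (\<lambda>z. P0 z / (2 * (\<bar>v z\<bar> + 1))))"
  have \<eta>0: "0 < \<eta>"
    unfolding \<eta>_def using P0(2) by (subst Min_gr_iff) (auto intro!: divide_pos_pos add_nonneg_pos)
  have \<eta>: "\<eta> * \<bar>v z\<bar> \<le> P0 z / 2" for z
  proof -
    have "\<eta> \<le> P0 z / (2 * (\<bar>v z\<bar> + 1))" unfolding \<eta>_def by (intro Min_le) auto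
    then have "\<eta> * \<bar>v z\<bar> \<le> P0 z / (2 * (\<bar>v z\<bar> + 1)) * (\<bar>v z\<bar> + 1)"
      using \<eta>0 P0(2)[of z] by (intro mult_mono) auto
    also have "\<dots> = P0 z / 2" by (simp add: field_simps add_nonneg_eq_0_iff)
    finally show ?thesis .
  qed
  \<comment> \<open>The 3 pays for three unit terms in \<open>Y\<close>: rounding up the crossing
    time, bad paths, and confusion. The rest makes \<open>(1 - eps) * Y\<close> fall short of
    \<open>(1 - eps) * x\<close> by 1, which absorbs the excess of \<open>q\<close>.\<close>
  define \<kappa> where "\<kappa> = 3 + 1 / (1 - eps)"
  \<comment> \<open>\<open>40 * B\<close> collects \<open>16 * B\<close> from rounding and
    \<open>24 * B\<close> from late fluctuations; \<open>384 = 64 * 6\<close> comes from the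
    quadratic cost.\<close>
  define K1 where "K1 = 40 * B + 384 * c0 * B\<^sup>2"
  have K1: "0 < K1" using B c0 by (auto simp: K1_def intro!: add_pos_nonneg)
  define p where "p x = x powr (2/3)" for x :: real
  define L where "L x = x powr (1/3) * ln x" for x :: real
  define S where "S x = sqrt (6 * ln x * x)" for x :: real
  have ev: "\<forall>\<^sub>F x in at_top. 1 \<le> p x"
    "\<forall>\<^sub>F x in at_top. 6 * ln x \<le> p x"
    "\<forall>\<^sub>F x in at_top. 6 * ln x \<le> (x::real)"
    "\<forall>\<^sub>F x in at_top. 2 * p x \<le> x"
    "\<forall>\<^sub>F x in at_top. S x / p x \<le> L x"
    "\<forall>\<^sub>F x in at_top. sqrt (6 * ln x * (6 * p x)) \<le> 6 * L x"
    "\<forall>\<^sub>F x in at_top. x\<^sup>2 / x ^ 5 * (2 * (2 * p x + 1) * (2 * x + 1)) \<le> 1"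
    unfolding p_def L_def S_def by real_asymp+
  have ev': "\<forall>\<^sub>F x in at_top. (4 * B * S x + K1 * L x) / C + 1 \<le> p x"
    "\<forall>\<^sub>F x in at_top. 8 * B * S x / p x \<le> \<eta>"
    "\<forall>\<^sub>F x in at_top. 4 * p x + K1 * L x / C + \<kappa> \<le> x"
    "\<forall>\<^sub>F x in at_top. (2 * x + x\<^sup>2 + 2 * B * x / C) * ((8 * p x + 6) * exp (- (6 * ln x))) \<le> 1"
    "\<forall>\<^sub>F x in at_top. 5 * ln x + ln 2 \<le> C * x - K1 * L x - C * (\<kappa> + 1)"
    "\<forall>\<^sub>F x in at_top. C * (\<kappa> + 1) + 5 * ln x + ln 2 \<le> L x"
    unfolding p_def L_def S_def using B(1) C(3) K1 \<eta>0 by real_asymp+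
  have "\<forall>\<^sub>F x in at_top. \<exists>M. vlf_achievable W1 W2 ((1 - eps) * x) M eps \<and>
    C * x - (K1 + 1) * L x \<le> ln (real M)"
    using eventually_gt_at_top[of "1::real"] ev eventually_ge_at_top[of "1 / eps"] ev'
  proof eventually_elim
    case (elim x)
    note x1 = elim(1) and p1 = elim(2)
    define T where "T = nat \<lceil>p x\<rceil>"
    have T: "p x \<le> real T" "real T \<le> 2 * p x" using p1 unfolding T_def by linarith+
    have T0: "0 < real T" using T p1 by linarith
    \<comment> \<open>Tail probabilities become \<open>x\<close> to the power -6, which beats the
      penalty \<open>x^2\<close> times the number of tail events.\<close>
    define l where "l = 6 * ln x"
    have l: "0 < l" "l \<le> real (3 * T)" "l \<le> x" using x1 elim(3,4) T T0 by (auto simp: l_def)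
    define A' where "A' = 4 * B * sqrt (l * x)"
    have A': "A' = 4 * B * S x" by (simp add: A'_def l_def S_def)
    have S0: "0 < S x" using x1 by (simp add: S_def)
    \<comment> \<open>The smallest \<open>d\<close> for which the balancing phase can cancel a gap
      of \<open>2 * A'\<close>.\<close>
    define d where "d = 2 * A' / real T"
    have d0: "0 < d" using S0 B T0 by (simp add: d_def A')
    have d_le: "d \<le> 8 * B * S x / p x"
    proof -
      have "d = 8 * B * S x / real T" by (simp add: d_def A')
      also have "\<dots> \<le> 8 * B * S x / p x" using T p1 S0 B by (intro divide_left_mono) auto
      finally show ?thesis .
    qed
    have dv: "d * \<bar>v z\<bar> \<le> P0 z / 2" for z
      using mult_right_mono[of d \<eta> "\<bar>v z\<bar>"] d_le elim(11) \<eta>[of z] by linarith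
    define err' where "err' = 2 * d + c0 * real T * d\<^sup>2 + 4 * B * sqrt (l * real (3 * T))"
    have "2 * d \<le> 16 * B * L x"
    proof -
      have "8 * B * (S x / p x) \<le> 8 * B * L x" using elim(6) B by (intro mult_left_mono) auto
      then show ?thesis using d_le by simp
    qed
    moreover have "c0 * real T * d\<^sup>2 \<le> 384 * c0 * B\<^sup>2 * L x"
    proof -
      have "real T * d\<^sup>2 = 64 * B\<^sup>2 * ((S x)\<^sup>2 / real T)"
        using T0 by (simp add: d_def A' power2_eq_square field_simps)
      also have "\<dots> \<le> 64 * B\<^sup>2 * ((S x)\<^sup>2 / p x)"
        using T p1 by (intro mult_left_mono divide_left_mono) auto
      also have "(S x)\<^sup>2 = 6 * ln x * x" using x1 by (simp add: S_def)
      also have "6 * ln x * x / p x = 6 * L x"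
      proof -
        have "x powr (1 - 2/3) = x powr 1 / x powr (2/3)" by (rule powr_diff)
        then have "x / p x = x powr (1/3)" using x1 by (simp add: p_def)
        then have "6 * ln x * (x / p x) = 6 * L x" by (simp add: L_def)
        then show ?thesis by simp
      qed
      finally have "c0 * (real T * d\<^sup>2) \<le> c0 * (64 * B\<^sup>2 * (6 * L x))"
        using c0 by (intro mult_left_mono)
      then show ?thesis by (simp add: mult_ac)
    qed
    moreover have "4 * B * sqrt (l * real (3 * T)) \<le> 24 * B * L x"
    proof -
      have "sqrt (l * real (3 * T)) \<le> sqrt (6 * ln x * (6 * p x))"
        unfolding l_def using T x1 by (intro real_sqrt_le_mono mult_left_mono) auto
      then have "sqrt (l * real (3 * T)) \<le> 6 * L x" using elim(7) by linarith
      then have "4 * B * sqrt (l * real (3 * T)) \<le> 4 * B * (6 * L x)" using B by (intro mult_left_mono) auto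
      then show ?thesis by simp
    qed
    ultimately have err'_le: "err' \<le> K1 * L x" unfolding err'_def K1_def by (simp add: algebra_simps)
    have err'0: "0 \<le> err'" unfolding err'_def using d0 c0 B l by auto
    \<comment> \<open>From the budget \<open>x\<close>, this reserves the nominal
      \<open>2 * T\<close> uses after phase one, the delay due to \<open>err'\<close>, and
      \<open>\<kappa>\<close>.\<close>
    define z where "z = x - 2 * real T - err' / C - \<kappa>"
    have errC: "err' / C \<le> K1 * L x / C" using err'_le C by (intro divide_right_mono) auto
    then have z0: "0 \<le> z" using elim(12) T unfolding z_def by linarith
    define n where "n = nat \<lfloor>z\<rfloor>"
    have n: "real n \<le> z" "z - 1 \<le> real n" using z0 unfolding n_def by linarith+
    have eC: "0 \<le> err' / C" using err'0 C by simp
    have \<kappa>0: "4 \<le> \<kappa>" using eps by (simp add: \<kappa>_def field_simps)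
    have n2T: "real n + 2 * real T \<le> x - err' / C - \<kappa>" using n by (simp add: z_def)
    have nx: "real n \<le> x" using n2T eC \<kappa>0 T0 by linarith
    have Nx: "real n + 3 * real T \<le> 2 * x" using n2T eC \<kappa>0 T elim(5) by linarith
    define \<gamma> where "\<gamma> = C * real (n + 2 * T)"
    have "x - err' / C - \<kappa> - 1 \<le> real (n + 2 * T)" using n by (simp add: z_def)
    then have "C * (x - err' / C - \<kappa> - 1) \<le> \<gamma>" unfolding \<gamma>_def using C by (intro mult_left_mono) auto
    moreover have "C * (x - err' / C - \<kappa> - 1) = C * x - err' - C * (\<kappa> + 1)"
      using C by (simp add: field_simps)
    ultimately have \<gamma>: "C * x - K1 * L x - C * (\<kappa> + 1) \<le> \<gamma>" using err'_le by linarith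
    \<comment> \<open>Confusion costs about \<open>M * exp (- \<gamma>)\<close> times
      \<open>x^2 * T * x\<close>. Dividing by \<open>x^5\<close> makes this at most 1 and costs only
      \<open>5 * ln x\<close> in the logarithm of \<open>M\<close>.\<close>
    define y where "y = exp \<gamma> / x ^ 5"
    have y0: "0 < y" using x1 by (simp add: y_def)
    have lny: "ln y = \<gamma> - 5 * ln x" using x1 by (simp add: y_def ln_div ln_realpow)
    have "ln 2 \<le> ln y" using lny \<gamma> elim(14) by linarith
    then have y2: "2 \<le> y" using y0 by simp
    define M where "M = nat \<lfloor>y\<rfloor>"
    have M: "real M \<le> y" "y / 2 \<le> real M" using y2 unfolding M_def by linarith+
    have M1: "1 \<le> M" using M y2 by linarith
    \<comment> \<open>Giving up has probability \<open>eps - 1 / x\<close>, which leaves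
      \<open>1 / x\<close> for decoding errors; with penalty \<open>x^2\<close> these are at most
      \<open>Y / x^2\<close>.\<close>
    define q where "q = 1 - eps + 1 / x"
    have ix: "1 / x \<le> eps" using elim(9) x1 eps by (simp add: field_simps)
    have q: "0 \<le> q" "q \<le> 1" using ix x1 eps by (auto simp: q_def)
    define Y where "Y = x - \<kappa> + 3"
    have achieves: "vlf_achievable W1 W2 ((1 - eps) * x) M eps"
    proof (rule achievable_at[OF W P0 C v B _ _ _ d0 dv l nx A'_def err'_def])
      show "(\<Sum>y\<in>UNIV. (out_dist W1 v y)\<^sup>2 / out_dist W1 P0 y) \<le> c0"
        "(\<Sum>y\<in>UNIV. (out_dist W2 v y)\<^sup>2 / out_dist W2 P0 y) \<le> c0" "0 \<le> c0"
        using c0 by (simp_all add: chi2_def)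
      show "2 * A' \<le> real T * d" using T0 by (simp add: d_def)
      have "(A' + err') / C \<le> (4 * B * S x + K1 * L x) / C"
        using err'_le C unfolding A' by (intro divide_right_mono) auto
      then show "(A' + err') / C + 1 \<le> real T" using elim(10) T by linarith
      show "0 < x\<^sup>2" using x1 by simp
      show "1 \<le> M" by (rule M1)
      show "0 \<le> q" "q \<le> 1" by (rule q)+
      have t1: "(real (n + 3 * T) + x\<^sup>2 + 2 * B * real n / C) * (real (4 * T + 6) * exp (- l)) \<le> 1"
      proof -
        have "(real (n + 3 * T) + x\<^sup>2 + 2 * B * real n / C) * (real (4 * T + 6) * exp (- l))
          \<le> (2 * x + x\<^sup>2 + 2 * B * x / C) * ((8 * p x + 6) * exp (- l))"
          using Nx nx T x1 B C
          by (intro mult_mono add_mono divide_right_mono mult_right_mono mult_left_mono) auto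
        then show ?thesis using elim(13) unfolding l_def by linarith
      qed
      have t2: "real M * x\<^sup>2 * (2 * real (T + 1) * real (n + 3 * T + 1) * exp (- (C * real (n + 2 * T)))) \<le> 1"
      proof -
        have "real M * x\<^sup>2 * (2 * real (T + 1) * real (n + 3 * T + 1) * exp (- \<gamma>))
          \<le> y * x\<^sup>2 * (2 * (2 * p x + 1) * (2 * x + 1) * exp (- \<gamma>))"
          using M T Nx y0 x1 by (intro mult_mono mult_right_mono mult_left_mono) auto
        also have "\<dots> = x\<^sup>2 / x ^ 5 * (2 * (2 * p x + 1) * (2 * x + 1))"
          using x1 by (simp add: y_def exp_minus field_simps)
        finally show ?thesis using elim(8) unfolding \<gamma>_def by linarith
      qed
      show "real (n + 2 * T) + err' / C + 1
        + (real (n + 3 * T) + x\<^sup>2 + 2 * B * real n / C) * (real (4 * T + 6) * exp (- l))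
        + real M * x\<^sup>2 * (2 * real (T + 1) * real (n + 3 * T + 1) * exp (- (C * real (n + 2 * T)))) \<le> Y"
        using t1 t2 n2T unfolding Y_def by simp
      have "q * Y = (1 - eps) * Y + Y / x"
        unfolding q_def distrib_right by simp
      also have "(1 - eps) * Y = (1 - eps) * x - 1"
        using eps by (simp add: Y_def \<kappa>_def right_diff_distrib)
      also have "Y / x \<le> 1" using x1 \<kappa>0 by (simp add: Y_def)
      finally show "q * Y \<le> (1 - eps) * x" by simp
      have "Y / x\<^sup>2 \<le> x / x\<^sup>2" using \<kappa>0 by (intro divide_right_mono) (auto simp: Y_def)
      also have "\<dots> = 1 / x" using x1 by (simp add: power2_eq_square)
      finally have "q * (Y / x\<^sup>2) \<le> q * (1 / x)" using q by (intro mult_left_mono)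
      also have "\<dots> \<le> 1 * (1 / x)" using q x1 by (intro mult_right_mono) auto
      finally have "q * (Y / x\<^sup>2) \<le> 1 / x" by simp
      then show "1 - q + q * (Y / x\<^sup>2) \<le> eps" by (simp add: q_def)
    qed
    have "ln y - ln 2 = ln (y / 2)" using y0 by (simp add: ln_div)
    also have "\<dots> \<le> ln (real M)" using M y0 by (subst ln_le_cancel_iff) auto
    finally have "\<gamma> - 5 * ln x - ln 2 \<le> ln (real M)" using lny by linarith
    then have "C * x - (K1 + 1) * L x \<le> ln (real M)"
      using \<gamma> elim(15) by (simp add: algebra_simps)
    with achieves show ?case by blast
  qed
  then show ?thesis unfolding L_def using K1 by (intro exI[of _ "K1 + 1"]) auto
qed

theorem theorem8:
  fixes W1 W2 :: "'x::finite \<Rightarrow> 'y::finite \<Rightarrow> real" and Pstar :: "'x \<Rightarrow> real" and eps :: real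
  assumes "stochastic W1" and "stochastic W2"
    and "is_dist Pstar"
    and "min (mutual_info W1 Pstar) (mutual_info W2 Pstar) = cap_common W1 W2"
    and "\<forall>P. is_dist P \<and> min (mutual_info W1 P) (mutual_info W2 P) = cap_common W1 W2 \<longrightarrow> P = Pstar"
    and "\<forall>x. Pstar x > 0"
    and "disp W1 Pstar > 0" and "disp W2 Pstar > 0"
    and "cap_single W1 > cap_common W1 W2" and "cap_single W2 > cap_common W1 W2"
    and "0 < eps" and "eps < 1"
  shows "\<exists>K n0. \<forall>nbar::real. nbar \<ge> n0 \<longrightarrow>
           (\<exists>M. vlf_achievable W1 W2 nbar M eps \<and>
                ln (real M) \<ge> nbar * cap_common W1 W2 / (1 - eps) - K * nbar powr (1/3) * ln nbar)"
proof (cases "cap_common W1 W2 \<le> 0")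
  \<comment> \<open>Here the leading term is nonpositive, so \<open>M = 1\<close> with logarithm 0
    suffices.\<close>
  case True
  have "vlf_achievable W1 W2 nbar 1 eps \<and>
      nbar * cap_common W1 W2 / (1 - eps) - 0 * nbar powr (1/3) * ln nbar \<le> ln (real 1)"
    if "0 \<le> nbar" for nbar
    using trivial_code[OF assms(1,2) that] assms(11,12) True that
    by (simp add: divide_le_0_iff mult_le_0_iff)
  then show ?thesis by blast
next
  case False
  let ?C = "cap_common W1 W2"
  have pos: "\<And>x. 0 < Pstar x" using assms(6) by blast
  have C: "0 < ?C" using False by simp
  obtain v \<rho> where v: "mutual_info W1 Pstar = ?C" "mutual_info W2 Pstar = ?C"
    "(\<Sum>z\<in>UNIV. v z) = 0" "(\<Sum>z\<in>UNIV. v z * rel_info W1 Pstar z) = 1"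
    "(\<Sum>z\<in>UNIV. v z * rel_info W2 Pstar z) = - \<rho>" "0 < \<rho>"
    by (rule balancing_direction[OF assms(1-3) pos assms(4,9,10)])
  obtain K where K: "0 < K" "\<forall>\<^sub>F x in at_top. \<exists>M. vlf_achievable W1 W2 ((1 - eps) * x) M eps \<and>
      ?C * x - K * (x powr (1/3) * ln x) \<le> ln (real M)"
    using achievable_asymptotic[OF assms(1-3) pos v(1,2) C v(3-6) assms(11,12)] by blast
  \<comment> \<open>Substituting \<open>x = r * nbar\<close> rescales the error term; eventually
    this costs at most the factor \<open>2 * r powr (1/3)\<close>.\<close>
  define r where "r = 1 / (1 - eps)"
  have r: "0 < r" "(1 - eps) * r = 1" using assms(12) by (auto simp: r_def)
  have "filterlim (\<lambda>y. r * y) at_top at_top" using r(1) by real_asymp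
  from eventually_compose_filterlim[OF K(2) this]
  have "\<forall>\<^sub>F y in at_top. \<exists>M. vlf_achievable W1 W2 ((1 - eps) * (r * y)) M eps \<and>
      ?C * (r * y) - K * ((r * y) powr (1/3) * ln (r * y)) \<le> ln (real M)" .
  moreover have "\<forall>\<^sub>F y in at_top. (r * y) powr (1/3) * ln (r * y) \<le> 2 * r powr (1/3) * (y powr (1/3) * ln y)"
    using r(1) by real_asymp
  ultimately have "\<forall>\<^sub>F y in at_top. \<exists>M. vlf_achievable W1 W2 y M eps \<and>
      y * ?C / (1 - eps) - (K * (2 * r powr (1/3))) * y powr (1/3) * ln y \<le> ln (real M)"
  proof eventually_elim
    case (elim y)
    then obtain M where M: "vlf_achievable W1 W2 ((1 - eps) * (r * y)) M eps"
      "?C * (r * y) - K * ((r * y) powr (1/3) * ln (r * y)) \<le> ln (real M)" by blast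
    have "K * ((r * y) powr (1/3) * ln (r * y)) \<le> K * (2 * r powr (1/3) * (y powr (1/3) * ln y))"
      using elim(2) K(1) by (intro mult_left_mono) auto
    moreover have "?C * (r * y) = y * ?C / (1 - eps)" by (simp add: r_def)
    ultimately have "y * ?C / (1 - eps) - (K * (2 * r powr (1/3))) * y powr (1/3) * ln y \<le> ln (real M)"
      using M(2) by (simp add: mult.assoc)
    moreover have "(1 - eps) * (r * y) = y" unfolding mult.assoc[symmetric] r(2) by simp
    with M(1) have "vlf_achievable W1 W2 y M eps" by (simp only:)
    ultimately show ?case by blast
  qed
  then show ?thesis unfolding eventually_at_top_linorder by blast
qed

end
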